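(* Consider the long-memory dynamic factor model of the context, satisfying the conditions Model, Long memory, Pervasiveness, Memory structure across factors, Idiosyncratic component and Gap dominance. Then the Fourier coefficients of $\underline{\mathbf K}_{ni}(\theta)$ satisfy $$\left\|\mathbf K_{ni,h}\right\|=\mathcal O\left(|h|^{-1-\rho_q^{(q)}}\right),$$ where $\rho_q^{(q)}$ is the exponent defined recursively in the context.
   Context: Notation. $\Pi=(-\pi,\pi]$, $\iota$ is the imaginary unit, $L$ the lag operator, $^*$ conjugate transpose, $\|\cdot\|$, $\|\cdot\|_2$ the Euclidean norm of vectors and the operator norm of matrices. The spectral density matrix $\Sigma_Y$ of a zero-mean stationary vector process is defined by $E[Y_tY_{t-h}']=\int_\Pi e^{\iota h\theta}\Sigma_Y(\theta)\,d\theta$. Constants in the conditions and in $\mathcal O(\cdot)$ are independent of $n$ (and of $h$), the bound being for all sufficiently large $n$. Model. $x_{it}=\chi_{it}+\xi_{it}$, $\chi_{it}=\sum_{l=1}^q b_{il}(L)u_{lt}$, $i\in\mathbb N$, $t\in\mathbb Z$, with $q$ fixed. The vector $u_t=(u_{1t},\dots,u_{qt})'$ is orthonormal white noise with finite fourth moments, scaled so that its spectral density matrix is $I_q$. The filters $b_{il}$ may be two-sided and of infinite order, with square summable coefficients. For each $n$, $\xi_t=(\xi_{1t},\dots,\xi_{nt})'$ is zero-mean stationary, $\xi_{it}$ is independent of $u_{l,t-k}$ for all $i,l,t,k$, and $\xi_t=\sum_{m\in\mathbb Z}B_{\xi,m}\epsilon_{t-m}$ with $\epsilon_t$ an $n$-dimensional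 second-order white noise. Put $X_t=(x_{1t},\dots,x_{nt})'$; its spectral density is $\Sigma(\theta)=\Sigma_\chi(\theta)+\Sigma_\xi(\theta)$. Long memory. $b_{il}(L)=(1-L)^{-d_{il}}g_{il}(L)$ with $d_{il}\in[0,1/2)$ and $g_{il}$ a short-memory filter. Pervasiveness. Let $G(\theta)=[g_{il}(e^{-\iota\theta})]_{i\le n,\,l\le q}$ and $S(\theta)=\frac1nG^*(\theta)G(\theta)$. There are constants $0<s^-\le s^+<\infty$ with $s^-I_q\preceq S(\theta)\preceq s^+I_q$ for all $\theta\in\Pi$; $G$ is twice differentiable with $\|G^{(r)}(\theta)\|_2\le C_{G,r}\sqrt n$, $r=1,2$, and $\|G(\theta_2)-G(\theta_1)\|\le\sqrt n\,L_G|\theta_2-\theta_1|$. Memory structure across factors. $d_{il}=d_l$ depends only on the factor $l$, so $\Sigma_\chi(\theta)=G(\theta)\,\mathrm{diag}(|1-e^{-\iota\theta}|^{-2d_l})_{l\le q}\,G^*(\theta)$. The values in decreasing order are $d_{(1)}>\dots>d_{(q)}$. Idiosyncratic component. There are constants $\Lambda_\xi^-,\Lambda_\xi^+$ such that all eigenvalues of $\Sigma_\xi(\theta)$ lie in $[\Lambda_\xi^-,\Lambda_\xi^+]$ for all $\theta\in\Pi$; $\Sigma_\xi$ is twice differentiable, hence Lipschitz, on $\Pi$; and $\sup_{\|v_1\|_2=\dots=\|v_4\|_2=1}|\mathrm{cum}(v_1'\epsilon_t,v_2'\epsilon_t,v_3'\epsilon_t,v_4'\epsilon_t)|$ is bounded.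 Exponent and Gap dominance. Put $d_{(q+1)}=0$, $\alpha_{j_1j_2}=2|d_{(j_1)}-d_{(j_2)}|>0$, $\alpha_{0,j}=1$, $\rho_0^{(q)}=1$, and for $m=1,\dots,q$ $$\rho_m^{(q)}=\min\left\{\rho_{m-1}^{(q)},\ \alpha_{m,m+1},\ \min_{0\le l\le m-1}\left\{2\rho_l^{(q)}-\alpha_{l,m}\right\}\right\}.$$ Gap dominance: if $q\ge2$, $2\rho_l^{(q)}>\alpha_{l,m}$ for all $l=1,\dots,m-1$ and $m=2,\dots,q$. Eigenprojection row. Let $\mathbf p_j(\theta)$ be orthonormal row eigenvectors of $\Sigma(\theta)$ ($\mathbf p_j\Sigma=\lambda_j\mathbf p_j$, $\lambda_1\ge\dots\ge\lambda_n$), $p_{j,i}$ the $i$-th entry; $\underline{\mathbf K}_{ni}(\theta)=\sum_{j=1}^q\overline{p_{j,i}(\theta)}\,\mathbf p_j(\theta)$, and $\mathbf K_{ni,h}=\frac1{2\pi}\int_\Pi\underline{\mathbf K}_{ni}(\theta)e^{-\iota h\theta}d\theta$, $h\in\mathbb Z\setminus\{0\}$.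
   Formalization: "$\Sigma_\xi$ is twice differentiable, hence Lipschitz, on $\Pi$" is taken to mean: its $2\pi$-periodic version is twice differentiable, and the operator norms of its first and second derivatives are bounded by constants independent of $n$; without such bounds the claim fails. *)

theory Defs
  imports "HOL-Probability.Probability" "Jordan_Normal_Form.Schur_Decomposition"
begin

text \<open>
  Component indices (series \<open>i\<close>, factors \<open>l\<close>, eigenvalues \<open>j\<close>, matrix entries) start at 0 here, so
  the index range \<open>1..n\<close> becomes \<open>0..<n\<close>.  Only the ordered memory parameters \<open>d\<^sub>(\<^sub>j\<^sub>)\<close> and the
  exponents \<open>\<alpha>\<close>, \<open>\<rho>\<close> keep their 1-based (respectively 0-based) numbering.  The cross-section size \<open>n\<close>
  varies, hence vectors and matrices are those of Jordan_Normal_Form.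
\<close>

unbundle no vec_syntax
no_notation inner (infixl "\<bullet>" 70)

section \<open>Vectors and matrices\<close>

definition vnorm :: "'a::real_normed_vector Matrix.vec \<Rightarrow> real" where
  "vnorm v = L2_set (\<lambda>i. norm (v $ i)) {..<dim_vec v}"

text \<open>The supremum is over the closed unit ball so that it is also right for matrices without columns.\<close>

definition op_norm :: "complex mat \<Rightarrow> real" where
  "op_norm A = (SUP v\<in>{v \<in> carrier_vec (dim_col A). vnorm v \<le> 1}. vnorm (A *\<^sub>v v))"

definition psd :: "complex mat \<Rightarrow> bool" where
  "psd A \<longleftrightarrow> square_mat A \<and> mat_adjoint A = A \<and>
     (\<forall>v \<in> carrier_vec (dim_row A). 0 \<le> Re ((A *\<^sub>v v) \<bullet>c v))"

definition loewner_le :: "complex mat \<Rightarrow> complex mat \<Rightarrow> bool" where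
  "loewner_le A B \<longleftrightarrow> psd (B - A)"

definition mat_differentiable :: "nat \<Rightarrow> nat \<Rightarrow> (real \<Rightarrow> complex mat) \<Rightarrow> bool" where
  "mat_differentiable n m F \<longleftrightarrow>
     (\<forall>\<theta>. \<forall>i<n. \<forall>j<m. (\<lambda>t. F t $$ (i, j)) differentiable (at \<theta>))"

definition mat_deriv :: "nat \<Rightarrow> nat \<Rightarrow> (real \<Rightarrow> complex mat) \<Rightarrow> real \<Rightarrow> complex mat" where
  "mat_deriv n m F \<theta> = Matrix.mat n m (\<lambda>(i, j). vector_derivative (\<lambda>t. F t $$ (i, j)) (at \<theta>))"

definition mat_twice_differentiable :: "nat \<Rightarrow> nat \<Rightarrow> (real \<Rightarrow> complex mat) \<Rightarrow> bool" where
  "mat_twice_differentiable n m F \<longleftrightarrow> mat_differentiable n m F \<and> mat_differentiable n m (mat_deriv n m F)"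

section \<open>Second-order processes\<close>

text \<open>A real process \<open>Y i t \<omega>\<close> has component \<open>i\<close>, time \<open>t \<in> \<int>\<close> and sample point \<open>\<omega>\<close>; the vector
  process of dimension \<open>n\<close> consists of the components \<open>i < n\<close>.\<close>

type_synonym 'w process = "nat \<Rightarrow> int \<Rightarrow> 'w \<Rightarrow> real"

definition freq :: "real set" where "freq = {-pi<..pi}"

definition zero_mean_stationary :: "'w measure \<Rightarrow> nat \<Rightarrow> 'w process \<Rightarrow> bool" where
  "zero_mean_stationary M n Y \<longleftrightarrow>
     (\<forall>i<n. \<forall>t. Y i t \<in> borel_measurable M \<and> integrable M (\<lambda>\<omega>. (Y i t \<omega>)\<^sup>2) \<and> (LINT \<omega>|M. Y i t \<omega>) = 0) \<and>
     (\<forall>i<n. \<forall>j<n. \<forall>h s t.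
        (LINT \<omega>|M. Y i t \<omega> * Y j (t - h) \<omega>) = (LINT \<omega>|M. Y i s \<omega> * Y j (s - h) \<omega>))"

definition white_noise :: "'w measure \<Rightarrow> nat \<Rightarrow> 'w process \<Rightarrow> bool" where
  "white_noise M n Y \<longleftrightarrow> zero_mean_stationary M n Y \<and>
     (\<forall>i<n. \<forall>j<n. \<forall>s t. s \<noteq> t \<longrightarrow> (LINT \<omega>|M. Y i s \<omega> * Y j t \<omega>) = 0)"

text \<open>The normalisation has no factor \<open>1/(2\<pi>)\<close>: white noise with spectral density matrix \<open>I\<close> has
  covariance matrix \<open>2\<pi> I\<close>.\<close>

definition spectral_density :: "'w measure \<Rightarrow> nat \<Rightarrow> 'w process \<Rightarrow> (real \<Rightarrow> complex mat) \<Rightarrow> bool" where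
  "spectral_density M n Y Sig \<longleftrightarrow> zero_mean_stationary M n Y \<and>
     (\<forall>\<theta>\<in>freq. Sig \<theta> \<in> carrier_mat n n) \<and>
     (\<forall>i<n. \<forall>j<n. set_integrable lborel freq (\<lambda>\<theta>. Sig \<theta> $$ (i, j)) \<and>
        (\<forall>t h. complex_of_real (LINT \<omega>|M. Y i t \<omega> * Y j (t - h) \<omega>) =
           (LINT \<theta>:freq|lborel. cis (of_int h * \<theta>) * Sig \<theta> $$ (i, j))))"

definition has_mean_square_sum :: "'w measure \<Rightarrow> (int \<Rightarrow> 'w \<Rightarrow> real) \<Rightarrow> ('w \<Rightarrow> real) \<Rightarrow> bool" where
  "has_mean_square_sum M f Z \<longleftrightarrow> Z \<in> borel_measurable M \<and> integrable M (\<lambda>\<omega>. (Z \<omega>)\<^sup>2) \<and>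
     ((\<lambda>F. LINT \<omega>|M. (Z \<omega> - (\<Sum>k\<in>F. f k \<omega>))\<^sup>2) \<longlongrightarrow> 0) (finite_subsets_at_top UNIV)"

text \<open>Joint fourth cumulant, written through the centred variables (cumulants of order at least two
  do not change under shifts).\<close>

definition cum4 :: "'w measure \<Rightarrow> ('w \<Rightarrow> real) \<Rightarrow> ('w \<Rightarrow> real) \<Rightarrow> ('w \<Rightarrow> real) \<Rightarrow> ('w \<Rightarrow> real) \<Rightarrow> real" where
  "cum4 M a b c d =
     (let E = integral\<^sup>L M;
          a' = (\<lambda>\<omega>. a \<omega> - E a); b' = (\<lambda>\<omega>. b \<omega> - E b);
          c' = (\<lambda>\<omega>. c \<omega> - E c); d' = (\<lambda>\<omega>. d \<omega> - E d)
      in E (\<lambda>\<omega>. a' \<omega> * b' \<omega> * c' \<omega> * d' \<omega>)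
         - E (\<lambda>\<omega>. a' \<omega> * b' \<omega>) * E (\<lambda>\<omega>. c' \<omega> * d' \<omega>)
         - E (\<lambda>\<omega>. a' \<omega> * c' \<omega>) * E (\<lambda>\<omega>. b' \<omega> * d' \<omega>)
         - E (\<lambda>\<omega>. a' \<omega> * d' \<omega>) * E (\<lambda>\<omega>. b' \<omega> * c' \<omega>))"

section \<open>The long-memory dynamic factor model\<close>

text \<open>
  \<open>b i l k\<close> and \<open>g i l k\<close> are the lag-\<open>k\<close> coefficients of the filters \<open>b\<^sub>i\<^sub>l(L)\<close> and \<open>g\<^sub>i\<^sub>l(L)\<close>.
  The innovations \<open>eps n\<close> and filter matrices \<open>B n\<close> of the idiosyncratic part may depend on \<open>n\<close>, whereas
  \<open>x\<close>, \<open>\<chi>\<close>, \<open>\<xi>\<close> are single infinite arrays.  \<open>\<Sigma>\<^sub>\<chi>\<close> and \<open>\<Sigma>\<close> are infinite at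
  frequency 0, so nothing is said about them there.
\<close>

definition dfm_model ::
  "'w measure \<Rightarrow> nat \<Rightarrow> (nat \<Rightarrow> nat \<Rightarrow> int \<Rightarrow> real) \<Rightarrow> 'w process \<Rightarrow> 'w process \<Rightarrow> 'w process \<Rightarrow> 'w process
   \<Rightarrow> (nat \<Rightarrow> int \<Rightarrow> real mat) \<Rightarrow> (nat \<Rightarrow> 'w process)
   \<Rightarrow> (nat \<Rightarrow> real \<Rightarrow> complex mat) \<Rightarrow> (nat \<Rightarrow> real \<Rightarrow> complex mat) \<Rightarrow> (nat \<Rightarrow> real \<Rightarrow> complex mat) \<Rightarrow> bool" where
  "dfm_model M q b u \<chi> \<xi> x B eps Sig_chi Sig_xi Sig \<longleftrightarrow>
     prob_space M \<and>
     (\<forall>i t \<omega>. x i t \<omega> = \<chi> i t \<omega> + \<xi> i t \<omega>) \<and>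
     (\<forall>i. \<forall>l<q. (\<lambda>k. (b i l k)\<^sup>2) summable_on UNIV) \<and>
     (\<forall>i t. has_mean_square_sum M (\<lambda>k \<omega>. \<Sum>l<q. b i l k * u l (t - k) \<omega>) (\<chi> i t)) \<and>
     white_noise M q u \<and> spectral_density M q u (\<lambda>\<theta>. 1\<^sub>m q) \<and>
     (\<forall>l<q. \<forall>t. integrable M (\<lambda>\<omega>. (u l t \<omega>) ^ 4)) \<and>
     (\<forall>n. zero_mean_stationary M n \<xi>) \<and>
     (\<forall>i t. \<forall>l<q. \<forall>s. prob_space.indep_var M borel (\<xi> i t) borel (u l s)) \<and>
     (\<forall>n. white_noise M n (eps n) \<and> (\<forall>m. B n m \<in> carrier_mat n n) \<and>
        (\<forall>i<n. \<forall>t. has_mean_square_sum M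
           (\<lambda>m \<omega>. \<Sum>j<n. B n m $$ (i, j) * eps n j (t - m) \<omega>) (\<xi> i t))) \<and>
     (\<forall>n. spectral_density M n \<chi> (Sig_chi n) \<and> spectral_density M n \<xi> (Sig_xi n) \<and>
        spectral_density M n x (Sig n) \<and>
        (\<forall>\<theta>\<in>freq - {0}. Sig n \<theta> = Sig_chi n \<theta> + Sig_xi n \<theta>))"

text \<open>\<open>frac_coeff d j\<close> is the coefficient of \<open>z^j\<close> in the binomial series of \<open>(1 - z)^(-d)\<close>.
  A filter is short-memory if its coefficients are absolutely summable.\<close>

definition frac_coeff :: "real \<Rightarrow> nat \<Rightarrow> real" where
  "frac_coeff d j = (- 1) ^ j * ((- d) gchoose j)"

definition long_memory ::
  "nat \<Rightarrow> (nat \<Rightarrow> nat \<Rightarrow> int \<Rightarrow> real) \<Rightarrow> (nat \<Rightarrow> nat \<Rightarrow> real) \<Rightarrow> (nat \<Rightarrow> nat \<Rightarrow> int \<Rightarrow> real) \<Rightarrow> bool" where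
  "long_memory q b dd g \<longleftrightarrow> (\<forall>i. \<forall>l<q.
     0 \<le> dd i l \<and> dd i l < 1/2 \<and>
     (\<lambda>k. \<bar>g i l k\<bar>) summable_on UNIV \<and>
     (\<forall>k. b i l k = (\<Sum>j. frac_coeff (dd i l) j * g i l (k - int j))))"

definition G_mat :: "nat \<Rightarrow> (nat \<Rightarrow> nat \<Rightarrow> int \<Rightarrow> real) \<Rightarrow> nat \<Rightarrow> real \<Rightarrow> complex mat" where
  "G_mat q g n \<theta> = Matrix.mat n q
     (\<lambda>(i, l). \<Sum>\<^sub>\<infinity>k\<in>UNIV. complex_of_real (g i l k) * cis (- (of_int k * \<theta>)))"

definition S_mat :: "nat \<Rightarrow> (nat \<Rightarrow> nat \<Rightarrow> int \<Rightarrow> real) \<Rightarrow> nat \<Rightarrow> real \<Rightarrow> complex mat" where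
  "S_mat q g n \<theta> = complex_of_real (1 / real n) \<cdot>\<^sub>m (mat_adjoint (G_mat q g n \<theta>) * G_mat q g n \<theta>)"

text \<open>The bounds are for all large \<open>n\<close>; the lower one cannot hold for \<open>n < q\<close>, where \<open>S\<close> is singular.\<close>

definition pervasiveness :: "nat \<Rightarrow> (nat \<Rightarrow> nat \<Rightarrow> int \<Rightarrow> real) \<Rightarrow> bool" where
  "pervasiveness q g \<longleftrightarrow>
     (\<forall>n. mat_twice_differentiable n q (G_mat q g n)) \<and>
     (\<exists>s_lo s_up C1 C2 L_G. 0 < s_lo \<and> s_lo \<le> s_up \<and>
       (\<forall>\<^sub>F n in sequentially.
          (\<forall>\<theta>\<in>freq. loewner_le (complex_of_real s_lo \<cdot>\<^sub>m 1\<^sub>m q) (S_mat q g n \<theta>) \<and>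
                    loewner_le (S_mat q g n \<theta>) (complex_of_real s_up \<cdot>\<^sub>m 1\<^sub>m q)) \<and>
          (\<forall>\<theta>\<in>freq. op_norm (mat_deriv n q (G_mat q g n) \<theta>) \<le> C1 * sqrt (real n)) \<and>
          (\<forall>\<theta>\<in>freq. op_norm (mat_deriv n q (mat_deriv n q (G_mat q g n)) \<theta>) \<le> C2 * sqrt (real n)) \<and>
          (\<forall>\<theta>\<^sub>1\<in>freq. \<forall>\<theta>\<^sub>2\<in>freq.
             op_norm (G_mat q g n \<theta>\<^sub>2 - G_mat q g n \<theta>\<^sub>1) \<le> sqrt (real n) * L_G * \<bar>\<theta>\<^sub>2 - \<theta>\<^sub>1\<bar>)))"

text \<open>\<open>d_ord q d j\<close> is \<open>d\<^sub>(\<^sub>j\<^sub>)\<close>, the \<open>j\<close>-th largest of the \<open>q\<close> memory parameters, with \<open>d\<^sub>(\<^sub>q\<^sub>+\<^sub>1\<^sub>) = 0\<close>.\<close>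

definition d_ord :: "nat \<Rightarrow> (nat \<Rightarrow> real) \<Rightarrow> nat \<Rightarrow> real" where
  "d_ord q d j = (if 1 \<le> j \<and> j \<le> q then rev (sort (map d [0..<q])) ! (j - 1) else 0)"

definition memory_structure ::
  "nat \<Rightarrow> (nat \<Rightarrow> nat \<Rightarrow> real) \<Rightarrow> (nat \<Rightarrow> nat \<Rightarrow> int \<Rightarrow> real) \<Rightarrow> (nat \<Rightarrow> real)
   \<Rightarrow> (nat \<Rightarrow> real \<Rightarrow> complex mat) \<Rightarrow> bool" where
  "memory_structure q dd g d Sig_chi \<longleftrightarrow>
     (\<forall>i. \<forall>l<q. dd i l = d l) \<and>
     (\<forall>n. \<forall>\<theta>\<in>freq - {0}. Sig_chi n \<theta> =
        G_mat q g n \<theta> * mat_diag q (\<lambda>l. complex_of_real (cmod (1 - cis (- \<theta>)) powr (- 2 * d l)))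
          * mat_adjoint (G_mat q g n \<theta>)) \<and>
     (\<forall>j. 1 \<le> j \<and> j < q \<longrightarrow> d_ord q d j > d_ord q d (j + 1))"

text \<open>\<open>\<Pi>\<close> is read as the circle, i.e. \<open>\<Sigma>\<^sub>\<xi>\<close> is the \<open>2\<pi>\<close>-periodic version, and the regularity is
  uniform in \<open>n\<close>: the derivatives up to order two have \<open>n\<close>-free bounds, which is what makes
  \<open>\<Sigma>\<^sub>\<xi>\<close> Lipschitz with an \<open>n\<close>-free constant.\<close>

definition idiosyncratic :: "'w measure \<Rightarrow> (nat \<Rightarrow> 'w process) \<Rightarrow> (nat \<Rightarrow> real \<Rightarrow> complex mat) \<Rightarrow> bool" where
  "idiosyncratic M eps Sig_xi \<longleftrightarrow>
     (\<exists>\<Lambda>_lo \<Lambda>_up. \<forall>n. \<forall>\<theta>\<in>freq. \<forall>k. eigenvalue (Sig_xi n \<theta>) k \<longrightarrow> k \<in> complex_of_real ` {\<Lambda>_lo..\<Lambda>_up}) \<and>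
     (\<forall>n \<theta>. Sig_xi n (\<theta> + 2 * pi) = Sig_xi n \<theta>) \<and>
     (\<forall>n. mat_twice_differentiable n n (Sig_xi n)) \<and>
     (\<exists>C1 C2. \<forall>n. \<forall>\<theta>\<in>freq.
        op_norm (mat_deriv n n (Sig_xi n) \<theta>) \<le> C1 \<and>
        op_norm (mat_deriv n n (mat_deriv n n (Sig_xi n)) \<theta>) \<le> C2) \<and>
     (\<forall>n. \<forall>i<n. \<forall>t. integrable M (\<lambda>\<omega>. (eps n i t \<omega>) ^ 4)) \<and>
     (\<exists>C. \<forall>n t. \<forall>v\<^sub>1 \<in> carrier_vec n. \<forall>v\<^sub>2 \<in> carrier_vec n. \<forall>v\<^sub>3 \<in> carrier_vec n. \<forall>v\<^sub>4 \<in> carrier_vec n.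
        vnorm v\<^sub>1 = 1 \<and> vnorm v\<^sub>2 = 1 \<and> vnorm v\<^sub>3 = 1 \<and> vnorm v\<^sub>4 = 1 \<longrightarrow>
        \<bar>cum4 M (\<lambda>\<omega>. v\<^sub>1 \<bullet> Matrix.vec n (\<lambda>i. eps n i t \<omega>)) (\<lambda>\<omega>. v\<^sub>2 \<bullet> Matrix.vec n (\<lambda>i. eps n i t \<omega>))
                (\<lambda>\<omega>. v\<^sub>3 \<bullet> Matrix.vec n (\<lambda>i. eps n i t \<omega>)) (\<lambda>\<omega>. v\<^sub>4 \<bullet> Matrix.vec n (\<lambda>i. eps n i t \<omega>))\<bar> \<le> C)"

definition gap :: "nat \<Rightarrow> (nat \<Rightarrow> real) \<Rightarrow> nat \<Rightarrow> nat \<Rightarrow> real" where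
  "gap q d j k = (if j = 0 then 1 else 2 * \<bar>d_ord q d j - d_ord q d k\<bar>)"

fun rho :: "nat \<Rightarrow> (nat \<Rightarrow> real) \<Rightarrow> nat \<Rightarrow> real" where
  "rho q d 0 = 1"
| "rho q d (Suc m) = Min ({rho q d m, gap q d (Suc m) (Suc (Suc m))} \<union>
     (\<lambda>l. 2 * rho q d l - gap q d l (Suc m)) ` {0..m})"

definition gap_dominance :: "nat \<Rightarrow> (nat \<Rightarrow> real) \<Rightarrow> bool" where
  "gap_dominance q d \<longleftrightarrow>
     (2 \<le> q \<longrightarrow> (\<forall>m\<in>{2..q}. \<forall>l\<in>{1..m - 1}. 2 * rho q d l > gap q d l m))"

section \<open>Eigenprojection rows\<close>

definition ordered_row_eigenbasis ::
  "nat \<Rightarrow> complex mat \<Rightarrow> (nat \<Rightarrow> real) \<Rightarrow> (nat \<Rightarrow> complex Matrix.vec) \<Rightarrow> bool" where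
  "ordered_row_eigenbasis n A lam p \<longleftrightarrow>
     (\<forall>j<n. p j \<in> carrier_vec n \<and>
        mat_of_row (p j) * A = complex_of_real (lam j) \<cdot>\<^sub>m mat_of_row (p j)) \<and>
     (\<forall>j<n. \<forall>k<n. p j \<bullet>c p k = (if j = k then 1 else 0)) \<and>
     (\<forall>j k. j \<le> k \<and> k < n \<longrightarrow> lam k \<le> lam j)"

definition K_row ::
  "nat \<Rightarrow> (nat \<Rightarrow> nat \<Rightarrow> real \<Rightarrow> complex Matrix.vec) \<Rightarrow> nat \<Rightarrow> nat \<Rightarrow> real \<Rightarrow> complex Matrix.vec" where
  "K_row q p n i \<theta> = Matrix.vec n (\<lambda>k. \<Sum>j<q. cnj (p n j \<theta> $ i) * p n j \<theta> $ k)"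

definition K_coeff ::
  "nat \<Rightarrow> (nat \<Rightarrow> nat \<Rightarrow> real \<Rightarrow> complex Matrix.vec) \<Rightarrow> nat \<Rightarrow> nat \<Rightarrow> int \<Rightarrow> complex Matrix.vec" where
  "K_coeff q p n i h = Matrix.vec n (\<lambda>k.
     complex_of_real (1 / (2 * pi)) *
       (LINT \<theta>:freq|lborel. K_row q p n i \<theta> $ k * cis (- (of_int h * \<theta>))))"

end

theory Submission
  imports Defs "Jordan_Normal_Form.Spectral_Radius"
begin

text \<open>
  Write \<open>\<Sigma> = G D G\<^sup>* + \<Xi>\<close> with \<open>D = diag(|1 - e\<^sup>-\<^sup>i\<^sup>\<theta>|\<^sup>-\<^sup>2\<^sup>d)\<close>, \<open>\<Xi>\<close> the
  idiosyncratic part, and let \<open>P(\<theta>)\<close> be the orthogonal projection onto the span of the \<open>q\<close> leading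
  eigenvectors.  The vector \<open>K_row\<close> is the \<open>i\<close>-th row of \<open>P\<close>, so the claim is that the Fourier coefficients
  of the rows of \<open>P\<close> decay at a rate that does not see \<open>n\<close>.  The projection is treated as a whole and
  not factor by factor.

  Let \<open>s = 2 d\<^sub>(\<^sub>q\<^sub>)\<close>, the last gap \<open>\<alpha>\<close> between consecutive memory parameters.  By its recursion
  \<open>\<rho>\<close> at \<open>q\<close> is at most this gap (lemma \<open>rho_le_last_gap\<close>), hence decay of order \<open>|h|\<^sup>-\<^sup>1\<^sup>-\<^sup>s\<close>
  suffices.  It follows from two bounds on the second difference of \<open>P\<close> at step \<open>\<eta> = \<pi> / |h|\<close>: order
  \<open>\<eta>\<^sup>s\<close> when \<open>|\<theta>| < 2 \<eta>\<close>, and order \<open>\<eta>\<^sup>2 |\<theta>|\<^sup>s\<^sup>-\<^sup>2\<close> when \<open>|\<theta>| \<ge> 2 \<eta>\<close>.  Indeed a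
  shift by \<open>\<eta>\<close> changes the sign of \<open>e\<^sup>-\<^sup>i\<^sup>h\<^sup>\<theta>\<close>, so \<open>-4\<close> times the \<open>h\<close>-th coefficient is the
  integral of the second difference against \<open>e\<^sup>-\<^sup>i\<^sup>h\<^sup>\<theta>\<close> (lemma \<open>fourier_coefficient_decay\<close>).

  Although \<open>D\<close> blows up at frequency 0, the projection depends on \<open>D\<close> only through the bounded matrix
  \<open>E = D\<^sup>-\<^sup>1 / n\<close>, whose entries behave like \<open>|\<theta>|\<^sup>2\<^sup>d / n\<close>.  After a shift of \<open>\<Xi>\<close> by a
  multiple of the identity, which leaves the eigenvectors alone, put \<open>R = \<Sigma>\<^sup>-\<^sup>1\<close>, \<open>g = G / \<surd>n\<close>,
  \<open>W = n R g D\<close> and \<open>V = n D g\<^sup>* R\<close>.  These are bounded uniformly in \<open>n\<close> and \<open>\<theta>\<close>, and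
  \<open>R\<^sub>1 - R\<^sub>2 = R\<^sub>1 (g\<^sub>2 - g\<^sub>1) V\<^sub>2 + W\<^sub>1 (E\<^sub>1 - E\<^sub>2) V\<^sub>2 + W\<^sub>1 (g\<^sub>2\<^sup>* - g\<^sub>1\<^sup>*) R\<^sub>2 + R\<^sub>1 (\<Xi>\<^sub>2 - \<Xi>\<^sub>1) R\<^sub>2\<close>,
  an identity without \<open>D\<close> (lemma \<open>bordered_resolvent_difference\<close>).  So the first and second differences
  of \<open>R\<close> are controlled by those of \<open>g\<close>, \<open>E\<close> and \<open>\<Xi>\<close>.  Pervasiveness puts the \<open>q\<close> leading
  eigenvalues of \<open>\<Sigma>\<close> above a multiple of \<open>n\<close> and the others below a constant (lemmas \<open>lam_top\<close>, \<open>lam_bulk\<close>); thus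
  \<open>P\<close> is the spectral projection of \<open>R\<close> belonging to an isolated group of eigenvalues near 0, and the
  differences of \<open>P\<close> are controlled by those of \<open>R\<close> through a Sylvester equation (lemmas
  \<open>projection_difference_bound\<close>, \<open>projection_second_difference_bound\<close>).  All steps are finite-difference
  algebra in a normed algebra of operators; derivatives occur only for the given functions \<open>G\<close>,
  \<open>\<Xi>\<close> and \<open>|1 - e\<^sup>-\<^sup>i\<^sup>\<theta>|\<^sup>2\<^sup>d\<close>.
\<close>

unbundle no vec_syntax
no_notation inner (infixl "\<bullet>" 70)

section \<open>Perturbation of an isolated spectral projection\<close>

text \<open>
  \<open>P\<close> is the spectral projection of \<open>R\<close> for its small eigenvalues: on the range of \<open>P\<close> the norm of \<open>R\<close>
  is at most \<open>1 / (2 \<kappa>)\<close>, and on the complementary range \<open>R\<close> is inverted by \<open>T\<close> with norm at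
  most \<open>\<kappa>\<close>.  Stating the gap by the norms of \<open>R P\<close> and \<open>T\<close> lets it act from the left and from the
  right alike.  The unit \<open>e\<close> is only a unit for the elements at hand: for \<open>n\<close>-by-\<open>n\<close>
  matrices it is the identity of that size inside an algebra that contains all sizes.
\<close>

locale spectral_split =
  fixes \<kappa> :: real and e R P T :: "'a::real_normed_algebra"
  assumes idem: "P * P = P" and unit_P: "e * P = P" "P * e = P" and unit_e: "e * e = e"
    and unit_R: "e * R = R" "R * e = R"
    and commute: "R * P = P * R"
    and reduced_inverse: "T * R = e - P" "R * T = e - P"
    and norm_P: "norm P \<le> 1" and norm_Q: "norm (e - P) \<le> 1"
    and norm_T: "norm T \<le> \<kappa>" and small: "\<kappa> * norm (R * P) \<le> 1 / 2"
begin

lemma kappa_nonneg: "0 \<le> \<kappa>"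
  using norm_T norm_ge_zero order_trans by blast

lemma norm_le_R_mult:
  assumes "(e - P) * Z = Z"
  shows "norm Z \<le> \<kappa> * norm (R * Z)"
proof -
  have "Z = T * (R * Z)"
    using assms reduced_inverse by (simp flip: mult.assoc)
  then have "norm Z \<le> norm T * norm (R * Z)"
    using norm_mult_ineq by metis
  also have "\<dots> \<le> \<kappa> * norm (R * Z)"
    by (simp add: mult_right_mono norm_T)
  finally show ?thesis .
qed

lemma norm_le_mult_R:
  assumes "Z * (e - P) = Z"
  shows "norm Z \<le> \<kappa> * norm (Z * R)"
proof -
  have "Z = (Z * R) * T"
    using assms reduced_inverse by (simp add: mult.assoc)
  then have "norm Z \<le> norm (Z * R) * norm T"
    using norm_mult_ineq by metis
  also have "\<dots> \<le> norm (Z * R) * \<kappa>"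
    by (simp add: mult_left_mono norm_T)
  finally show ?thesis by (simp add: mult.commute)
qed

lemma small_R_mult:
  assumes "P * Z = Z"
  shows "\<kappa> * norm (R * Z) \<le> norm Z / 2"
proof -
  have "R * Z = R * P * Z"
    by (simp add: mult.assoc assms)
  then have "\<kappa> * norm (R * Z) \<le> \<kappa> * (norm (R * P) * norm Z)"
    by (simp add: kappa_nonneg mult_left_mono norm_mult_ineq)
  also have "\<dots> = \<kappa> * norm (R * P) * norm Z" by simp
  also have "\<dots> \<le> 1 / 2 * norm Z"
    by (rule mult_right_mono[OF small norm_ge_zero])
  finally show ?thesis by simp
qed

lemma small_mult_R:
  assumes "Z * P = Z"
  shows "\<kappa> * norm (Z * R) \<le> norm Z / 2"
proof -
  have "Z * R = Z * (R * P)"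
    by (metis assms commute mult.assoc)
  then have "\<kappa> * norm (Z * R) \<le> \<kappa> * (norm Z * norm (R * P))"
    by (simp add: kappa_nonneg mult_left_mono norm_mult_ineq)
  also have "\<dots> = \<kappa> * norm (R * P) * norm Z" by simp
  also have "\<dots> \<le> 1 / 2 * norm Z"
    by (rule mult_right_mono[OF small norm_ge_zero])
  finally show ?thesis by simp
qed

end

text \<open>
  \<open>Z \<mapsto> R\<^sub>1 Z - Z R\<^sub>2\<close> is bounded below on elements that map the large eigenspaces of one operator
  to the small eigenspaces of the other: one of the two terms is at least \<open>norm Z / \<kappa>\<close>, the other
  at most half of that.
\<close>

lemma sylvester_bound:
  assumes s1: "spectral_split \<kappa> e R1 P1 T1" and s2: "spectral_split \<kappa> e R2 P2 T2"
    and Z: "P1 * Z = Z \<and> Z * (e - P2) = Z \<or> (e - P1) * Z = Z \<and> Z * P2 = Z"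
    and x: "norm (R1 * Z - Z * R2) \<le> x"
  shows "norm Z \<le> 2 * \<kappa> * x"
proof -
  have \<kappa>: "0 \<le> \<kappa>" using s1 by (rule spectral_split.kappa_nonneg)
  from Z show ?thesis
  proof
    assume Z: "P1 * Z = Z \<and> Z * (e - P2) = Z"
    have "norm Z \<le> \<kappa> * norm (Z * R2)"
      using spectral_split.norm_le_mult_R[OF s2] Z by blast
    also have "\<dots> \<le> \<kappa> * (norm (R1 * Z) + x)"
      using x by (intro mult_left_mono \<kappa>) (smt (verit) norm_triangle_sub norm_minus_commute)
    finally show ?thesis
      using spectral_split.small_R_mult[OF s1, of Z] Z by (simp add: algebra_simps)
  next
    assume Z: "(e - P1) * Z = Z \<and> Z * P2 = Z"
    have "norm Z \<le> \<kappa> * norm (R1 * Z)"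
      using spectral_split.norm_le_R_mult[OF s1] Z by blast
    also have "\<dots> \<le> \<kappa> * (norm (Z * R2) + x)"
      using x by (intro mult_left_mono \<kappa>) (smt (verit) norm_triangle_sub)
    finally show ?thesis
      using spectral_split.small_mult_R[OF s2, of Z] Z by (simp add: algebra_simps)
  qed
qed

lemma norm_mult_le:
  fixes a b :: "'a::real_normed_algebra"
  assumes "norm a \<le> x" "norm b \<le> y"
  shows "norm (a * b) \<le> x * y"
  by (meson assms mult_mono norm_ge_zero norm_mult_ineq order_trans)

text \<open>
  \<open>P\<^sub>1 - P\<^sub>2\<close> is the difference of the two mixed products \<open>P\<^sub>1 (e - P\<^sub>2)\<close> and \<open>(e - P\<^sub>1) P\<^sub>2\<close>, and each
  of them solves a Sylvester equation whose right-hand side contains \<open>R\<^sub>1 - R\<^sub>2\<close>.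
\<close>

lemma projection_difference_bound:
  assumes s1: "spectral_split \<kappa> e R1 P1 T1" and s2: "spectral_split \<kappa> e R2 P2 T2"
  shows "norm (P1 - P2) \<le> 4 * \<kappa> * norm (R1 - R2)"
proof -
  note a1 = spectral_split.idem[OF s1] spectral_split.unit_P[OF s1] spectral_split.unit_e[OF s1]
    spectral_split.unit_R[OF s1]
  note a2 = spectral_split.idem[OF s2] spectral_split.unit_P[OF s2]
    spectral_split.unit_R[OF s2]
  let ?Z = "P1 * (e - P2)" and ?Y = "(e - P1) * P2"
  have "R1 * ?Z - ?Z * R2 = P1 * (R1 - R2) * (e - P2)"
    using spectral_split.commute[OF s1] spectral_split.commute[OF s2]
    by (simp add: algebra_simps a1 a2) (simp flip: mult.assoc)
  then have 3: "norm (R1 * ?Z - ?Z * R2) \<le> 1 * norm (R1 - R2) * 1"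
    using spectral_split.norm_P[OF s1] spectral_split.norm_Q[OF s2]
    by (metis norm_mult_le order_refl)
  have "R1 * ?Y - ?Y * R2 = (e - P1) * (R1 - R2) * P2"
    using spectral_split.commute[OF s1] spectral_split.commute[OF s2]
    by (simp add: algebra_simps a1 a2) (simp flip: mult.assoc add: a1 a2)
  then have 4: "norm (R1 * ?Y - ?Y * R2) \<le> 1 * norm (R1 - R2) * 1"
    using spectral_split.norm_P[OF s2] spectral_split.norm_Q[OF s1]
    by (metis norm_mult_le order_refl)
  have 1: "norm ?Z \<le> 2 * \<kappa> * norm (R1 - R2)"
    by (rule sylvester_bound[OF s1 s2 _ 3[simplified]])
      (simp add: algebra_simps a1 a2 flip: mult.assoc, simp add: mult.assoc a2)
  have 2: "norm ?Y \<le> 2 * \<kappa> * norm (R1 - R2)"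
    by (rule sylvester_bound[OF s1 s2 _ 4[simplified]])
      (simp add: algebra_simps a1 a2 flip: mult.assoc, simp add: mult.assoc a2)
  have "P1 - P2 = ?Z - ?Y"
    by (simp add: algebra_simps a1 a2)
  then have "norm (P1 - P2) \<le> norm ?Z + norm ?Y"
    by (metis norm_triangle_ineq4)
  with 1 2 show ?thesis by simp
qed

text \<open>
  Split the second difference into blocks with respect to the central projection \<open>P\<close>.  Since the outer
  projections are idempotent, the two diagonal blocks are quadratic in the first differences.  The
  off-diagonal blocks solve Sylvester equations in which \<open>R\<^sub>1 + R\<^sub>2 - 2 R\<close> enters linearly and everything
  else is again a product of two first differences.
\<close>

lemma projection_second_difference_bound:
  assumes s0: "spectral_split \<kappa> e R P T"
    and s1: "spectral_split \<kappa> e R1 P1 T1" and s2: "spectral_split \<kappa> e R2 P2 T2"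
    and \<delta>: "norm (R1 - R) \<le> \<delta>" "norm (R2 - R) \<le> \<delta>"
    and \<epsilon>: "norm ((R1 - R) + (R2 - R)) \<le> \<epsilon>"
  shows "norm ((P1 - P) + (P2 - P)) \<le> 4 * \<kappa> * \<epsilon> + 128 * \<kappa>\<^sup>2 * \<delta>\<^sup>2"
proof -
  have \<kappa>: "0 \<le> \<kappa>" using s0 by (rule spectral_split.kappa_nonneg)
  define a b u v Q where "a = P1 - P" and "b = P2 - P" and "u = R1 - R" and "v = R2 - R"
    and "Q = e - P"
  note defs = a_def b_def u_def v_def Q_def
  define \<alpha> where "\<alpha> = 4 * \<kappa> * \<delta>"
  have na: "norm a \<le> \<alpha>" and nb: "norm b \<le> \<alpha>"
    using projection_difference_bound[OF s1 s0] projection_difference_bound[OF s2 s0] \<delta> \<kappa>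
    unfolding a_def b_def \<alpha>_def by (meson order_trans mult_left_mono mult_nonneg_nonneg zero_le_numeral)+
  have nu: "norm u \<le> \<delta>" and nv: "norm v \<le> \<delta>" and nuv: "norm (u + v) \<le> \<epsilon>"
    using \<delta> \<epsilon> by (simp_all add: u_def v_def)
  have nP: "norm P \<le> 1" and nQ: "norm Q \<le> 1"
    using spectral_split.norm_P[OF s0] spectral_split.norm_Q[OF s0] by (simp_all add: Q_def)
  note unit = spectral_split.unit_e[OF s0]
    spectral_split.unit_P[OF s0] spectral_split.unit_P[OF s1] spectral_split.unit_P[OF s2]
    spectral_split.unit_R[OF s0] spectral_split.unit_R[OF s1] spectral_split.unit_R[OF s2]
  note idem = spectral_split.idem[OF s0] spectral_split.idem[OF s1] spectral_split.idem[OF s2]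
  have idem': "P * (P * X) = P * X" "P1 * (P1 * X) = P1 * X" "P2 * (P2 * X) = P2 * X"
    "e * (e * X) = e * X" "P * (e * X) = P * X" "e * (P * X) = P * X"
    "e * (P1 * X) = P1 * X" "P1 * (e * X) = P1 * X" "e * (P2 * X) = P2 * X" "P2 * (e * X) = P2 * X"
    "e * (R * X) = R * X" "R * (e * X) = R * X"
    for X using idem unit by (simp_all flip: mult.assoc)
  note com = spectral_split.commute[OF s0] spectral_split.commute[OF s1] spectral_split.commute[OF s2]
  have com': "R * (P * X) = P * (R * X)" "R1 * (P1 * X) = P1 * (R1 * X)" "R2 * (P2 * X) = P2 * (R2 * X)"
    for X using com by (simp_all flip: mult.assoc)
  have PQ: "P * Q = 0" "Q * P = 0" "P * P = P" "Q * Q = Q" "P + Q = e" "R * Q = Q * R"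
    by (simp_all add: Q_def algebra_simps idem unit com)
  have diag: "norm (P * (a + b) * P) \<le> 2 * \<alpha>\<^sup>2" "norm (Q * (a + b) * Q) \<le> 2 * \<alpha>\<^sup>2"
  proof -
    have "P * (a + b) * P = - (P * (a * a) * P + P * (b * b) * P)"
      by (simp add: a_def b_def algebra_simps idem idem')
    then have "norm (P * (a + b) * P) \<le> norm (P * (a * a) * P) + norm (P * (b * b) * P)"
      by (metis norm_minus_cancel norm_triangle_ineq)
    also have "\<dots> \<le> 1 * (\<alpha> * \<alpha>) * 1 + 1 * (\<alpha> * \<alpha>) * 1"
      by (intro add_mono norm_mult_le na nb nP)
    finally show "norm (P * (a + b) * P) \<le> 2 * \<alpha>\<^sup>2" by (simp add: power2_eq_square)
    have "Q * (a + b) * Q = Q * (a * a) * Q + Q * (b * b) * Q"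
      by (simp add: a_def b_def Q_def algebra_simps idem idem' unit)
    then have "norm (Q * (a + b) * Q) \<le> norm (Q * (a * a) * Q) + norm (Q * (b * b) * Q)"
      by (metis norm_triangle_ineq)
    also have "\<dots> \<le> 1 * (\<alpha> * \<alpha>) * 1 + 1 * (\<alpha> * \<alpha>) * 1"
      by (intro add_mono norm_mult_le na nb nQ)
    finally show "norm (Q * (a + b) * Q) \<le> 2 * \<alpha>\<^sup>2" by (simp add: power2_eq_square)
  qed
  \<comment> \<open>Each outer projection commutes with its own operator, so its commutator with \<open>R\<close> is the commutator
      with \<open>-u\<close> (respectively \<open>-v\<close>); \<open>w\<close> is the part of it that is quadratic in first differences.\<close>
  define w where "w = (a * u - u * a) + (b * v - v * b)"
  have nw: "norm w \<le> 4 * (\<alpha> * \<delta>)"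
  proof -
    have "norm w \<le> (norm (a * u) + norm (u * a)) + (norm (b * v) + norm (v * b))"
      unfolding w_def by (intro norm_triangle_le add_mono norm_triangle_ineq4)
    also have "\<dots> \<le> (\<alpha> * \<delta> + \<delta> * \<alpha>) + (\<alpha> * \<delta> + \<delta> * \<alpha>)"
      by (intro add_mono norm_mult_le na nb nu nv)
    finally show ?thesis by simp
  qed
  have key: "R * (a + b) - (a + b) * R = w + (P * (u + v) - (u + v) * P)"
    by (simp add: w_def defs algebra_simps com)
  have comm: "X * (R * (a + b) - (a + b) * R) * Y = X * w * Y + (X * P * (u + v) * Y - X * (u + v) * P * Y)" for X Y
    unfolding key by (simp add: algebra_simps)
  have off1: "norm (P * (a + b) * Q) \<le> 2 * \<kappa> * (4 * (\<alpha> * \<delta>) + \<epsilon>)"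
  proof (rule sylvester_bound[OF s0 s0])
    show "P * (P * (a + b) * Q) = P * (a + b) * Q \<and> P * (a + b) * Q * (e - P) = P * (a + b) * Q
        \<or> (e - P) * (P * (a + b) * Q) = P * (a + b) * Q \<and> P * (a + b) * Q * P = P * (a + b) * Q"
      using PQ by (simp add: mult.assoc flip: Q_def mult.assoc[of P P])
    have "R * (P * (a + b) * Q) - P * (a + b) * Q * R = P * (R * (a + b) - (a + b) * R) * Q"
      using PQ com by (simp add: algebra_simps com')
    also have "\<dots> = P * w * Q + P * (u + v) * Q"
      unfolding comm using PQ by (simp add: mult.assoc idem')
    finally have "norm (R * (P * (a + b) * Q) - P * (a + b) * Q * R)
        \<le> norm (P * w * Q) + norm (P * (u + v) * Q)"
      by (metis norm_triangle_ineq)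
    also have "\<dots> \<le> 1 * (4 * (\<alpha> * \<delta>)) * 1 + 1 * \<epsilon> * 1"
      by (intro add_mono norm_mult_le nw nuv nP nQ)
    finally show "norm (R * (P * (a + b) * Q) - P * (a + b) * Q * R) \<le> 4 * (\<alpha> * \<delta>) + \<epsilon>" by simp
  qed
  have off2: "norm (Q * (a + b) * P) \<le> 2 * \<kappa> * (4 * (\<alpha> * \<delta>) + \<epsilon>)"
  proof (rule sylvester_bound[OF s0 s0])
    have QQ: "Q * (Q * X) = Q * X" for X using PQ by (simp flip: mult.assoc)
    show "P * (Q * (a + b) * P) = Q * (a + b) * P \<and> Q * (a + b) * P * (e - P) = Q * (a + b) * P
        \<or> (e - P) * (Q * (a + b) * P) = Q * (a + b) * P \<and> Q * (a + b) * P * P = Q * (a + b) * P"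
      using PQ QQ by (simp add: mult.assoc flip: Q_def)
    have "R * (Q * (a + b) * P) = R * Q * (a + b) * P" "Q * (a + b) * P * R = Q * (a + b) * (P * R)"
      by (simp_all only: mult.assoc)
    then have "R * (Q * (a + b) * P) = Q * (R * (a + b)) * P" "Q * (a + b) * P * R = Q * ((a + b) * R) * P"
      unfolding PQ(6) com(1)[symmetric] by (simp_all only: mult.assoc)
    then have "R * (Q * (a + b) * P) - Q * (a + b) * P * R = Q * (R * (a + b) - (a + b) * R) * P"
      by (simp only: right_diff_distrib left_diff_distrib)
    also have "\<dots> = Q * w * P - Q * (u + v) * P"
      unfolding comm using PQ by (simp add: mult.assoc idem')
    finally have "norm (R * (Q * (a + b) * P) - Q * (a + b) * P * R)
        \<le> norm (Q * w * P) + norm (Q * (u + v) * P)"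
      by (metis norm_triangle_ineq4)
    also have "\<dots> \<le> 1 * (4 * (\<alpha> * \<delta>)) * 1 + 1 * \<epsilon> * 1"
      by (intro add_mono norm_mult_le nw nuv nP nQ)
    finally show "norm (R * (Q * (a + b) * P) - Q * (a + b) * P * R) \<le> 4 * (\<alpha> * \<delta>) + \<epsilon>" by simp
  qed
  have "e * (a + b) * e = a + b"
    by (simp add: a_def b_def algebra_simps unit)
  then have "a + b = P * (a + b) * P + Q * (a + b) * Q + P * (a + b) * Q + Q * (a + b) * P"
    by (simp flip: PQ(5) add: algebra_simps)
  then have "norm (a + b) \<le> norm (P * (a + b) * P) + norm (Q * (a + b) * Q)
      + norm (P * (a + b) * Q) + norm (Q * (a + b) * P)"
    by (metis (no_types, opaque_lifting) norm_triangle_mono order_refl)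
  also have "\<dots> \<le> 2 * \<alpha>\<^sup>2 + 2 * \<alpha>\<^sup>2 + 2 * \<kappa> * (4 * (\<alpha> * \<delta>) + \<epsilon>) + 2 * \<kappa> * (4 * (\<alpha> * \<delta>) + \<epsilon>)"
    by (intro add_mono diag off1 off2)
  also have "\<dots> = 4 * \<kappa> * \<epsilon> + 128 * \<kappa>\<^sup>2 * \<delta>\<^sup>2"
    by (simp add: \<alpha>_def algebra_simps power2_eq_square)
  finally show ?thesis by (simp add: a_def b_def)
qed

section \<open>Differences of a bordered resolvent\<close>

text \<open>
  The relations satisfied by \<open>R = (g D g\<^sup>* + x)\<^sup>-\<^sup>1\<close>, \<open>E = D\<^sup>-\<^sup>1\<close>, \<open>W = R g D\<close>, \<open>V = D g\<^sup>* R\<close> when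
  \<open>D\<close> is no longer mentioned.  Equivalently, \<open>R\<close>, \<open>W\<close>, \<open>V\<close> are blocks of the inverse of the bordered
  matrix with rows \<open>(x, g)\<close> and \<open>(g\<^sup>*, -E)\<close>; this matrix and its inverse stay bounded when \<open>D\<close>
  tends to infinity.  The right inverse \<open>H\<close> of \<open>g\<^sup>*\<close> serves to bound the differences of \<open>W\<close>.
\<close>

locale bordered_resolvent =
  fixes K :: real and e f R g g' E x W V H :: "'a::real_normed_algebra"
  assumes R_unit: "e * R = R" "R * e = R" and W_unit: "W * f = W"
    and Rg: "R * g = W * E" and gR: "g' * R = E * V"
    and Wg: "W * g' = e - R * x" and gV: "g * V = e - x * R"
    and H: "g' * H = f"
    and bounds: "norm R \<le> K" "norm x \<le> K" "norm W \<le> K" "norm V \<le> K" "norm H \<le> K"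

lemma bordered_resolvent_difference:
  assumes r1: "bordered_resolvent K e f R1 g1 g1' E1 x1 W1 V1 H1"
    and r2: "bordered_resolvent K e f R2 g2 g2' E2 x2 W2 V2 H2"
  shows "R1 - R2 = R1 * (g2 - g1) * V2 + W1 * (E1 - E2) * V2 + W1 * (g2' - g1') * R2
    + R1 * (x2 - x1) * R2"
proof -
  have "R1 * (g2 - g1) * V2 = R1 * (g2 * V2) - (R1 * g1) * V2"
    by (simp add: algebra_simps)
  also have "\<dots> = R1 * (e - x2 * R2) - W1 * E1 * V2"
    by (simp only: bordered_resolvent.gV[OF r2] bordered_resolvent.Rg[OF r1])
  finally have 1: "R1 * (g2 - g1) * V2 = R1 * (e - x2 * R2) - W1 * E1 * V2" .
  have "W1 * (g2' - g1') * R2 = W1 * (g2' * R2) - (W1 * g1') * R2"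
    by (simp add: algebra_simps)
  also have "\<dots> = W1 * (E2 * V2) - (e - R1 * x1) * R2"
    by (simp only: bordered_resolvent.gR[OF r2] bordered_resolvent.Wg[OF r1])
  finally show ?thesis
    unfolding 1
    by (simp add: algebra_simps bordered_resolvent.R_unit[OF r1] bordered_resolvent.R_unit[OF r2])
qed

text \<open>
  For \<open>W\<close>, the relation \<open>W g\<^sup>* = e - R x\<close> gives the difference times \<open>g\<^sup>*\<close>, and \<open>H\<close> cancels \<open>g\<^sup>*\<close>.
\<close>

lemma bordered_resolvent_difference_bound:
  assumes r1: "bordered_resolvent K e f R1 g1 g1' E1 x1 W1 V1 H1"
    and r2: "bordered_resolvent K e f R2 g2 g2' E2 x2 W2 V2 H2"
    and \<delta>: "norm (g1 - g2) \<le> \<delta>" "norm (g1' - g2') \<le> \<delta>" "norm (E1 - E2) \<le> \<delta>" "norm (x1 - x2) \<le> \<delta>"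
    and K: "1 \<le> K"
  shows "norm (R1 - R2) \<le> 4 * K\<^sup>2 * \<delta>" and "norm (W1 - W2) \<le> 7 * K ^ 4 * \<delta>"
proof -
  note b1 = bordered_resolvent.bounds[OF r1] and b2 = bordered_resolvent.bounds[OF r2]
  have "norm (R1 - R2) \<le> norm (R1 * (g2 - g1) * V2) + norm (W1 * (E1 - E2) * V2)
      + norm (W1 * (g2' - g1') * R2) + norm (R1 * (x2 - x1) * R2)"
    unfolding bordered_resolvent_difference[OF r1 r2]
    by (intro norm_triangle_mono order_refl)
  also have "\<dots> \<le> K * \<delta> * K + K * \<delta> * K + K * \<delta> * K + K * \<delta> * K"
    by (intro add_mono norm_mult_le b1 b2 \<delta>) (use \<delta> in \<open>simp_all add: norm_minus_commute\<close>)
  finally show R: "norm (R1 - R2) \<le> 4 * K\<^sup>2 * \<delta>" by (simp add: power2_eq_square algebra_simps)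
  have \<delta>0: "0 \<le> \<delta>" using \<delta>(1) norm_ge_zero order_trans by blast
  have "(W1 - W2) * g2' = - (R1 * x1 - R2 * x2) - W1 * (g1' - g2')"
    using bordered_resolvent.Wg[OF r1] bordered_resolvent.Wg[OF r2] by (simp add: algebra_simps)
  also have "\<dots> = (R2 - R1) * x1 + R2 * (x2 - x1) + W1 * (g2' - g1')"
    by (simp add: algebra_simps)
  finally have "(W1 - W2) * (g2' * H2) = ((R2 - R1) * x1 + R2 * (x2 - x1) + W1 * (g2' - g1')) * H2"
    by (simp flip: mult.assoc)
  then have "W1 - W2 = ((R2 - R1) * x1 + R2 * (x2 - x1) + W1 * (g2' - g1')) * H2"
    by (simp add: bordered_resolvent.H[OF r2] bordered_resolvent.W_unit[OF r1]
        bordered_resolvent.W_unit[OF r2] left_diff_distrib)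
  moreover have "norm \<dots> \<le> (4 * K\<^sup>2 * \<delta> * K + K * \<delta> + K * \<delta>) * K"
    using R by (intro norm_mult_le norm_triangle_mono b1 b2) (use \<delta> in \<open>simp_all add: norm_minus_commute\<close>)
  ultimately have "norm (W1 - W2) \<le> (4 * K\<^sup>2 * \<delta> * K + K * \<delta> + K * \<delta>) * K"
    by simp
  also have "\<dots> = 4 * K ^ 4 * \<delta> + 2 * K\<^sup>2 * \<delta>"
    by (simp add: algebra_simps power2_eq_square power4_eq_xxxx)
  also have "\<dots> \<le> 4 * K ^ 4 * \<delta> + 3 * K ^ 4 * \<delta>"
    using K \<delta>0 by (intro add_mono mult_mono mult_right_mono power_increasing) auto
  finally show "norm (W1 - W2) \<le> 7 * K ^ 4 * \<delta>" by (simp add: algebra_simps)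
qed

text \<open>
  Both outer points are compared with the centre by \<open>bordered_resolvent_difference\<close>.  In each of its four
  terms the right factor is the central one; replacing the left factor by the central one costs a product
  of two first differences, and then the second difference of the middle factor remains.
\<close>

lemma bordered_resolvent_second_difference_bound:
  assumes r0: "bordered_resolvent K e f R g g' E x W V H"
    and r1: "bordered_resolvent K e f R1 g1 g1' E1 x1 W1 V1 H1"
    and r2: "bordered_resolvent K e f R2 g2 g2' E2 x2 W2 V2 H2"
    and \<delta>1: "norm (g1 - g) \<le> \<delta>" "norm (g1' - g') \<le> \<delta>" "norm (E1 - E) \<le> \<delta>" "norm (x1 - x) \<le> \<delta>"
    and \<delta>2: "norm (g2 - g) \<le> \<delta>" "norm (g2' - g') \<le> \<delta>" "norm (E2 - E) \<le> \<delta>" "norm (x2 - x) \<le> \<delta>"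
    and \<epsilon>: "norm ((g1 - g) + (g2 - g)) \<le> \<epsilon>" "norm ((g1' - g') + (g2' - g')) \<le> \<epsilon>"
      "norm ((E1 - E) + (E2 - E)) \<le> \<epsilon>" "norm ((x1 - x) + (x2 - x)) \<le> \<epsilon>"
    and K: "1 \<le> K"
  shows "norm ((R1 - R) + (R2 - R)) \<le> 4 * K\<^sup>2 * \<epsilon> + 56 * K ^ 5 * \<delta>\<^sup>2"
proof -
  have \<delta>0: "0 \<le> \<delta>" using \<delta>1(1) norm_ge_zero order_trans by blast
  define \<beta> where "\<beta> = 7 * K ^ 4 * \<delta>"
  have R\<beta>: "4 * K\<^sup>2 * \<delta> \<le> \<beta>"
    unfolding \<beta>_def using K \<delta>0 by (intro mult_right_mono mult_mono power_increasing) auto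
  note b0 = bordered_resolvent.bounds[OF r0]
  note d1 = bordered_resolvent_difference_bound[OF r1 r0 \<delta>1 K]
    and d2 = bordered_resolvent_difference_bound[OF r2 r0 \<delta>2 K]
  have bnd: "norm (R1 - R) \<le> \<beta>" "norm (R2 - R) \<le> \<beta>" "norm (W1 - W) \<le> \<beta>" "norm (W2 - W) \<le> \<beta>"
    using d1 d2 R\<beta> by (simp_all add: \<beta>_def)
  have split: "norm (A1 * X1 * Y + A2 * X2 * Y) \<le> K * \<epsilon> * K + \<beta> * \<delta> * K + \<beta> * \<delta> * K"
    if "norm A \<le> K" "norm Y \<le> K" "norm (A1 - A) \<le> \<beta>" "norm (A2 - A) \<le> \<beta>"
      "norm X1 \<le> \<delta>" "norm X2 \<le> \<delta>" "norm (X1 + X2) \<le> \<epsilon>" for A A1 A2 X1 X2 Y :: 'a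
  proof -
    have eq: "A1 * X1 * Y + A2 * X2 * Y = A * (X1 + X2) * Y + (A1 - A) * X1 * Y + (A2 - A) * X2 * Y"
      by (simp add: algebra_simps)
    show ?thesis
      unfolding eq by (intro norm_triangle_mono norm_mult_le that)
  qed
  have neg: "norm ((c - c1) + (c - c2)) \<le> \<epsilon>" if "norm ((c1 - c) + (c2 - c)) \<le> \<epsilon>" for c c1 c2 :: 'a
    using that norm_minus_cancel[of "(c1 - c) + (c2 - c)"] by (simp add: algebra_simps)
  have \<delta>1': "norm (g - g1) \<le> \<delta>" "norm (g' - g1') \<le> \<delta>" "norm (x - x1) \<le> \<delta>"
    and \<delta>2': "norm (g - g2) \<le> \<delta>" "norm (g' - g2') \<le> \<delta>" "norm (x - x2) \<le> \<delta>"
    using \<delta>1 \<delta>2 by (simp_all add: norm_minus_commute)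
  have "(R1 - R) + (R2 - R)
      = (R1 * (g - g1) * V + R2 * (g - g2) * V) + (W1 * (E1 - E) * V + W2 * (E2 - E) * V)
        + (W1 * (g' - g1') * R + W2 * (g' - g2') * R) + (R1 * (x - x1) * R + R2 * (x - x2) * R)"
    unfolding bordered_resolvent_difference[OF r1 r0] bordered_resolvent_difference[OF r2 r0]
    by (simp add: algebra_simps)
  also have "norm \<dots> \<le> (K * \<epsilon> * K + \<beta> * \<delta> * K + \<beta> * \<delta> * K) + (K * \<epsilon> * K + \<beta> * \<delta> * K + \<beta> * \<delta> * K)
        + (K * \<epsilon> * K + \<beta> * \<delta> * K + \<beta> * \<delta> * K) + (K * \<epsilon> * K + \<beta> * \<delta> * K + \<beta> * \<delta> * K)"
    by (intro norm_triangle_mono split[OF b0(1,4) bnd(1,2)] split[OF b0(3,4) bnd(3,4)]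
        split[OF b0(3,1) bnd(3,4)] split[OF b0(1,1) bnd(1,2)] \<delta>1 \<delta>1' \<delta>2 \<delta>2' \<epsilon> neg)
  also have "\<dots> = 4 * K\<^sup>2 * \<epsilon> + 56 * K ^ 5 * \<delta>\<^sup>2"
    by (simp add: \<beta>_def algebra_simps power2_eq_square eval_nat_numeral)
  finally show ?thesis .
qed

section \<open>Matrices of all sizes as operators on one space\<close>

text \<open>
  The bounds must be uniform in \<open>n\<close>, and the identities above are ring identities.  Both are convenient in
  one normed algebra that contains the matrices of every size: the bounded operators on the finitely
  supported sequences with the \<open>\<ell>\<^sup>2\<close> norm.
\<close>

typedef fvec = "{v :: nat \<Rightarrow> complex. finite {i. v i \<noteq> 0}}"
  morphisms coord Abs_fvec
  by (rule exI[of _ "\<lambda>_. 0"]) simp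

setup_lifting type_definition_fvec

lemma finite_support: "finite {i. coord v i \<noteq> 0}"
  using coord by simp

lemma fvec_eqI: "(\<And>i. coord v i = coord w i) \<Longrightarrow> v = w"
  by (metis coord_inject ext)

instantiation fvec :: real_normed_vector
begin

lift_definition zero_fvec :: fvec is "\<lambda>_. 0" by simp
lift_definition plus_fvec :: "fvec \<Rightarrow> fvec \<Rightarrow> fvec" is "\<lambda>v w i. v i + w i"
  subgoal for v w by (rule finite_subset[of _ "{i. v i \<noteq> 0} \<union> {i. w i \<noteq> 0}"]) auto
  done
lift_definition minus_fvec :: "fvec \<Rightarrow> fvec \<Rightarrow> fvec" is "\<lambda>v w i. v i - w i"
  subgoal for v w by (rule finite_subset[of _ "{i. v i \<noteq> 0} \<union> {i. w i \<noteq> 0}"]) auto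
  done
lift_definition uminus_fvec :: "fvec \<Rightarrow> fvec" is "\<lambda>v i. - v i" by simp
lift_definition scaleR_fvec :: "real \<Rightarrow> fvec \<Rightarrow> fvec" is "\<lambda>r v i. r *\<^sub>R v i"
  by (auto elim: rev_finite_subset)

definition norm_fvec :: "fvec \<Rightarrow> real" where
  "norm_fvec v = L2_set (\<lambda>i. cmod (coord v i)) {i. coord v i \<noteq> 0}"
definition sgn_fvec :: "fvec \<Rightarrow> fvec" where "sgn_fvec v = inverse (norm v) *\<^sub>R v"
definition dist_fvec :: "fvec \<Rightarrow> fvec \<Rightarrow> real" where "dist_fvec v w = norm (v - w)"
definition uniformity_fvec :: "(fvec \<times> fvec) filter" where
  "uniformity_fvec = (INF e\<in>{0 <..}. principal {(x, y). dist x y < e})"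
definition open_fvec :: "fvec set \<Rightarrow> bool" where
  "open_fvec U = (\<forall>x\<in>U. eventually (\<lambda>(x', y). x' = x \<longrightarrow> y \<in> U) uniformity)"

lemma norm_fvec_eq_L2_set:
  assumes "finite A" "{i. coord v i \<noteq> 0} \<subseteq> A"
  shows "norm v = L2_set (\<lambda>i. cmod (coord v i)) A"
  unfolding norm_fvec_def L2_set_def
  by (rule arg_cong[where f = sqrt], rule sum.mono_neutral_left) (use assms in auto)

instance
proof
  fix a b :: real and v w z :: fvec
  show "v + w + z = v + (w + z)" "v + w = w + v" "0 + v = v" "- v + v = 0" "v - w = v + - w"
    "a *\<^sub>R (v + w) = a *\<^sub>R v + a *\<^sub>R w" "(a + b) *\<^sub>R v = a *\<^sub>R v + b *\<^sub>R v"
    "a *\<^sub>R b *\<^sub>R v = (a * b) *\<^sub>R v" "1 *\<^sub>R v = v"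
    by (transfer, auto simp: algebra_simps)+
  show "dist v w = norm (v - w)" by (rule dist_fvec_def)
  show "sgn v = inverse (norm v) *\<^sub>R v" by (rule sgn_fvec_def)
  show "(norm v = 0) \<longleftrightarrow> v = 0"
  proof
    assume "norm v = 0"
    then have "\<forall>i\<in>{i. coord v i \<noteq> 0}. cmod (coord v i) = 0"
      unfolding norm_fvec_def by (simp only: L2_set_eq_0_iff[OF finite_support])
    then show "v = 0" by (intro fvec_eqI) (auto simp: zero_fvec.rep_eq)
  qed (simp add: norm_fvec_def zero_fvec.rep_eq)
  let ?A = "{i. coord v i \<noteq> 0} \<union> {i. coord w i \<noteq> 0}"
  have "norm (v + w) = L2_set (\<lambda>i. cmod (coord v i + coord w i)) ?A"
    by (subst norm_fvec_eq_L2_set[of ?A]) (auto simp: plus_fvec.rep_eq finite_support)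
  also have "\<dots> \<le> L2_set (\<lambda>i. cmod (coord v i) + cmod (coord w i)) ?A"
    by (intro L2_set_mono norm_triangle_ineq) auto
  also have "\<dots> \<le> L2_set (\<lambda>i. cmod (coord v i)) ?A + L2_set (\<lambda>i. cmod (coord w i)) ?A"
    by (rule L2_set_triangle_ineq)
  also have "\<dots> = norm v + norm w"
    by (simp add: norm_fvec_eq_L2_set[of ?A] finite_support)
  finally show "norm (v + w) \<le> norm v + norm w" .
  show "norm (a *\<^sub>R v) = \<bar>a\<bar> * norm v"
    by (simp add: norm_fvec_eq_L2_set[of "{i. coord v i \<noteq> 0}"] finite_support scaleR_fvec.rep_eq
        L2_set_right_distrib subset_eq)
  show "uniformity = (INF e\<in>{0 <..}. principal {(x, y :: fvec). dist x y < e})"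
    by (rule uniformity_fvec_def)
  show "open U = (\<forall>x\<in>U. eventually (\<lambda>(x', y). x' = x \<longrightarrow> y \<in> U) uniformity)" for U :: "fvec set"
    by (rule open_fvec_def)
qed

end

text \<open>
  A copy of the bounded linear maps of a space into itself, made so that composition can be the
  multiplication of a type class and the algebraic simplification rules apply.
\<close>

typedef (overloaded) 'a endo = "UNIV :: ('a::real_normed_vector \<Rightarrow>\<^sub>L 'a) set"
  morphisms blinfun_of Endo by simp

setup_lifting type_definition_endo

instantiation endo :: (real_normed_vector) real_normed_algebra
begin

lift_definition zero_endo :: "'a endo" is 0 .
lift_definition plus_endo :: "'a endo \<Rightarrow> 'a endo \<Rightarrow> 'a endo" is "(+)" .
lift_definition minus_endo :: "'a endo \<Rightarrow> 'a endo \<Rightarrow> 'a endo" is "(-)" .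
lift_definition uminus_endo :: "'a endo \<Rightarrow> 'a endo" is "uminus" .
lift_definition scaleR_endo :: "real \<Rightarrow> 'a endo \<Rightarrow> 'a endo" is "(*\<^sub>R)" .
lift_definition times_endo :: "'a endo \<Rightarrow> 'a endo \<Rightarrow> 'a endo" is "(o\<^sub>L)" .
lift_definition norm_endo :: "'a endo \<Rightarrow> real" is norm .

definition sgn_endo :: "'a endo \<Rightarrow> 'a endo" where "sgn_endo v = inverse (norm v) *\<^sub>R v"
definition dist_endo :: "'a endo \<Rightarrow> 'a endo \<Rightarrow> real" where "dist_endo v w = norm (v - w)"
definition uniformity_endo :: "('a endo \<times> 'a endo) filter" where
  "uniformity_endo = (INF e\<in>{0 <..}. principal {(x, y). dist x y < e})"
definition open_endo :: "'a endo set \<Rightarrow> bool" where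
  "open_endo U = (\<forall>x\<in>U. eventually (\<lambda>(x', y). x' = x \<longrightarrow> y \<in> U) uniformity)"

instance
proof
  fix a b :: real and v w z :: "'a endo"
  show "v + w + z = v + (w + z)" "v + w = w + v" "0 + v = v" "- v + v = 0" "v - w = v + - w"
    "a *\<^sub>R (v + w) = a *\<^sub>R v + a *\<^sub>R w" "(a + b) *\<^sub>R v = a *\<^sub>R v + b *\<^sub>R v"
    "a *\<^sub>R b *\<^sub>R v = (a * b) *\<^sub>R v" "1 *\<^sub>R v = v"
    by (transfer, auto simp: algebra_simps)+
  show "v * w * z = v * (w * z)" "(v + w) * z = v * z + w * z" "v * (w + z) = v * w + v * z"
    "a *\<^sub>R v * w = a *\<^sub>R (v * w)" "v * a *\<^sub>R w = a *\<^sub>R (v * w)"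
    by (transfer, auto intro!: blinfun_eqI simp: blinfun.bilinear_simps)+
  show "(norm v = 0) \<longleftrightarrow> v = 0" "norm (v + w) \<le> norm v + norm w" "norm (a *\<^sub>R v) = \<bar>a\<bar> * norm v"
    "norm (v * w) \<le> norm v * norm w"
    by (transfer, simp add: norm_triangle_ineq norm_blinfun_compose)+
qed (simp_all only: sgn_endo_def dist_endo_def uniformity_endo_def open_endo_def)

end


lift_definition to_fvec :: "complex Matrix.vec \<Rightarrow> fvec" is "\<lambda>v i. if i < dim_vec v then v $ i else 0"
  subgoal for v by (rule finite_subset[of _ "{..<dim_vec v}"]) auto
  done

definition of_fvec :: "nat \<Rightarrow> fvec \<Rightarrow> complex Matrix.vec" where
  "of_fvec n v = Matrix.vec n (coord v)"

lemma of_fvec_carrier [simp]: "of_fvec n v \<in> carrier_vec n" and dim_of_fvec [simp]: "dim_vec (of_fvec n v) = n"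
  by (simp_all add: of_fvec_def)

lemma of_fvec_to_fvec: "of_fvec (dim_vec v) (to_fvec v) = v"
  by (auto simp: of_fvec_def to_fvec.rep_eq)

lemma norm_to_fvec: "norm (to_fvec v) = vnorm v"
  by (subst norm_fvec_eq_L2_set[of "{..<dim_vec v}"])
    (auto simp: to_fvec.rep_eq vnorm_def split: if_splits intro!: L2_set_cong)

lemma vnorm_nonneg [simp]: "0 \<le> vnorm v"
  by (simp add: vnorm_def)

lemma vnorm_of_fvec_le: "vnorm (of_fvec n v) \<le> norm v"
proof -
  let ?A = "{i. coord v i \<noteq> 0} \<union> {..<n}"
  have "vnorm (of_fvec n v) = L2_set (\<lambda>i. cmod (coord v i)) {..<n}"
    by (simp add: vnorm_def of_fvec_def L2_set_def)
  also have "\<dots> \<le> L2_set (\<lambda>i. cmod (coord v i)) ?A"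
    unfolding L2_set_def by (intro real_sqrt_le_mono sum_mono2) (auto simp: finite_support)
  also have "\<dots> = norm v"
    by (rule norm_fvec_eq_L2_set[symmetric]) (auto simp: finite_support)
  finally show ?thesis .
qed

lemma norm_index_le_vnorm: "i < dim_vec v \<Longrightarrow> norm (v $ i) \<le> vnorm v"
  unfolding vnorm_def by (rule member_le_L2_set) auto

lemma vnorm_mult_mat_vec_le_sum:
  fixes A :: "complex mat"
  assumes "v \<in> carrier_vec (dim_col A)"
  shows "vnorm (A *\<^sub>v v) \<le> (\<Sum>i<dim_row A. \<Sum>j<dim_col A. cmod (A $$ (i, j))) * vnorm v"
proof -
  have "vnorm (A *\<^sub>v v) \<le> (\<Sum>i<dim_row A. cmod ((A *\<^sub>v v) $ i))"
    unfolding vnorm_def using L2_set_le_sum[of "{..<dim_row A}" "\<lambda>i. cmod ((A *\<^sub>v v) $ i)"] by simp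
  also have "\<dots> \<le> (\<Sum>i<dim_row A. (\<Sum>j<dim_col A. cmod (A $$ (i, j))) * vnorm v)"
  proof (rule sum_mono)
    fix i assume "i \<in> {..<dim_row A}"
    then have "cmod ((A *\<^sub>v v) $ i) \<le> (\<Sum>j<dim_col A. cmod (A $$ (i, j) * v $ j))"
      using assms by (auto simp: scalar_prod_def atLeast0LessThan intro: order_trans[OF norm_sum])
    also have "\<dots> \<le> (\<Sum>j<dim_col A. cmod (A $$ (i, j)) * vnorm v)"
      using assms by (auto simp: norm_mult intro!: sum_mono mult_left_mono norm_index_le_vnorm)
    finally show "cmod ((A *\<^sub>v v) $ i) \<le> (\<Sum>j<dim_col A. cmod (A $$ (i, j))) * vnorm v"
      by (simp add: sum_distrib_right)
  qed
  finally show ?thesis by (simp add: sum_distrib_right)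
qed

text \<open>
  A matrix acts on the first \<open>dim_col A\<close> coordinates and is zero on the others.  The map is additive,
  multiplicative for matching sizes, and isometric for the operator norm.
\<close>

lift_definition emb :: "complex mat \<Rightarrow> fvec endo" is
  "\<lambda>A. Blinfun (\<lambda>v. to_fvec (A *\<^sub>v of_fvec (dim_col A) v))" .

lemma bounded_linear_mult_mat_fvec: "bounded_linear (\<lambda>v. to_fvec (A *\<^sub>v of_fvec (dim_col A) v))"
proof (rule bounded_linear_intro)
  fix v w :: fvec and r :: real
  have 1: "of_fvec (dim_col A) (v + w) = of_fvec (dim_col A) v + of_fvec (dim_col A) w"
    by (auto simp: of_fvec_def plus_fvec.rep_eq)
  show "to_fvec (A *\<^sub>v of_fvec (dim_col A) (v + w))
      = to_fvec (A *\<^sub>v of_fvec (dim_col A) v) + to_fvec (A *\<^sub>v of_fvec (dim_col A) w)"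
    unfolding 1
    by (rule fvec_eqI) (simp add: plus_fvec.rep_eq to_fvec.rep_eq scalar_prod_add_distrib[of _ "dim_col A"])
  have 2: "of_fvec (dim_col A) (r *\<^sub>R v) = complex_of_real r \<cdot>\<^sub>v of_fvec (dim_col A) v"
    by (auto simp: of_fvec_def scaleR_fvec.rep_eq scaleR_conv_of_real)
  show "to_fvec (A *\<^sub>v of_fvec (dim_col A) (r *\<^sub>R v)) = r *\<^sub>R to_fvec (A *\<^sub>v of_fvec (dim_col A) v)"
    unfolding 2
    by (rule fvec_eqI) (simp add: scaleR_fvec.rep_eq to_fvec.rep_eq scaleR_conv_of_real)
  show "norm (to_fvec (A *\<^sub>v of_fvec (dim_col A) v))
      \<le> norm v * (\<Sum>i<dim_row A. \<Sum>j<dim_col A. cmod (A $$ (i, j)))"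
    unfolding norm_to_fvec
    by (rule order_trans[OF vnorm_mult_mat_vec_le_sum])
      (auto simp: mult.commute[of "norm v"] vnorm_of_fvec_le intro!: mult_left_mono sum_nonneg)
qed

lemma blinfun_of_emb: "blinfun_apply (blinfun_of (emb A)) v = to_fvec (A *\<^sub>v of_fvec (dim_col A) v)"
  by (simp add: emb.rep_eq bounded_linear_Blinfun_apply bounded_linear_mult_mat_fvec)

lemma emb_eqI:
  "(\<And>v. to_fvec (A *\<^sub>v of_fvec (dim_col A) v) = blinfun_apply (blinfun_of X) v) \<Longrightarrow> emb A = X"
  by (metis blinfun_eqI blinfun_of_emb blinfun_of_inject)

lemma vnorm_mult_mat_vec_le:
  assumes "v \<in> carrier_vec (dim_col A)"
  shows "vnorm (A *\<^sub>v v) \<le> norm (emb A) * vnorm v"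
proof -
  have "of_fvec (dim_col A) (to_fvec v) = v"
    using assms of_fvec_to_fvec[of v] by simp
  then show ?thesis
    using norm_blinfun[of "blinfun_of (emb A)" "to_fvec v"]
    by (simp add: blinfun_of_emb norm_to_fvec norm_endo.rep_eq)
qed

lemma norm_emb_le:
  assumes "0 \<le> c" "\<And>v. v \<in> carrier_vec (dim_col A) \<Longrightarrow> vnorm (A *\<^sub>v v) \<le> c * vnorm v"
  shows "norm (emb A) \<le> c"
  unfolding norm_endo.rep_eq
proof (rule norm_blinfun_bound)
  fix v
  have "vnorm (A *\<^sub>v of_fvec (dim_col A) v) \<le> c * vnorm (of_fvec (dim_col A) v)"
    by (rule assms(2)) simp
  also have "\<dots> \<le> c * norm v"
    by (simp add: assms(1) mult_left_mono vnorm_of_fvec_le)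
  finally show "norm (blinfun_apply (blinfun_of (emb A)) v) \<le> c * norm v"
    by (simp add: blinfun_of_emb norm_to_fvec)
qed (rule assms)

lemma emb_mult:
  assumes "dim_col A = dim_row B"
  shows "emb (A * B) = emb A * emb B"
proof (rule emb_eqI)
  fix v
  have "(A * B) *\<^sub>v of_fvec (dim_col B) v = A *\<^sub>v (B *\<^sub>v of_fvec (dim_col B) v)"
    using assms by (intro assoc_mult_mat_vec[of _ "dim_row A" "dim_col A" _ "dim_col B"]) auto
  moreover have "of_fvec (dim_row B) (to_fvec (B *\<^sub>v of_fvec (dim_col B) v)) = B *\<^sub>v of_fvec (dim_col B) v"
    using of_fvec_to_fvec[of "B *\<^sub>v of_fvec (dim_col B) v"] by simp
  ultimately show "to_fvec (A * B *\<^sub>v of_fvec (dim_col (A * B)) v) = blinfun_apply (blinfun_of (emb A * emb B)) v"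
    by (simp add: times_endo.rep_eq blinfun_of_emb assms)
qed

lemma emb_add:
  assumes "A \<in> carrier_mat n m" "B \<in> carrier_mat n m"
  shows "emb (A + B) = emb A + emb B"
  by (rule emb_eqI, rule fvec_eqI)
    (use assms in \<open>simp add: plus_endo.rep_eq blinfun.bilinear_simps blinfun_of_emb plus_fvec.rep_eq
      to_fvec.rep_eq add_scalar_prod_distrib[of _ m]\<close>)

lemma emb_smult: "emb (complex_of_real r \<cdot>\<^sub>m A) = r *\<^sub>R emb A"
  by (rule emb_eqI, rule fvec_eqI)
    (simp add: scaleR_endo.rep_eq blinfun.bilinear_simps blinfun_of_emb scaleR_fvec.rep_eq
      to_fvec.rep_eq scaleR_conv_of_real)

lemma emb_minus:
  assumes "A \<in> carrier_mat n m" "B \<in> carrier_mat n m"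
  shows "emb (A - B) = emb A - emb B"
proof -
  have eq: "A - B + B = A" and "A - B \<in> carrier_mat n m"
    using assms by auto
  from emb_add[OF this(2) assms(2)] show ?thesis
    by (simp add: eq)
qed

lemma op_norm_eq_norm_emb: "op_norm A = norm (emb A)"
proof (rule antisym)
  have le: "vnorm (A *\<^sub>v v) \<le> norm (emb A)" if "v \<in> carrier_vec (dim_col A)" "vnorm v \<le> 1" for v
    using vnorm_mult_mat_vec_le[OF that(1)] mult_left_mono[OF that(2), of "norm (emb A)"] by simp
  have zero: "vnorm (0\<^sub>v m :: complex Matrix.vec) = 0" for m by (simp add: vnorm_def L2_set_def)
  have "0\<^sub>v (dim_col A) \<in> {v :: complex Matrix.vec. v \<in> carrier_vec (dim_col A) \<and> vnorm v \<le> 1}"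
    by (simp add: zero)
  then have ne: "{v :: complex Matrix.vec. v \<in> carrier_vec (dim_col A) \<and> vnorm v \<le> 1} \<noteq> {}"
    by blast
  show "op_norm A \<le> norm (emb A)"
    unfolding op_norm_def by (rule cSUP_least[OF ne]) (use le in auto)
  have bdd: "bdd_above ((\<lambda>v. vnorm (A *\<^sub>v v)) ` {v \<in> carrier_vec (dim_col A). vnorm v \<le> 1})"
    by (rule bdd_aboveI2[of _ _ "norm (emb A)"]) (use le in auto)
  have unit: "vnorm (A *\<^sub>v v) \<le> op_norm A" if "v \<in> carrier_vec (dim_col A)" "vnorm v \<le> 1" for v
    unfolding op_norm_def by (rule cSUP_upper[OF _ bdd]) (use that in auto)
  have scale: "vnorm (complex_of_real r \<cdot>\<^sub>v v) = \<bar>r\<bar> * vnorm v" for r v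
    by (auto simp: vnorm_def norm_mult L2_set_right_distrib intro!: L2_set_cong)
  show "norm (emb A) \<le> op_norm A"
  proof (rule norm_emb_le)
    show "0 \<le> op_norm A"
      using order_trans[OF vnorm_nonneg unit[of "0\<^sub>v (dim_col A)"]] by (simp add: zero)
    fix v :: "complex Matrix.vec" assume v: "v \<in> carrier_vec (dim_col A)"
    show "vnorm (A *\<^sub>v v) \<le> op_norm A * vnorm v"
    proof (cases "vnorm v = 0")
      case True
      then show ?thesis using vnorm_mult_mat_vec_le[OF v] by simp
    next
      case False
      then have pos: "0 < vnorm v" using vnorm_nonneg[of v] by linarith
      have "vnorm (A *\<^sub>v (complex_of_real (1 / vnorm v) \<cdot>\<^sub>v v)) \<le> op_norm A"
        by (rule unit) (use v pos in \<open>simp_all only: scale smult_carrier_vec abs_of_pos\<close>, simp)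
      then have "vnorm (complex_of_real (1 / vnorm v) \<cdot>\<^sub>v (A *\<^sub>v v)) \<le> op_norm A"
        using mult_mat_vec[of A "dim_row A" "dim_col A" v] v by simp
      then show ?thesis using pos unfolding scale by (simp add: field_simps)
    qed
  qed
qed

section \<open>Adjoints and Hermitian matrices\<close>

lemma cscalar_prod_eq_sum: "v \<bullet>c w = (\<Sum>i<dim_vec w. v $ i * cnj (w $ i))"
  by (simp add: scalar_prod_def atLeast0LessThan conjugate_complex_def)

lemma cscalar_prod_self: "v \<bullet>c v = complex_of_real ((vnorm v)\<^sup>2)"
  by (simp add: cscalar_prod_eq_sum vnorm_def L2_set_def sum_nonneg flip: complex_norm_square)

lemma cscalar_prod_bound:
  assumes "dim_vec v = dim_vec w"
  shows "cmod (v \<bullet>c w) \<le> vnorm v * vnorm w"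
proof -
  have "cmod (v \<bullet>c w) \<le> (\<Sum>i<dim_vec w. cmod (v $ i) * cmod (w $ i))"
    unfolding cscalar_prod_eq_sum by (rule order_trans[OF norm_sum]) (simp add: norm_mult)
  also have "\<dots> \<le> vnorm v * vnorm w"
    unfolding vnorm_def assms using L2_set_mult_ineq[of "\<lambda>i. cmod (v $ i)" "\<lambda>i. cmod (w $ i)"] by simp
  finally show ?thesis .
qed

lemma mat_adjoint_conv: "mat_adjoint A = Matrix.mat (dim_col A) (dim_row A) (\<lambda>(i, j). cnj (A $$ (j, i)))"
  for A :: "complex mat"
  by (rule eq_matI) (auto simp: mat_adjoint_def mat_of_rows_index conjugate_complex_def)

lemma mat_adjoint_carrier [simp]:
  "A \<in> carrier_mat n m \<Longrightarrow> mat_adjoint A \<in> carrier_mat m n" for A :: "complex mat"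
  by (auto simp: mat_adjoint_conv)

lemma dim_mat_adjoint [simp]: "dim_row (mat_adjoint A) = dim_col A" "dim_col (mat_adjoint A) = dim_row A"
  for A :: "complex mat"
  by (auto simp: mat_adjoint_conv)

lemma index_mat_adjoint [simp]:
  "i < dim_col A \<Longrightarrow> j < dim_row A \<Longrightarrow> mat_adjoint A $$ (i, j) = cnj (A $$ (j, i))" for A :: "complex mat"
  by (simp add: mat_adjoint_conv)

lemma mat_adjoint_adjoint [simp]: "mat_adjoint (mat_adjoint A) = A" for A :: "complex mat"
  by (rule eq_matI) auto

lemma mat_adjoint_mult:
  fixes A B :: "complex mat"
  assumes "dim_col A = dim_row B"
  shows "mat_adjoint (A * B) = mat_adjoint B * mat_adjoint A"
  by (rule eq_matI) (use assms in \<open>auto simp: scalar_prod_def mult.commute\<close>)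

lemma cscalar_prod_adjoint:
  fixes A :: "complex mat"
  assumes "v \<in> carrier_vec (dim_col A)" "w \<in> carrier_vec (dim_row A)"
  shows "(A *\<^sub>v v) \<bullet>c w = v \<bullet>c (mat_adjoint A *\<^sub>v w)"
proof -
  have "(A *\<^sub>v v) \<bullet>c w = (\<Sum>i<dim_row A. \<Sum>j<dim_col A. A $$ (i, j) * v $ j * cnj (w $ i))"
    using assms by (auto simp: cscalar_prod_eq_sum scalar_prod_def atLeast0LessThan sum_distrib_right)
  also have "\<dots> = (\<Sum>j<dim_col A. \<Sum>i<dim_row A. A $$ (i, j) * v $ j * cnj (w $ i))"
    by (rule sum.swap)
  also have "\<dots> = v \<bullet>c (mat_adjoint A *\<^sub>v w)"
    using assms by (auto simp: cscalar_prod_eq_sum scalar_prod_def atLeast0LessThan sum_distrib_left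
        intro!: sum.cong)
  finally show ?thesis .
qed

lemma norm_emb_adjoint_le: "norm (emb (mat_adjoint A)) \<le> norm (emb A)"
proof (rule norm_emb_le)
  fix w :: "complex Matrix.vec" assume "w \<in> carrier_vec (dim_col (mat_adjoint A))"
  then have w: "w \<in> carrier_vec (dim_row A)" by simp
  define v where "v = mat_adjoint A *\<^sub>v w"
  have v: "v \<in> carrier_vec (dim_col A)" unfolding v_def by (rule carrier_vecI) simp
  have "(vnorm v)\<^sup>2 = cmod (v \<bullet>c v)"
    unfolding cscalar_prod_self norm_of_real by simp
  also have "v \<bullet>c v = (A *\<^sub>v v) \<bullet>c w"
    by (rule cscalar_prod_adjoint[OF v w, folded v_def, symmetric])
  also have "cmod \<dots> \<le> vnorm (A *\<^sub>v v) * vnorm w"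
    by (rule cscalar_prod_bound) (simp add: carrier_vecD[OF w])
  also have "\<dots> \<le> norm (emb A) * vnorm v * vnorm w"
    by (intro mult_right_mono vnorm_mult_mat_vec_le v vnorm_nonneg)
  finally have le: "vnorm v * vnorm v \<le> norm (emb A) * vnorm w * vnorm v"
    by (simp add: power2_eq_square ac_simps)
  have "vnorm v \<le> norm (emb A) * vnorm w"
  proof (cases "vnorm v = 0")
    case False
    then have "0 < vnorm v" using vnorm_nonneg[of v] by linarith
    with le show ?thesis by (rule mult_right_le_imp_le)
  qed simp
  then show "vnorm (mat_adjoint A *\<^sub>v w) \<le> norm (emb A) * vnorm w"
    by (simp add: v_def)
qed simp

lemma norm_emb_adjoint: "norm (emb (mat_adjoint A)) = norm (emb A)"
  using norm_emb_adjoint_le[of A] norm_emb_adjoint_le[of "mat_adjoint A"] by simp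

lemma vnorm_smult: "vnorm (c \<cdot>\<^sub>v v) = cmod c * vnorm v" for c :: complex
  by (auto simp: vnorm_def norm_mult L2_set_right_distrib intro!: L2_set_cong)

lemma vnorm_eq_0_iff: "v \<in> carrier_vec n \<Longrightarrow> vnorm v = 0 \<longleftrightarrow> v = 0\<^sub>v n"
  by (auto simp: vnorm_def L2_set_eq_0_iff)

lemma smult_mat_mult_vec: "v \<in> carrier_vec (dim_col A) \<Longrightarrow> (c \<cdot>\<^sub>m A) *\<^sub>v v = c \<cdot>\<^sub>v (A *\<^sub>v v)"
  for A :: "complex mat"
  by (rule eq_vecI) (auto simp: scalar_prod_def sum_distrib_left mult.assoc)

lemma pow_mat_commute: "A \<in> carrier_mat n n \<Longrightarrow> A * A ^\<^sub>m k = A ^\<^sub>m k * A"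
proof (induction k)
  case (Suc k)
  then have "A * (A ^\<^sub>m k * A) = (A * A ^\<^sub>m k) * A"
    by (intro assoc_mult_mat[symmetric]) auto
  also have "\<dots> = A ^\<^sub>m k * A * A"
    using Suc by simp
  finally show ?case by simp
qed simp

text \<open>
  For Hermitian \<open>B\<close> the sequence \<open>vnorm (B\<^sup>k v)\<close> is log-convex by Cauchy-Schwarz, so if \<open>B\<close> expands \<open>v\<close>
  then the sequence grows geometrically.  Divide \<open>A\<close> by a number strictly between \<open>K\<close> and the expansion
  rate of a vector that violates the bound: the powers of the scaled matrix are bounded, since its spectral
  radius is below 1, but also grow geometrically on that vector.
\<close>

lemma hermitian_norm_le_eigenvalue_bound:
  assumes A: "A \<in> carrier_mat n n" and herm: "mat_adjoint A = A"
    and ev: "\<And>k. eigenvalue A k \<Longrightarrow> cmod k \<le> K" and K: "0 \<le> K"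
  shows "norm (emb A) \<le> K"
proof (rule norm_emb_le[OF K], rule ccontr)
  fix v :: "complex Matrix.vec" assume "v \<in> carrier_vec (dim_col A)" and gt: "\<not> vnorm (A *\<^sub>v v) \<le> K * vnorm v"
  then have v: "v \<in> carrier_vec n" using A by simp
  have v0: "vnorm v \<noteq> 0"
  proof
    assume "vnorm v = 0"
    then have "v = 0\<^sub>v n" using vnorm_eq_0_iff[OF v] by simp
    then show False using gt A by (simp add: vnorm_def L2_set_def)
  qed
  then have vpos: "0 < vnorm v" using vnorm_nonneg[of v] by linarith
  then have n: "0 < n" using v by (cases n) (auto simp: vnorm_def L2_set_def)
  have "K < vnorm (A *\<^sub>v v) / vnorm v"
    using gt vpos by (simp add: field_simps)
  then obtain r where r: "K < r" "r < vnorm (A *\<^sub>v v) / vnorm v"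
    using dense by blast
  then have rpos: "0 < r" using K by linarith
  define B where "B = complex_of_real (1 / r) \<cdot>\<^sub>m A"
  have B: "B \<in> carrier_mat n n" using A by (simp add: B_def)
  have hermB: "mat_adjoint B = B"
  proof (rule eq_matI)
    fix i j assume "i < dim_row B" "j < dim_col B"
    then have ij: "i < n" "j < n" using B by auto
    have "cnj (A $$ (j, i)) = A $$ (i, j)"
      using arg_cong[OF herm, of "\<lambda>M. M $$ (i, j)"] A ij by simp
    then show "mat_adjoint B $$ (i, j) = B $$ (i, j)"
      using ij A B by (simp add: B_def)
  qed (use B in auto)
  have "cmod k < 1" if "eigenvalue B k" for k
  proof -
    from that obtain w where w: "w \<in> carrier_vec n" "w \<noteq> 0\<^sub>v n" "B *\<^sub>v w = k \<cdot>\<^sub>v w"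
      using B unfolding eigenvalue_def eigenvector_def by auto
    have "A = complex_of_real r \<cdot>\<^sub>m B"
      using rpos A by (intro eq_matI) (auto simp: B_def)
    then have "A *\<^sub>v w = complex_of_real r \<cdot>\<^sub>v (B *\<^sub>v w)"
      using B w by (simp add: smult_mat_mult_vec)
    also have "\<dots> = (complex_of_real r * k) \<cdot>\<^sub>v w"
      by (simp add: w(3) smult_smult_assoc)
    finally have "eigenvalue A (complex_of_real r * k)"
      using w A unfolding eigenvalue_def eigenvector_def by auto
    then have "r * cmod k \<le> K" using ev rpos by (fastforce simp: norm_mult)
    also have "K < r * 1" using r by simp
    finally show ?thesis using rpos by simp
  qed
  then have "spectral_radius B < 1"
    using spectral_radius_mem_max(1)[OF B n] by (auto simp: spectrum_def)
  then obtain c where c: "\<And>k. norm_bound (B ^\<^sub>m k) c"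
    using spectral_radius_jnf_norm_bound_less_1_upper_triangular[OF B] by blast
  define w where "w k = B ^\<^sub>m k *\<^sub>v v" for k
  have Bk: "B ^\<^sub>m k \<in> carrier_mat n n" for k using B by simp
  have w: "w k \<in> carrier_vec n" for k unfolding w_def by (rule mult_mat_vec_carrier[OF Bk v])
  have wS: "w (Suc k) = B *\<^sub>v w k" for k
    unfolding w_def pow_mat.simps pow_mat_commute[OF B, symmetric]
    by (rule assoc_mult_mat_vec[OF B Bk v])
  have logconvex: "(vnorm (w (Suc k)))\<^sup>2 \<le> vnorm (w k) * vnorm (w (Suc (Suc k)))" for k
  proof -
    have "(vnorm (w (Suc k)))\<^sup>2 = cmod ((B *\<^sub>v w k) \<bullet>c w (Suc k))"
      unfolding wS[of k, symmetric] by (simp add: cscalar_prod_self norm_power)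
    also have "\<dots> = cmod (w k \<bullet>c w (Suc (Suc k)))"
      by (subst cscalar_prod_adjoint) (use B w in \<open>simp_all add: hermB wS\<close>)
    also have "\<dots> \<le> vnorm (w k) * vnorm (w (Suc (Suc k)))"
      by (rule cscalar_prod_bound) (metis w carrier_vecD)
    finally show ?thesis .
  qed
  \<comment> \<open>the initial growth factor, at least which every later step grows by log-convexity\<close>
  define \<rho> where "\<rho> = vnorm (w 1) / vnorm v"
  have w0: "w 0 = v" using B v by (simp add: w_def)
  have "w 1 = complex_of_real (1 / r) \<cdot>\<^sub>v (A *\<^sub>v v)"
    using wS[of 0] A v by (simp add: w0 B_def smult_mat_mult_vec)
  then have "\<rho> = (vnorm (A *\<^sub>v v) / vnorm v) / r"
    using rpos by (simp add: \<rho>_def vnorm_smult norm_divide)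
  then have \<rho>: "1 < \<rho>" using r(2) by (simp only: less_divide_eq_1_pos[OF rpos])
  have grow: "\<rho> * vnorm (w k) \<le> vnorm (w (Suc k)) \<and> 0 < vnorm (w k)" for k
  proof (induction k)
    case 0
    then show ?case using vpos by (simp add: w0 \<rho>_def)
  next
    case (Suc k)
    then have pos: "0 < vnorm (w k)" "0 < vnorm (w (Suc k))"
      using \<rho> by (auto intro: less_le_trans[of 0 "\<rho> * vnorm (w k)"])
    have "vnorm (w k) * (\<rho> * vnorm (w (Suc k))) = (\<rho> * vnorm (w k)) * vnorm (w (Suc k))" by simp
    also have "\<dots> \<le> vnorm (w (Suc k)) * vnorm (w (Suc k))"
      using Suc pos by (intro mult_right_mono) auto
    also have "\<dots> \<le> vnorm (w k) * vnorm (w (Suc (Suc k)))"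
      using logconvex[of k] by (simp add: power2_eq_square)
    finally show ?case using pos by simp
  qed
  have lower: "\<rho> ^ k * vnorm v \<le> vnorm (w k)" for k
  proof (induction k)
    case 0
    then show ?case by (simp add: w0)
  next
    case (Suc k)
    have "\<rho> ^ Suc k * vnorm v \<le> \<rho> * vnorm (w k)"
      using mult_left_mono[OF Suc, of \<rho>] \<rho> by (simp add: mult_ac)
    then show ?case using grow[of k] by linarith
  qed
  have upper: "vnorm (w k) \<le> (real n * (real n * c)) * vnorm v" for k
  proof -
    note dims = carrier_matD[OF Bk[of k]]
    have "vnorm (w k) \<le> (\<Sum>i<n. \<Sum>j<n. cmod ((B ^\<^sub>m k) $$ (i, j))) * vnorm v"
      unfolding w_def using vnorm_mult_mat_vec_le_sum[of v "B ^\<^sub>m k"] v unfolding dims by blast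
    also have "\<dots> \<le> (\<Sum>i<n. \<Sum>j<n. c) * vnorm v"
      by (intro mult_right_mono sum_mono) (use c[of k] in \<open>auto simp: norm_bound_def dims simp del: pow_mat_dim\<close>)
    finally show ?thesis by simp
  qed
  obtain k where "real n * (real n * c) < \<rho> ^ k"
    using real_arch_pow[OF \<rho>] by blast
  then have "(real n * (real n * c)) * vnorm v < \<rho> ^ k * vnorm v"
    using vpos by simp
  with lower[of k] upper[of k] show False by linarith
qed

text \<open>
  A homogeneous system with one more unknown than equations; padding with a zero row makes the matrix square
  and singular.
\<close>

lemma exists_kernel_vector:
  fixes B :: "complex mat"
  assumes B: "B \<in> carrier_mat m (Suc m)"
  obtains y where "y \<in> carrier_vec (Suc m)" "y \<noteq> 0\<^sub>v (Suc m)" "B *\<^sub>v y = 0\<^sub>v m"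
proof -
  define C where "C = mat\<^sub>r (Suc m) (Suc m) (\<lambda>i. if i = m then 0\<^sub>v (Suc m) else row B i)"
  have "row B \<in> {0..<Suc m} \<rightarrow> carrier_vec (Suc m)"
    using B by (metis Pi_I row_carrier carrier_matD(2))
  then have "det C = 0"
    unfolding C_def by (intro det_row_0) auto
  moreover have C: "C \<in> carrier_mat (Suc m) (Suc m)"
    by (simp add: C_def)
  ultimately obtain y where y: "y \<in> carrier_vec (Suc m)" "y \<noteq> 0\<^sub>v (Suc m)" "C *\<^sub>v y = 0\<^sub>v (Suc m)"
    using det_0_iff_vec_prod_zero_field[OF C] by blast
  have "B *\<^sub>v y = 0\<^sub>v m"
  proof (rule eq_vecI)
    fix i assume "i < dim_vec (0\<^sub>v m :: complex Matrix.vec)"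
    then have i: "i < m" by simp
    have "row C i = row B i"
      unfolding C_def using i B by (auto intro!: eq_vecI)
    then show "(B *\<^sub>v y) $ i = 0\<^sub>v m $ i"
      using arg_cong[OF y(3), of "\<lambda>v. v $ i"] i B C by simp
  qed (use B in simp)
  with y that show ?thesis by blast
qed

lemma mat_diag_mult_vec:
  "v \<in> carrier_vec n \<Longrightarrow> mat_diag n f *\<^sub>v v = Matrix.vec n (\<lambda>i. f i * v $ i)" for f :: "nat \<Rightarrow> complex"
proof (rule eq_vecI)
  fix i assume v: "v \<in> carrier_vec n" and "i < dim_vec (Matrix.vec n (\<lambda>i. f i * v $ i))"
  then have i: "i < n" by simp
  have "(mat_diag n f *\<^sub>v v) $ i = (\<Sum>j\<in>{0..<n}. (if i = j then f j else 0) * v $ j)"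
    using i v by (simp add: mat_diag_def scalar_prod_def)
  also have "\<dots> = f i * v $ i"
    using i by (subst sum.remove[of _ i]) auto
  finally show "(mat_diag n f *\<^sub>v v) $ i = Matrix.vec n (\<lambda>i. f i * v $ i) $ i"
    using i by simp
qed (simp add: mat_diag_def)

lemma norm_emb_mat_diag_le:
  assumes "0 \<le> c" "\<And>i. i < n \<Longrightarrow> cmod (f i) \<le> c"
  shows "norm (emb (mat_diag n f)) \<le> c"
proof (rule norm_emb_le[OF assms(1)])
  fix v :: "complex Matrix.vec" assume "v \<in> carrier_vec (dim_col (mat_diag n f))"
  then have v: "v \<in> carrier_vec n" by (simp add: mat_diag_def)
  have "vnorm (mat_diag n f *\<^sub>v v) = L2_set (\<lambda>i. cmod (f i) * cmod (v $ i)) {..<n}"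
    unfolding mat_diag_mult_vec[OF v] vnorm_def by (auto simp: norm_mult intro!: L2_set_cong)
  also have "\<dots> \<le> L2_set (\<lambda>i. c * cmod (v $ i)) {..<n}"
    by (intro L2_set_mono) (auto intro: mult_right_mono assms)
  also have "\<dots> = c * vnorm v"
    using carrier_vecD[OF v] assms(1) by (simp add: vnorm_def L2_set_right_distrib)
  finally show "vnorm (mat_diag n f *\<^sub>v v) \<le> c * vnorm v" .
qed

section \<open>Functional calculus in a row eigenbasis\<close>

locale row_eigenbasis =
  fixes n :: nat and A :: "complex mat" and lam :: "nat \<Rightarrow> real" and p :: "nat \<Rightarrow> complex Matrix.vec"
  assumes basis: "ordered_row_eigenbasis n A lam p" and A: "A \<in> carrier_mat n n"
begin

definition U :: "complex mat" where "U = Matrix.mat n n (\<lambda>(j, k). p j $ k)"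

text \<open>
  The matrix with the eigenvectors of \<open>A\<close> and with the eigenvalue \<open>\<phi> j\<close> in place of \<open>lam j\<close>.  The
  resolvent, the projection and the reduced inverse are all of this form, which makes the hypotheses of
  \<open>spectral_split\<close> pointwise statements on eigenvalues.
\<close>

definition calc :: "(nat \<Rightarrow> real) \<Rightarrow> fvec endo" where
  "calc \<phi> = emb (mat_adjoint U) * emb (mat_diag n (\<lambda>j. complex_of_real (\<phi> j))) * emb U"

lemma p_carrier: "j < n \<Longrightarrow> p j \<in> carrier_vec n"
  using basis by (simp add: ordered_row_eigenbasis_def)

lemma lam_antimono: "j \<le> k \<Longrightarrow> k < n \<Longrightarrow> lam k \<le> lam j"
  using basis by (simp add: ordered_row_eigenbasis_def)

lemma U_carrier [simp]: "U \<in> carrier_mat n n" and U_dims [simp]: "dim_row U = n" "dim_col U = n"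
  by (simp_all add: U_def)

lemma U_adjoint: "U * mat_adjoint U = 1\<^sub>m n"
proof (rule eq_matI)
  fix j k assume "j < dim_row (1\<^sub>m n :: complex mat)" "k < dim_col (1\<^sub>m n :: complex mat)"
  then have jk: "j < n" "k < n" by auto
  have "(U * mat_adjoint U) $$ (j, k) = p j \<bullet>c p k"
    using jk p_carrier[of j] p_carrier[of k]
    by (simp add: scalar_prod_def U_def conjugate_complex_def)
  also have "\<dots> = (if j = k then 1 else 0)"
    using basis jk by (simp add: ordered_row_eigenbasis_def)
  finally show "(U * mat_adjoint U) $$ (j, k) = 1\<^sub>m n $$ (j, k)" using jk by simp
qed auto

lemma adjoint_U: "mat_adjoint U * U = 1\<^sub>m n"
  by (rule mat_mult_left_right_inverse[OF _ _ U_adjoint]) auto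

lemma U_mult_A: "U * A = mat_diag n (\<lambda>j. complex_of_real (lam j)) * U"
proof (rule eq_matI)
  fix j k assume "j < dim_row (mat_diag n (\<lambda>j. complex_of_real (lam j)) * U)"
    "k < dim_col (mat_diag n (\<lambda>j. complex_of_real (lam j)) * U)"
  then have jk: "j < n" "k < n" by (auto simp: mat_diag_def)
  have "mat_of_row (p j) * A = complex_of_real (lam j) \<cdot>\<^sub>m mat_of_row (p j)"
    using basis jk by (simp add: ordered_row_eigenbasis_def)
  from arg_cong[OF this, of "\<lambda>M. M $$ (0, k)"]
  have "(mat_of_row (p j) * A) $$ (0, k) = complex_of_real (lam j) * p j $ k"
    using jk p_carrier[of j] by auto
  moreover have "(mat_of_row (p j) * A) $$ (0, k) = (U * A) $$ (j, k)"
    using jk p_carrier[of j] A by (auto simp: scalar_prod_def U_def mat_of_row_def)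
  ultimately show "(U * A) $$ (j, k) = (mat_diag n (\<lambda>j. complex_of_real (lam j)) * U) $$ (j, k)"
    using jk by (simp add: mat_diag_mult_left[of _ n n] U_def)
qed (use A in \<open>auto simp: mat_diag_def\<close>)

lemma emb_U: "emb U * emb (mat_adjoint U) = emb (1\<^sub>m n)" "emb (mat_adjoint U) * emb U = emb (1\<^sub>m n)"
  by (simp_all add: U_adjoint adjoint_U flip: emb_mult)

lemma emb_one_left: "B \<in> carrier_mat n m \<Longrightarrow> emb (1\<^sub>m n) * emb B = emb B"
  by (subst emb_mult[symmetric]) auto

lemma emb_one_right: "B \<in> carrier_mat m n \<Longrightarrow> emb B * emb (1\<^sub>m n) = emb B"
  by (subst emb_mult[symmetric]) auto

lemma calc_cong: "(\<And>j. j < n \<Longrightarrow> \<phi> j = \<psi> j) \<Longrightarrow> calc \<phi> = calc \<psi>"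
proof -
  assume "\<And>j. j < n \<Longrightarrow> \<phi> j = \<psi> j"
  then have "mat_diag n (\<lambda>j. complex_of_real (\<phi> j)) = mat_diag n (\<lambda>j. complex_of_real (\<psi> j))"
    by (intro eq_matI) (auto simp: mat_diag_def)
  then show ?thesis by (simp add: calc_def)
qed

lemma calc_mult: "calc \<phi> * calc \<psi> = calc (\<lambda>j. \<phi> j * \<psi> j)"
proof -
  let ?D = "\<lambda>\<phi> :: nat \<Rightarrow> real. emb (mat_diag n (\<lambda>j. complex_of_real (\<phi> j)))"
  have "calc \<phi> * calc \<psi> = emb (mat_adjoint U) * (?D \<phi> * (emb U * emb (mat_adjoint U)) * ?D \<psi>) * emb U"
    by (simp add: calc_def mult.assoc)
  also have "?D \<phi> * (emb U * emb (mat_adjoint U)) * ?D \<psi> = ?D (\<lambda>j. \<phi> j * \<psi> j)"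
  proof -
    have "mat_diag n (\<lambda>j. complex_of_real (\<phi> j * \<psi> j))
        = mat_diag n (\<lambda>j. complex_of_real (\<phi> j)) * mat_diag n (\<lambda>j. complex_of_real (\<psi> j))"
      by (simp only: mat_diag_diag of_real_mult)
    then show ?thesis
      by (simp only: emb_U emb_one_right[OF mat_diag_dim]) (subst emb_mult, simp_all add: mat_diag_def)
  qed
  finally show ?thesis by (simp add: calc_def)
qed

lemma calc_diff: "calc \<phi> - calc \<psi> = calc (\<lambda>j. \<phi> j - \<psi> j)"
proof -
  have "mat_diag n (\<lambda>j. complex_of_real (\<phi> j - \<psi> j))
      = mat_diag n (\<lambda>j. complex_of_real (\<phi> j)) - mat_diag n (\<lambda>j. complex_of_real (\<psi> j))"
    by (rule eq_matI) (auto simp: mat_diag_def)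
  then show ?thesis
    unfolding calc_def by (simp only: emb_minus[OF mat_diag_dim mat_diag_dim]) (simp add: algebra_simps)
qed

lemma calc_one: "calc (\<lambda>_. 1) = emb (1\<^sub>m n)"
  by (simp add: calc_def emb_one_right[of _ n] emb_U)

lemma calc_lam: "calc lam = emb A"
proof -
  have "emb (mat_diag n (\<lambda>j. complex_of_real (lam j))) * emb U = emb U * emb A"
    using A by (simp add: U_mult_A mat_diag_def flip: emb_mult)
  then have "calc lam = emb (mat_adjoint U) * emb U * emb A"
    by (simp add: calc_def mult.assoc)
  then show ?thesis by (simp add: emb_U emb_one_left[OF A])
qed

lemma vnorm_U: "v \<in> carrier_vec n \<Longrightarrow> vnorm (U *\<^sub>v v) = vnorm v"
proof -
  assume v: "v \<in> carrier_vec n"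
  have Uv: "U *\<^sub>v v \<in> carrier_vec n" by (rule mult_mat_vec_carrier[OF U_carrier v])
  have "(U *\<^sub>v v) \<bullet>c (U *\<^sub>v v) = v \<bullet>c (mat_adjoint U *\<^sub>v (U *\<^sub>v v))"
    by (rule cscalar_prod_adjoint) (use v Uv in simp_all)
  also have "mat_adjoint U *\<^sub>v (U *\<^sub>v v) = (mat_adjoint U * U) *\<^sub>v v"
    by (rule assoc_mult_mat_vec[symmetric, of _ n n _ n]) (use v in auto)
  also have "\<dots> = v" using v by (simp add: adjoint_U)
  finally show ?thesis
    by (simp add: cscalar_prod_self of_real_eq_iff del: of_real_power)
qed

lemma norm_calc_le:
  assumes "0 \<le> c" "\<And>j. j < n \<Longrightarrow> \<bar>\<phi> j\<bar> \<le> c"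
  shows "norm (calc \<phi>) \<le> c"
proof -
  have U: "norm (emb U) \<le> 1"
    by (rule norm_emb_le) (auto simp: vnorm_U)
  moreover have "norm (emb (mat_adjoint U)) \<le> 1"
    using U by (simp add: norm_emb_adjoint)
  moreover have "norm (emb (mat_diag n (\<lambda>j. complex_of_real (\<phi> j)))) \<le> c"
    by (rule norm_emb_mat_diag_le) (use assms in auto)
  ultimately have "norm (calc \<phi>) \<le> 1 * c * 1"
    unfolding calc_def by (intro norm_mult_le)
  then show ?thesis by simp
qed

lemma quadratic_form:
  assumes v: "v \<in> carrier_vec n"
  shows "(A *\<^sub>v v) \<bullet>c v = complex_of_real (\<Sum>j<n. lam j * (cmod ((U *\<^sub>v v) $ j))\<^sup>2)"
proof -
  let ?L = "mat_diag n (\<lambda>j. complex_of_real (lam j))"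
  have Uv: "U *\<^sub>v v \<in> carrier_vec n" by (rule mult_mat_vec_carrier[OF U_carrier v])
  have Av: "A *\<^sub>v v \<in> carrier_vec n" by (rule mult_mat_vec_carrier[OF A v])
  have "(A *\<^sub>v v) \<bullet>c v = (A *\<^sub>v v) \<bullet>c ((mat_adjoint U * U) *\<^sub>v v)"
    using v by (simp add: adjoint_U)
  also have "(mat_adjoint U * U) *\<^sub>v v = mat_adjoint U *\<^sub>v (U *\<^sub>v v)"
    by (rule assoc_mult_mat_vec[of _ n n _ n]) (use v in auto)
  also have "(A *\<^sub>v v) \<bullet>c (mat_adjoint U *\<^sub>v (U *\<^sub>v v)) = (U *\<^sub>v (A *\<^sub>v v)) \<bullet>c (U *\<^sub>v v)"
    by (rule cscalar_prod_adjoint[symmetric]) (use Av Uv in simp_all)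
  also have "U *\<^sub>v (A *\<^sub>v v) = (U * A) *\<^sub>v v"
    by (rule assoc_mult_mat_vec[symmetric, of _ n n _ n]) (use v A in auto)
  also have "\<dots> = ?L *\<^sub>v (U *\<^sub>v v)"
    unfolding U_mult_A by (rule assoc_mult_mat_vec[of _ n n _ n]) (use v in auto)
  also have "\<dots> \<bullet>c (U *\<^sub>v v) = (\<Sum>j<n. complex_of_real (lam j) * ((U *\<^sub>v v) $ j * cnj ((U *\<^sub>v v) $ j)))"
    unfolding mat_diag_mult_vec[OF Uv] cscalar_prod_eq_sum by (simp add: mult.assoc)
  also have "\<dots> = complex_of_real (\<Sum>j<n. lam j * (cmod ((U *\<^sub>v v) $ j))\<^sup>2)"
    by (simp flip: complex_norm_square)
  finally show ?thesis .
qed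

lemma calc_indicator:
  assumes "q \<le> n"
  shows "calc (\<lambda>j. if j < q then 1 else 0) = emb (Matrix.mat n n (\<lambda>(i, k). \<Sum>j<q. cnj (p j $ i) * p j $ k))"
proof -
  let ?D = "mat_diag n (\<lambda>j. complex_of_real (if j < q then 1 else 0))"
  have "calc (\<lambda>j. if j < q then 1 else 0) = emb (mat_adjoint U * (?D * U))"
    by (simp add: calc_def emb_mult mat_diag_def mult.assoc)
  also have "mat_adjoint U * (?D * U) = Matrix.mat n n (\<lambda>(i, k). \<Sum>j<q. cnj (p j $ i) * p j $ k)"
  proof (rule eq_matI)
    fix i k assume "i < dim_row (Matrix.mat n n (\<lambda>(i, k). \<Sum>j<q. cnj (p j $ i) * p j $ k))"
      "k < dim_col (Matrix.mat n n (\<lambda>(i, k). \<Sum>j<q. cnj (p j $ i) * p j $ k))"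
    then have ik: "i < n" "k < n" by auto
    have "(mat_adjoint U * (?D * U)) $$ (i, k) = (\<Sum>j<n. if j < q then cnj (p j $ i) * p j $ k else 0)"
      using ik unfolding mat_diag_mult_left[OF U_carrier]
      by (auto simp: scalar_prod_def U_def atLeast0LessThan intro!: sum.cong)
    also have "\<dots> = (\<Sum>j<q. cnj (p j $ i) * p j $ k)"
      using assms by (intro sum.mono_neutral_cong_right) auto
    finally show "(mat_adjoint U * (?D * U)) $$ (i, k)
        = Matrix.mat n n (\<lambda>(i, k). \<Sum>j<q. cnj (p j $ i) * p j $ k) $$ (i, k)"
      using ik by simp
  qed (auto simp: mat_diag_def)
  finally show ?thesis .
qed

lemma spectral_split_calc:
  assumes \<kappa>: "1 \<le> \<kappa>" and low: "\<And>j. j < n \<Longrightarrow> 1 \<le> lam j + c"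
    and bulk: "\<And>j. q \<le> j \<Longrightarrow> j < n \<Longrightarrow> lam j + c \<le> \<kappa>"
    and top: "\<And>j. j < q \<Longrightarrow> j < n \<Longrightarrow> 2 * \<kappa> \<le> lam j + c"
  shows "spectral_split \<kappa> (emb (1\<^sub>m n)) (calc (\<lambda>j. 1 / (lam j + c)))
    (calc (\<lambda>j. if j < q then 1 else 0)) (calc (\<lambda>j. if j < q then 0 else lam j + c))"
  unfolding calc_one[symmetric]
proof
  have nz: "lam j + c \<noteq> 0" if "j < n" for j using low[OF that] by linarith
  show "\<kappa> * norm (calc (\<lambda>j. 1 / (lam j + c)) * calc (\<lambda>j. if j < q then 1 else 0)) \<le> 1 / 2"
  proof -
    have "norm (calc (\<lambda>j. 1 / (lam j + c) * (if j < q then 1 else 0))) \<le> 1 / (2 * \<kappa>)"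
    proof (rule norm_calc_le)
      fix j assume j: "j < n"
      show "\<bar>1 / (lam j + c) * (if j < q then 1 else 0)\<bar> \<le> 1 / (2 * \<kappa>)"
        using top[of j] j low[of j] \<kappa> by (auto intro!: divide_left_mono)
    qed (use \<kappa> in simp)
    then show ?thesis
      using \<kappa> by (simp add: calc_mult field_simps)
  qed
  show "norm (calc (\<lambda>_. 1) - calc (\<lambda>j. if j < q then 1 else 0)) \<le> 1"
    unfolding calc_diff by (rule norm_calc_le) auto
  show "norm (calc (\<lambda>j. if j < q then 0 else lam j + c)) \<le> \<kappa>"
    by (rule norm_calc_le) (use \<kappa> bulk low in \<open>force+\<close>)
  show "norm (calc (\<lambda>j. if j < q then 1 else 0)) \<le> 1"
    by (rule norm_calc_le) auto
qed (simp_all add: calc_mult calc_diff, (rule calc_cong, use low in force)+)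

end

section \<open>Eigenvalues of a factor part plus a bounded part\<close>

lemma real_quadratic_form_bound:
  assumes X: "X \<in> carrier_mat n n" and v: "v \<in> carrier_vec n"
  shows "\<bar>Re ((X *\<^sub>v v) \<bullet>c v)\<bar> \<le> norm (emb X) * (vnorm v)\<^sup>2"
proof -
  have "\<bar>Re ((X *\<^sub>v v) \<bullet>c v)\<bar> \<le> cmod ((X *\<^sub>v v) \<bullet>c v)"
    by (rule abs_Re_le_cmod)
  also have "\<dots> \<le> vnorm (X *\<^sub>v v) * vnorm v"
    by (rule cscalar_prod_bound) (use X v in simp)
  also have "\<dots> \<le> norm (emb X) * vnorm v * vnorm v"
    by (intro mult_right_mono vnorm_mult_mat_vec_le) (use X v in simp_all)
  finally show ?thesis by (simp add: power2_eq_square mult.assoc)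
qed

lemma vnorm_power2_eq_sum: "v \<in> carrier_vec n \<Longrightarrow> (vnorm v)\<^sup>2 = (\<Sum>j<n. (cmod (v $ j))\<^sup>2)"
  by (auto simp: vnorm_def L2_set_def sum_nonneg)

lemma vnorm_pos: "v \<in> carrier_vec n \<Longrightarrow> v \<noteq> 0\<^sub>v n \<Longrightarrow> 0 < vnorm v"
  using vnorm_eq_0_iff[of v n] vnorm_nonneg[of v] by linarith

lemma gram_form:
  assumes G: "G \<in> carrier_mat n q" and w: "w \<in> carrier_vec q"
  shows "((mat_adjoint G * G) *\<^sub>v w) \<bullet>c w = complex_of_real ((vnorm (G *\<^sub>v w))\<^sup>2)"
proof -
  have "(mat_adjoint G * G) *\<^sub>v w = mat_adjoint G *\<^sub>v (G *\<^sub>v w)"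
    by (rule assoc_mult_mat_vec[OF mat_adjoint_carrier[OF G] G w])
  then have "((mat_adjoint G * G) *\<^sub>v w) \<bullet>c w = (G *\<^sub>v w) \<bullet>c (mat_adjoint (mat_adjoint G) *\<^sub>v w)"
    using cscalar_prod_adjoint[of "G *\<^sub>v w" "mat_adjoint G" w] G w by auto
  then show ?thesis by (simp add: cscalar_prod_self)
qed
text \<open>
  \<open>H = G (G\<^sup>* G)\<^sup>-\<^sup>1\<close>, the transposed pseudoinverse; its norm is the reciprocal of the smallest singular
  value of \<open>G\<close>.
\<close>

lemma gram_right_inverse:
  assumes G: "G \<in> carrier_mat n q" and a: "0 < a"
    and coercive: "\<And>w. w \<in> carrier_vec q \<Longrightarrow> a * (vnorm w)\<^sup>2 \<le> (vnorm (G *\<^sub>v w))\<^sup>2"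
  obtains H where "H \<in> carrier_mat n q" "mat_adjoint G * H = 1\<^sub>m q" "norm (emb H) \<le> 1 / sqrt a"
proof -
  let ?M = "mat_adjoint G * G"
  have Ga: "mat_adjoint G \<in> carrier_mat q n" using G by simp
  have M: "?M \<in> carrier_mat q q" using G Ga by auto
  note form = gram_form[OF G]
  have "det ?M \<noteq> 0"
  proof
    assume "det ?M = 0"
    then obtain w where w: "w \<in> carrier_vec q" "w \<noteq> 0\<^sub>v q" "?M *\<^sub>v w = 0\<^sub>v q"
      using det_0_iff_vec_prod_zero_field[OF M] by blast
    have "complex_of_real ((vnorm (G *\<^sub>v w))\<^sup>2) = 0"
      using form[OF w(1)] w by simp
    then have "(vnorm (G *\<^sub>v w))\<^sup>2 = 0" by (simp only: of_real_eq_0_iff)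
    then show False using coercive[OF w(1)] vnorm_pos[OF w(1,2)] a
      by (simp add: mult_le_0_iff)
  qed
  then obtain N where N: "N \<in> carrier_mat q q" "?M * N = 1\<^sub>m q"
    using det_non_zero_imp_unit[OF M, of "()"] unfolding Units_def ring_mat_def by auto
  define H where "H = G * N"
  have H: "H \<in> carrier_mat n q" using G N by (simp add: H_def)
  have "norm (emb H) \<le> 1 / sqrt a"
  proof (rule norm_emb_le)
    fix v :: "complex Matrix.vec" assume "v \<in> carrier_vec (dim_col H)"
    then have v: "v \<in> carrier_vec q" using H by simp
    define w where "w = N *\<^sub>v v"
    have w: "w \<in> carrier_vec q" unfolding w_def by (rule mult_mat_vec_carrier[OF N(1) v])
    have Hv: "H *\<^sub>v v = G *\<^sub>v w" unfolding H_def w_def by (rule assoc_mult_mat_vec[OF G N(1) v])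
    have "?M *\<^sub>v w = v"
      unfolding w_def using assoc_mult_mat_vec[OF M N(1) v] N(2) v by simp
    then have "(vnorm (G *\<^sub>v w))\<^sup>2 = cmod (v \<bullet>c w)"
      using form[OF w] by (simp add: norm_power)
    also have "\<dots> \<le> vnorm v * vnorm w"
      by (rule cscalar_prod_bound) (use v w in simp)
    also have "\<dots> \<le> vnorm v * (vnorm (G *\<^sub>v w) / sqrt a)"
    proof (rule mult_left_mono)
      have "(vnorm w)\<^sup>2 \<le> (vnorm (G *\<^sub>v w) / sqrt a)\<^sup>2"
        using coercive[OF w] a by (simp add: power_divide field_simps)
      then show "vnorm w \<le> vnorm (G *\<^sub>v w) / sqrt a"
        by (rule power2_le_imp_le) (use a in simp)
    qed simp
    finally have le: "vnorm (G *\<^sub>v w) * vnorm (G *\<^sub>v w) \<le> (1 / sqrt a * vnorm v) * vnorm (G *\<^sub>v w)"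
      by (simp add: power2_eq_square mult_ac)
    have "vnorm (G *\<^sub>v w) \<le> 1 / sqrt a * vnorm v"
    proof (cases "vnorm (G *\<^sub>v w) = 0")
      case False
      then have "0 < vnorm (G *\<^sub>v w)" using vnorm_nonneg[of "G *\<^sub>v w"] by linarith
      with le show ?thesis by (rule mult_right_le_imp_le)
    qed (use a in simp)
    then show "vnorm (H *\<^sub>v v) \<le> 1 / sqrt a * vnorm v"
      unfolding Hv .
  qed (use a in simp)
  moreover have "mat_adjoint G * H = 1\<^sub>m q"
    unfolding H_def N(2)[symmetric] by (rule assoc_mult_mat[symmetric]) (use G N in auto)
  ultimately show ?thesis using H that by blast
qed

locale factor_spectrum = row_eigenbasis +
  fixes q :: nat and G X :: "complex mat" and dv :: "nat \<Rightarrow> real" and K a :: real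
  assumes G: "G \<in> carrier_mat n q" and X: "X \<in> carrier_mat n n"
    and A_eq: "A = G * mat_diag q (\<lambda>l. complex_of_real (dv l)) * mat_adjoint G + X"
    and dv: "\<And>l. l < q \<Longrightarrow> 1 / 2 \<le> dv l"
    and norm_X: "norm (emb X) \<le> K" and a: "0 < a"
    and coercive: "\<And>w. w \<in> carrier_vec q \<Longrightarrow> a * (vnorm w)\<^sup>2 \<le> (vnorm (G *\<^sub>v w))\<^sup>2"
begin

abbreviation D :: "complex mat" where "D \<equiv> mat_diag q (\<lambda>l. complex_of_real (dv l))"

lemma K_nonneg: "0 \<le> K" using norm_X norm_ge_zero order_trans by blast

lemma quadratic_form_factor:
  assumes v: "v \<in> carrier_vec n"
  shows "(\<Sum>j<n. lam j * (cmod ((U *\<^sub>v v) $ j))\<^sup>2)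
    = (\<Sum>l<q. dv l * (cmod ((mat_adjoint G *\<^sub>v v) $ l))\<^sup>2) + Re ((X *\<^sub>v v) \<bullet>c v)"
proof -
  define y where "y = mat_adjoint G *\<^sub>v v"
  have Ga: "mat_adjoint G \<in> carrier_mat q n" using G by simp
  have y: "y \<in> carrier_vec q" unfolding y_def by (rule mult_mat_vec_carrier[OF Ga v])
  have Dy: "D *\<^sub>v y \<in> carrier_vec q" by (rule mult_mat_vec_carrier[OF mat_diag_dim y])
  have GD: "G * D \<in> carrier_mat n q" using G by (simp add: mat_diag_def)
  have "A *\<^sub>v v = (G * D * mat_adjoint G) *\<^sub>v v + X *\<^sub>v v"
    unfolding A_eq by (rule add_mult_distrib_mat_vec[OF mult_carrier_mat[OF GD Ga] X v])
  also have "(G * D * mat_adjoint G) *\<^sub>v v = G *\<^sub>v (D *\<^sub>v y)"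
    unfolding y_def assoc_mult_mat_vec[OF GD Ga v]
    by (rule assoc_mult_mat_vec[OF G mat_diag_dim]) (use y in \<open>simp add: y_def\<close>)
  finally have Av: "A *\<^sub>v v = G *\<^sub>v (D *\<^sub>v y) + X *\<^sub>v v" .
  have "(A *\<^sub>v v) \<bullet>c v = (G *\<^sub>v (D *\<^sub>v y)) \<bullet>c v + (X *\<^sub>v v) \<bullet>c v"
    unfolding Av by (rule add_scalar_prod_distrib[of _ n])
      (use mult_mat_vec_carrier[OF G Dy] mult_mat_vec_carrier[OF X v] v in simp_all)
  also have "(G *\<^sub>v (D *\<^sub>v y)) \<bullet>c v = (D *\<^sub>v y) \<bullet>c y"
    unfolding y_def[of] by (subst cscalar_prod_adjoint) (use Dy G v in \<open>simp_all add: y_def\<close>)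
  also have "\<dots> = (\<Sum>l<q. complex_of_real (dv l) * (y $ l * cnj (y $ l)))"
    unfolding mat_diag_mult_vec[OF y] cscalar_prod_eq_sum using y by (simp add: mult.assoc)
  also have "\<dots> = complex_of_real (\<Sum>l<q. dv l * (cmod (y $ l))\<^sup>2)"
    by (simp flip: complex_norm_square)
  finally have "Re ((A *\<^sub>v v) \<bullet>c v) = (\<Sum>l<q. dv l * (cmod (y $ l))\<^sup>2) + Re ((X *\<^sub>v v) \<bullet>c v)"
    by simp
  then show ?thesis
    unfolding quadratic_form[OF v] y_def by simp
qed

lemma factor_form_nonneg: "0 \<le> (\<Sum>l<q. dv l * (cmod (y l))\<^sup>2)"
proof (rule sum_nonneg)
  fix l assume "l \<in> {..<q}"
  with dv[of l] show "0 \<le> dv l * (cmod (y l))\<^sup>2" by simp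
qed

lemma adjoint_U_mult:
  assumes "y \<in> carrier_vec n"
  shows "mat_adjoint U *\<^sub>v y \<in> carrier_vec n" "U *\<^sub>v (mat_adjoint U *\<^sub>v y) = y"
    "vnorm (mat_adjoint U *\<^sub>v y) = vnorm y"
proof -
  show 1: "mat_adjoint U *\<^sub>v y \<in> carrier_vec n"
    by (rule mult_mat_vec_carrier[OF _ assms]) simp
  show 2: "U *\<^sub>v (mat_adjoint U *\<^sub>v y) = y"
    using assoc_mult_mat_vec[of U n n "mat_adjoint U" n y] assms by (simp add: U_adjoint)
  show "vnorm (mat_adjoint U *\<^sub>v y) = vnorm y"
    using vnorm_U[OF 1] by (simp add: 2)
qed

lemma lam_lower:
  assumes j: "j < n"
  shows "- K \<le> lam j"
proof -
  let ?v = "mat_adjoint U *\<^sub>v unit_vec n j"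
  have u: "unit_vec n j \<in> carrier_vec n" by simp
  note v = adjoint_U_mult[OF u]
  have one: "(\<Sum>i<n. c i * (cmod (unit_vec n j $ i))\<^sup>2) = c j" for c
    using j by (subst sum.remove[of _ j]) (auto simp: unit_vec_def)
  have "(vnorm ?v)\<^sup>2 = 1"
    using one[of "\<lambda>_. 1"] unfolding v(3) vnorm_power2_eq_sum[OF u] by simp
  with real_quadratic_form_bound[OF X v(1)] have "\<bar>Re ((X *\<^sub>v ?v) \<bullet>c ?v)\<bar> \<le> norm (emb X)"
    by simp
  then have "- K \<le> Re ((X *\<^sub>v ?v) \<bullet>c ?v)"
    using norm_X by linarith
  then show ?thesis
    using quadratic_form_factor[OF v(1)] one[of lam]
      factor_form_nonneg[of "\<lambda>l. (mat_adjoint G *\<^sub>v ?v) $ l"]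
    unfolding v(2) by linarith
qed

text \<open>
  The span of the first \<open>q + 1\<close> eigenvectors contains a nonzero vector annihilated by \<open>G\<^sup>*\<close>.  On it the
  quadratic form of \<open>A\<close> is at least \<open>lam q\<close>, and equals the form of \<open>X\<close>.
\<close>

lemma lam_bulk:
  assumes j: "q \<le> j" "j < n"
  shows "lam j \<le> K"
proof -
  have qn: "q < n" using j by simp
  define B where "B = Matrix.mat q (Suc q) (\<lambda>(l, j). (mat_adjoint G * mat_adjoint U) $$ (l, j))"
  obtain y0 where y0: "y0 \<in> carrier_vec (Suc q)" "y0 \<noteq> 0\<^sub>v (Suc q)" "B *\<^sub>v y0 = 0\<^sub>v q"
    by (rule exists_kernel_vector[of B q]) (simp add: B_def)
  define y where "y = Matrix.vec n (\<lambda>j. if j \<le> q then y0 $ j else 0)"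
  have y: "y \<in> carrier_vec n" by (simp add: y_def)
  have "y \<noteq> 0\<^sub>v n"
  proof
    assume "y = 0\<^sub>v n"
    have "y0 = 0\<^sub>v (Suc q)"
    proof (rule eq_vecI)
      fix i assume "i < dim_vec (0\<^sub>v (Suc q) :: complex Matrix.vec)"
      with arg_cong[OF \<open>y = 0\<^sub>v n\<close>, of "\<lambda>v. v $ i"] qn show "y0 $ i = 0\<^sub>v (Suc q) $ i"
        by (simp add: y_def)
    qed (use y0 in simp)
    with y0 show False by simp
  qed
  then have pos: "0 < vnorm y" by (rule vnorm_pos[OF y])
  let ?v = "mat_adjoint U *\<^sub>v y"
  note v = adjoint_U_mult[OF y]
  have "mat_adjoint G *\<^sub>v ?v = (mat_adjoint G * mat_adjoint U) *\<^sub>v y"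
    by (rule assoc_mult_mat_vec[symmetric, of _ q n _ n]) (use G y in auto)
  also have "\<dots> = 0\<^sub>v q"
  proof (rule eq_vecI)
    fix l assume "l < dim_vec (0\<^sub>v q :: complex Matrix.vec)"
    then have l: "l < q" by simp
    have "((mat_adjoint G * mat_adjoint U) *\<^sub>v y) $ l
        = (\<Sum>j<n. (mat_adjoint G * mat_adjoint U) $$ (l, j) * (if j \<le> q then y0 $ j else 0))"
      using l G y by (simp add: scalar_prod_def[of "row (mat_adjoint G * mat_adjoint U) l"] y_def atLeast0LessThan)
    also have "\<dots> = (\<Sum>j<Suc q. (mat_adjoint G * mat_adjoint U) $$ (l, j) * y0 $ j)"
      by (rule sum.mono_neutral_cong_right) (use qn in auto)
    also have "\<dots> = (B *\<^sub>v y0) $ l"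
      using l carrier_vecD[OF y0(1)]
      by (simp add: scalar_prod_def B_def atLeast0LessThan del: index_mult_mat)
    finally show "((mat_adjoint G * mat_adjoint U) *\<^sub>v y) $ l = 0\<^sub>v q $ l"
      by (simp only: y0(3))
  qed (use G in simp)
  finally have "(\<Sum>j<n. lam j * (cmod (y $ j))\<^sup>2) = Re ((X *\<^sub>v ?v) \<bullet>c ?v)"
    using quadratic_form_factor[OF v(1)] unfolding v(2) by simp
  also have "\<dots> \<le> norm (emb X) * (vnorm y)\<^sup>2"
    using real_quadratic_form_bound[OF X v(1)] by (simp add: v(3))
  also have "\<dots> \<le> K * (vnorm y)\<^sup>2"
    by (intro mult_right_mono norm_X) simp
  finally have upper: "(\<Sum>j<n. lam j * (cmod (y $ j))\<^sup>2) \<le> K * (vnorm y)\<^sup>2" .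
  have "lam q * (vnorm y)\<^sup>2 = (\<Sum>j<n. lam q * (cmod (y $ j))\<^sup>2)"
    unfolding vnorm_power2_eq_sum[OF y] by (simp add: sum_distrib_left)
  also have "\<dots> \<le> (\<Sum>j<n. lam j * (cmod (y $ j))\<^sup>2)"
  proof (rule sum_mono)
    fix j assume "j \<in> {..<n}"
    then show "lam q * (cmod (y $ j))\<^sup>2 \<le> lam j * (cmod (y $ j))\<^sup>2"
      using lam_antimono[of j q] qn by (cases "j \<le> q") (auto simp: y_def intro: mult_right_mono)
  qed
  finally have "lam q * (vnorm y)\<^sup>2 \<le> K * (vnorm y)\<^sup>2" using upper by linarith
  then have "lam q \<le> K" using pos by simp
  then show ?thesis using lam_antimono[OF j] by linarith
qed

text \<open>
  The \<open>q\<close>-dimensional range of \<open>G\<close> contains a nonzero vector orthogonal to the first \<open>q - 1\<close>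
  eigenvectors.  On it the quadratic form of \<open>A\<close> is at most the \<open>q\<close>-th eigenvalue, and at least
  \<open>a / 2 - K\<close> because \<open>D \<ge> 1 / 2\<close> and \<open>G\<^sup>*\<close> is bounded below by \<open>\<surd>a\<close> on the range of \<open>G\<close>.
\<close>

lemma lam_top:
  assumes j: "j < q" "q \<le> n"
  shows "a / 2 - K \<le> lam j"
proof -
  obtain m where m: "q = Suc m" using j by (cases q) auto
  define B where "B = Matrix.mat m (Suc m) (\<lambda>(j, l). (U * G) $$ (j, l))"
  obtain w where w: "w \<in> carrier_vec q" "w \<noteq> 0\<^sub>v q" "B *\<^sub>v w = 0\<^sub>v m"
    unfolding m by (rule exists_kernel_vector[of B m]) (simp add: B_def)
  define v where "v = G *\<^sub>v w"
  have v: "v \<in> carrier_vec n" unfolding v_def by (rule mult_mat_vec_carrier[OF G w(1)])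
  have "0 < a * (vnorm w)\<^sup>2" using vnorm_pos[OF w(1,2)] a by simp
  also have "\<dots> \<le> (vnorm v)\<^sup>2" unfolding v_def by (rule coercive[OF w(1)])
  finally have pos: "0 < (vnorm v)\<^sup>2" .
  let ?y = "mat_adjoint G *\<^sub>v v"
  have y: "?y \<in> carrier_vec q" by (rule mult_mat_vec_carrier[OF _ v]) (use G in simp)
  have adj: "a * (vnorm v)\<^sup>2 \<le> (vnorm ?y)\<^sup>2"
  proof -
    have "(vnorm v)\<^sup>2 = cmod ((G *\<^sub>v w) \<bullet>c v)"
      unfolding v_def[symmetric] cscalar_prod_self norm_of_real by simp
    also have "\<dots> = cmod (w \<bullet>c ?y)"
      by (subst cscalar_prod_adjoint) (use G w v in auto)
    also have "\<dots> \<le> vnorm w * vnorm ?y"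
      by (rule cscalar_prod_bound) (use w y in \<open>metis carrier_vecD\<close>)
    finally have "a * ((vnorm v)\<^sup>2)\<^sup>2 \<le> a * (vnorm w * vnorm ?y)\<^sup>2"
      using a by (intro mult_left_mono power_mono) auto
    also have "\<dots> = (a * (vnorm w)\<^sup>2) * (vnorm ?y)\<^sup>2" by (simp add: power_mult_distrib)
    also have "\<dots> \<le> (vnorm v)\<^sup>2 * (vnorm ?y)\<^sup>2"
      unfolding v_def by (intro mult_right_mono coercive[OF w(1)]) simp
    finally have "(a * (vnorm v)\<^sup>2) * (vnorm v)\<^sup>2 \<le> (vnorm ?y)\<^sup>2 * (vnorm v)\<^sup>2"
      by (simp add: power2_eq_square mult_ac)
    then show ?thesis using pos by (rule mult_right_le_imp_le)
  qed
  have Uv: "U *\<^sub>v v \<in> carrier_vec n" by (rule mult_mat_vec_carrier[OF U_carrier v])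
  have zero: "(U *\<^sub>v v) $ j = 0" if jm: "j < m" for j
  proof -
    have "U *\<^sub>v v = (U * G) *\<^sub>v w"
      unfolding v_def by (rule assoc_mult_mat_vec[symmetric, OF U_carrier G w(1)])
    then have "(U *\<^sub>v v) $ j = (\<Sum>l<q. (U * G) $$ (j, l) * w $ l)"
      using jm m \<open>q \<le> n\<close> G w
      by (simp add: scalar_prod_def[of "row (U * G) j"] atLeast0LessThan del: index_mult_mat(1))
    also have "\<dots> = (B *\<^sub>v w) $ j"
      using jm m carrier_vecD[OF w(1)]
      by (simp add: scalar_prod_def B_def atLeast0LessThan del: index_mult_mat)
    finally show ?thesis by (simp add: w(3) jm)
  qed
  have "a / 2 * (vnorm v)\<^sup>2 \<le> 1 / 2 * (vnorm ?y)\<^sup>2" using adj by simp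
  also have "\<dots> \<le> (\<Sum>l<q. dv l * (cmod (?y $ l))\<^sup>2)"
    unfolding vnorm_power2_eq_sum[OF y] sum_distrib_left
    by (intro sum_mono mult_right_mono dv) auto
  finally have "(a / 2 - K) * (vnorm v)\<^sup>2 \<le> (\<Sum>l<q. dv l * (cmod (?y $ l))\<^sup>2) - K * (vnorm v)\<^sup>2"
    by (simp add: algebra_simps)
  also have "\<dots> \<le> (\<Sum>l<q. dv l * (cmod (?y $ l))\<^sup>2) + Re ((X *\<^sub>v v) \<bullet>c v)"
    using real_quadratic_form_bound[OF X v] mult_right_mono[OF norm_X, of "(vnorm v)\<^sup>2"] by simp
  also have "\<dots> = (\<Sum>j<n. lam j * (cmod ((U *\<^sub>v v) $ j))\<^sup>2)"
    by (rule quadratic_form_factor[OF v, symmetric])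
  also have "\<dots> \<le> (\<Sum>j<n. lam m * (cmod ((U *\<^sub>v v) $ j))\<^sup>2)"
  proof (rule sum_mono)
    fix j assume "j \<in> {..<n}"
    then show "lam j * (cmod ((U *\<^sub>v v) $ j))\<^sup>2 \<le> lam m * (cmod ((U *\<^sub>v v) $ j))\<^sup>2"
      using lam_antimono[of m j] zero[of j] by (cases "m \<le> j") (auto intro: mult_right_mono)
  qed
  also have "\<dots> = lam m * (vnorm v)\<^sup>2"
    unfolding vnorm_U[OF v, symmetric] vnorm_power2_eq_sum[OF Uv] by (simp add: sum_distrib_left)
  finally have "a / 2 - K \<le> lam m" using pos by simp
  moreover have "lam m \<le> lam j" using lam_antimono[of j m] j m by simp
  ultimately show ?thesis by linarith
qed

text \<open>
  The shift \<open>K + 1\<close> makes all eigenvalues at least 1; then the bulk lies in \<open>[1, 2 K + 1]\<close> and the leading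
  eigenvalues exceed twice that, because \<open>a\<close> is large.  The scale \<open>\<tau>\<close> will be \<open>\<surd>n\<close>: it moves a
  factor \<open>\<tau>\<^sup>2\<close> from \<open>G G\<^sup>*\<close> to \<open>D\<close>, so that \<open>g\<close> and \<open>W\<close> are of order 1.
\<close>

lemma resolvent_data:
  fixes \<tau> :: real
  assumes qn: "q \<le> n" and \<tau>: "0 < \<tau>" and large: "8 * K + 4 \<le> a"
    and L: "(2 * K + 2) * (1 + \<tau> / sqrt a) \<le> L"
  shows "\<exists>R T W V H. spectral_split (2 * K + 1) (emb (1\<^sub>m n)) R
      (emb (Matrix.mat n n (\<lambda>(i, k). \<Sum>j<q. cnj (p j $ i) * p j $ k))) T \<and>
    bordered_resolvent L (emb (1\<^sub>m n)) (emb (1\<^sub>m q)) R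
      ((1 / \<tau>) *\<^sub>R emb G) ((1 / \<tau>) *\<^sub>R emb (mat_adjoint G))
      ((1 / \<tau>\<^sup>2) *\<^sub>R emb (mat_diag q (\<lambda>l. complex_of_real (1 / dv l))))
      (emb X + (K + 1) *\<^sub>R emb (1\<^sub>m n)) W V H"
proof -
  define c where "c = K + 1"
  define R where "R = calc (\<lambda>j. 1 / (lam j + c))"
  have low: "1 \<le> lam j + c" if "j < n" for j
    using lam_lower[OF that] by (simp add: c_def)
  have split: "spectral_split (2 * K + 1) (emb (1\<^sub>m n)) R (calc (\<lambda>j. if j < q then 1 else 0))
      (calc (\<lambda>j. if j < q then 0 else lam j + c))"
    unfolding R_def
  proof (rule spectral_split_calc)
    show "lam j + c \<le> 2 * K + 1" if "q \<le> j" "j < n" for j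
      using lam_bulk[OF that] by (simp add: c_def)
    show "2 * (2 * K + 1) \<le> lam j + c" if "j < q" "j < n" for j
      using lam_top[OF that(1) qn] large K_nonneg by (simp add: c_def)
  qed (use K_nonneg low in auto)
  obtain H where H: "H \<in> carrier_mat n q" "mat_adjoint G * H = 1\<^sub>m q" "norm (emb H) \<le> 1 / sqrt a"
    using gram_right_inverse[OF G a coercive] by blast
  let ?e = "emb (1\<^sub>m n)" and ?f = "emb (1\<^sub>m q)"
  define g g' E x where "g = (1 / \<tau>) *\<^sub>R emb G" and "g' = (1 / \<tau>) *\<^sub>R emb (mat_adjoint G)"
    and "E = (1 / \<tau>\<^sup>2) *\<^sub>R emb (mat_diag q (\<lambda>l. complex_of_real (1 / dv l)))"
    and "x = emb X + c *\<^sub>R ?e"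
  define Dt where "Dt = \<tau>\<^sup>2 *\<^sub>R emb D"
  define h h' where "h = \<tau> *\<^sub>R emb H" and "h' = \<tau> *\<^sub>R emb (mat_adjoint H)"
  have gh: "g' * h = ?f"
    using \<tau> H G by (simp add: g'_def h_def flip: emb_mult)
  have hg: "h' * g = ?f"
  proof -
    have "mat_adjoint H * G = mat_adjoint (mat_adjoint G * H)"
      by (subst mat_adjoint_mult) (use H(1) G in auto)
    also have "\<dots> = 1\<^sub>m q"
      unfolding H(2) by (rule eq_matI) auto
    finally show ?thesis
      using \<tau> H G by (simp add: g_def h'_def flip: emb_mult)
  qed
  have DE: "Dt * E = ?f" "E * Dt = ?f"
  proof -
    have "D * mat_diag q (\<lambda>l. complex_of_real (1 / dv l)) = 1\<^sub>m q"
      "mat_diag q (\<lambda>l. complex_of_real (1 / dv l)) * D = 1\<^sub>m q"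
      unfolding mat_diag_diag using dv by (auto intro!: eq_matI simp: mat_diag_def) fastforce+
    then show "Dt * E = ?f" "E * Dt = ?f"
      using \<tau> by (simp_all add: Dt_def E_def mat_diag_def flip: emb_mult)
  qed
  have units: "?e * ?e = ?e" "?e * emb X = emb X" "emb X * ?e = emb X" "g * ?f = g" "?f * g' = g'"
    "?f * ?f = ?f" "Dt * ?f = Dt" "?f * Dt = Dt"
    using G X by (simp_all add: g_def g'_def Dt_def mat_diag_def flip: emb_mult)
  have "emb A = emb (G * D * mat_adjoint G) + emb X"
    unfolding A_eq by (rule emb_add) (use G X in \<open>auto simp: mat_diag_def\<close>)
  also have "emb (G * D * mat_adjoint G) = g * Dt * g'"
    using G \<tau> by (simp add: emb_mult mat_diag_def g_def g'_def Dt_def power2_eq_square)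
  finally have A_split: "emb A + c *\<^sub>R ?e = g * Dt * g' + x"
    by (simp add: x_def)
  have shift: "calc (\<lambda>j. lam j + c) = emb A + c *\<^sub>R ?e"
  proof -
    have "calc (\<lambda>j. - c) = - c *\<^sub>R ?e"
    proof -
      have "mat_diag n (\<lambda>j. complex_of_real (- c)) = complex_of_real (- c) \<cdot>\<^sub>m 1\<^sub>m n"
        by (rule eq_matI) (auto simp: mat_diag_def)
      then show ?thesis
        by (simp only: calc_def emb_smult) (simp add: emb_one_right[of _ n] emb_U)
    qed
    then show ?thesis
      using calc_diff[of lam "\<lambda>j. - c"] calc_lam by simp
  qed
  have inv: "R * (g * Dt * g' + x) = ?e" "(g * Dt * g' + x) * R = ?e"
    unfolding A_split[symmetric] shift[symmetric] R_def calc_mult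
    by (subst calc_one[symmetric], rule calc_cong, use low in force)+
  note R_unit = spectral_split.unit_R[OF split]
  define W V where "W = R * g * Dt" and "V = Dt * g' * R"
  have Wg: "W * g' = ?e - R * x" and gV: "g * V = ?e - x * R"
    using inv by (simp_all add: W_def V_def algebra_simps)
  have "R * g = W * E" "g' * R = E * V"
    by (simp_all add: W_def V_def mult.assoc DE units flip: mult.assoc[of E] mult.assoc[of ?f])
  have W_eq: "W = (?e - R * x) * h"
  proof -
    have "W = W * (g' * h)"
      by (simp add: gh W_def mult.assoc units)
    then show ?thesis by (simp add: Wg flip: mult.assoc)
  qed
  have V_eq: "V = h' * (?e - x * R)"
  proof -
    have "V = h' * g * V"
      by (simp add: hg V_def units flip: mult.assoc)
    then show ?thesis by (simp add: gV mult.assoc)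
  qed
  have ne: "norm ?e \<le> 1"
    unfolding calc_one[symmetric] by (rule norm_calc_le) auto
  have nR: "norm R \<le> 1"
    unfolding R_def by (rule norm_calc_le) (use low in \<open>fastforce simp: divide_le_eq\<close>)+
  have nx: "norm x \<le> 2 * K + 1"
  proof -
    have "norm x \<le> K + c * 1"
      unfolding x_def
      by (rule norm_triangle_mono[OF norm_X]) (use ne K_nonneg in \<open>simp add: c_def mult_left_le\<close>)
    then show ?thesis by (simp add: c_def)
  qed
  have nh: "norm h \<le> \<tau> / sqrt a" "norm h' \<le> \<tau> / sqrt a"
    using mult_left_mono[OF H(3), of \<tau>] \<tau> by (simp_all add: h_def h'_def norm_emb_adjoint)
  have e_minus: "norm (?e - y) \<le> 2 * K + 2" if "norm y \<le> 2 * K + 1" for y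
  proof -
    have "norm (?e - y) \<le> norm ?e + norm y" by (rule norm_triangle_ineq4)
    with that ne show ?thesis by linarith
  qed
  have nRx: "norm (?e - R * x) \<le> 2 * K + 2" "norm (?e - x * R) \<le> 2 * K + 2"
    using norm_mult_le[OF nR nx] norm_mult_le[OF nx nR] by (simp_all add: e_minus)
  have pos: "0 \<le> \<tau> / sqrt a" using \<tau> a by simp
  have "2 * K + 2 + (2 * K + 2) * (\<tau> / sqrt a) \<le> L" "0 \<le> (2 * K + 2) * (\<tau> / sqrt a)"
    "\<tau> / sqrt a \<le> (2 * K + 2) * (\<tau> / sqrt a)"
    using L pos K_nonneg mult_right_mono[of 1 "2 * K + 2" "\<tau> / sqrt a"] by (simp_all add: algebra_simps)
  then have L1: "2 * K + 2 \<le> L" "(2 * K + 2) * (\<tau> / sqrt a) \<le> L" "\<tau> / sqrt a \<le> L"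
    using K_nonneg by - linarith+
  have "bordered_resolvent L ?e ?f R g g' E x W V h"
  proof
    show "W * ?f = W" by (simp add: W_def mult.assoc units)
    show "norm R \<le> L" "norm x \<le> L" using nR nx L1 K_nonneg by - linarith+
    show "norm h \<le> L" using nh L1 by linarith
    show "norm W \<le> L" "norm V \<le> L"
      unfolding W_eq V_eq using norm_mult_le[OF nRx(1) nh(1)] norm_mult_le[OF nh(2) nRx(2)] L1
      by (simp_all add: mult.commute)
  qed fact+
  with split show ?thesis
    unfolding calc_indicator[OF qn] g_def g'_def E_def x_def c_def by blast
qed

end

section \<open>Finite differences of smooth functions\<close>

lemma vector_mean_value_bound:
  fixes f :: "real \<Rightarrow> 'a::real_normed_vector"
  assumes "\<And>t. t \<in> closed_segment x y \<Longrightarrow> (f has_vector_derivative f' t) (at t)"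
    and "\<And>t. t \<in> closed_segment x y \<Longrightarrow> norm (f' t) \<le> B"
  shows "norm (f x - f y) \<le> B * \<bar>x - y\<bar>"
proof -
  have "norm (f x - f y) \<le> B * norm (x - y)"
  proof (rule differentiable_bound[of "closed_segment x y"])
    fix t assume t: "t \<in> closed_segment x y"
    show "(f has_derivative (\<lambda>h. h *\<^sub>R f' t)) (at t within closed_segment x y)"
      using assms(1)[OF t] unfolding has_vector_derivative_def by (rule has_derivative_at_withinI)
    have "onorm (\<lambda>h. h *\<^sub>R f' t) = norm (f' t)"
      using onorm_scaleR_left[OF bounded_linear_ident, of "f' t"] by (simp add: onorm_id)
    then show "onorm (\<lambda>h. h *\<^sub>R f' t) \<le> B" using assms(2)[OF t] by simp
  qed auto
  then show ?thesis by simp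
qed

text \<open>
  The mean value inequality applied twice, to \<open>s \<mapsto> f (x + s) + f (x - s)\<close> and then to \<open>f'\<close>.
\<close>

lemma second_difference_mean_value_bound:
  fixes f :: "real \<Rightarrow> 'a::real_normed_vector"
  assumes \<eta>: "0 \<le> \<eta>"
    and f: "\<And>t. \<bar>t - x\<bar> \<le> \<eta> \<Longrightarrow> (f has_vector_derivative f' t) (at t)"
    and f': "\<And>t. \<bar>t - x\<bar> \<le> \<eta> \<Longrightarrow> (f' has_vector_derivative f'' t) (at t)"
    and B: "\<And>t. \<bar>t - x\<bar> \<le> \<eta> \<Longrightarrow> norm (f'' t) \<le> B"
  shows "norm ((f (x + \<eta>) - f x) + (f (x - \<eta>) - f x)) \<le> 2 * B * \<eta>\<^sup>2"
proof -
  have B0: "0 \<le> B" using order_trans[OF norm_ge_zero B[of x]] \<eta> by simp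
  define k where "k s = f (x + s) + f (x - s)" for s
  have seg: "\<bar>t - x\<bar> \<le> \<eta>" if "s \<in> closed_segment \<eta> 0" "t = x + s \<or> t = x - s" for s t
    using that \<eta> by (auto simp: closed_segment_eq_real_ivl split: if_splits)
  have "norm (k \<eta> - k 0) \<le> (2 * B * \<eta>) * \<bar>\<eta> - 0\<bar>"
  proof (rule vector_mean_value_bound)
    fix s assume s: "s \<in> closed_segment \<eta> 0"
    then have s0: "0 \<le> s" "s \<le> \<eta>" using \<eta> by (auto simp: closed_segment_eq_real_ivl split: if_splits)
    have "((f \<circ> (\<lambda>s. x + s)) has_vector_derivative 1 *\<^sub>R f' (x + s)) (at s)"
      by (rule vector_diff_chain_at) (use f[OF seg[OF s]] in \<open>auto intro!: derivative_eq_intros\<close>)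
    moreover have "((f \<circ> (\<lambda>s. x - s)) has_vector_derivative (- 1) *\<^sub>R f' (x - s)) (at s)"
      by (rule vector_diff_chain_at) (use f[OF seg[OF s]] in \<open>auto intro!: derivative_eq_intros\<close>)
    ultimately show "(k has_vector_derivative (f' (x + s) - f' (x - s))) (at s)"
      unfolding k_def using has_vector_derivative_add by (fastforce simp: o_def)
    have "norm (f' (x + s) - f' (x - s)) \<le> B * \<bar>(x + s) - (x - s)\<bar>"
    proof (rule vector_mean_value_bound)
      fix t assume "t \<in> closed_segment (x + s) (x - s)"
      then have "\<bar>t - x\<bar> \<le> \<eta>" using s0 by (auto simp: closed_segment_eq_real_ivl split: if_splits)
      then show "(f' has_vector_derivative f'' t) (at t)" "norm (f'' t) \<le> B"
        using f' B by auto
    qed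
    also have "\<dots> \<le> B * (2 * \<eta>)" using s0 B0 by (intro mult_left_mono) auto
    finally show "norm (f' (x + s) - f' (x - s)) \<le> 2 * B * \<eta>" by (simp add: mult_ac)
  qed
  moreover have "k \<eta> - k 0 = (f (x + \<eta>) - f x) + (f (x - \<eta>) - f x)"
    by (simp add: k_def)
  ultimately show ?thesis using \<eta> by (simp add: power2_eq_square mult.assoc)
qed

lemma norm_emb_le_bilinear:
  assumes c: "0 \<le> c"
    and bound: "\<And>v w. v \<in> carrier_vec (dim_col A) \<Longrightarrow> w \<in> carrier_vec (dim_row A) \<Longrightarrow>
      cmod ((A *\<^sub>v v) \<bullet>c w) \<le> c * (vnorm v * vnorm w)"
  shows "norm (emb A) \<le> c"
proof (rule norm_emb_le[OF c])
  fix v :: "complex Matrix.vec" assume v: "v \<in> carrier_vec (dim_col A)"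
  let ?w = "A *\<^sub>v v"
  have "?w \<in> carrier_vec (dim_row A)" by (rule carrier_vecI) simp
  from bound[OF v this] have "vnorm ?w * vnorm ?w \<le> (c * vnorm v) * vnorm ?w"
    unfolding cscalar_prod_self norm_of_real by (simp add: power2_eq_square mult_ac)
  then show "vnorm ?w \<le> c * vnorm v"
  proof (cases "vnorm ?w = 0")
    case False
    assume le: "vnorm ?w * vnorm ?w \<le> (c * vnorm v) * vnorm ?w"
    have "0 < vnorm ?w" using False vnorm_nonneg[of ?w] by linarith
    with le show ?thesis by (rule mult_right_le_imp_le)
  qed (use c in simp)
qed

lemma cscalar_prod_mult_eq_sum:
  fixes A :: "complex mat"
  assumes "A \<in> carrier_mat n m" "v \<in> carrier_vec m" "w \<in> carrier_vec n"
  shows "(A *\<^sub>v v) \<bullet>c w = (\<Sum>i<n. \<Sum>j<m. A $$ (i, j) * (v $ j * cnj (w $ i)))"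
  using assms
  by (auto simp: cscalar_prod_eq_sum scalar_prod_def atLeast0LessThan sum_distrib_right mult.assoc)

lemma mat_deriv_carrier [simp]: "mat_deriv n m F t \<in> carrier_mat n m"
  by (simp add: mat_deriv_def)

lemma has_vector_derivative_form:
  assumes F: "mat_differentiable n m F" "\<And>t. F t \<in> carrier_mat n m"
    and vw: "v \<in> carrier_vec m" "w \<in> carrier_vec n"
  shows "((\<lambda>t. (F t *\<^sub>v v) \<bullet>c w) has_vector_derivative (mat_deriv n m F t *\<^sub>v v) \<bullet>c w) (at t)"
proof -
  have "((\<lambda>t. F t $$ (i, j)) has_vector_derivative mat_deriv n m F t $$ (i, j)) (at t)"
    if "i < n" "j < m" for i j
    using F(1) that unfolding mat_differentiable_def mat_deriv_def
    by (auto simp: vector_derivative_works)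
  then show ?thesis
    unfolding cscalar_prod_mult_eq_sum[OF F(2) vw] cscalar_prod_mult_eq_sum[OF mat_deriv_carrier vw]
    by (intro has_vector_derivative_sum has_vector_derivative_mult_left) auto
qed

lemma cscalar_prod_minus_mult:
  fixes A B :: "complex mat"
  assumes "A \<in> carrier_mat n m" "B \<in> carrier_mat n m" "v \<in> carrier_vec m" "w \<in> carrier_vec n"
  shows "((A - B) *\<^sub>v v) \<bullet>c w = (A *\<^sub>v v) \<bullet>c w - (B *\<^sub>v v) \<bullet>c w"
    and "((A + B) *\<^sub>v v) \<bullet>c w = (A *\<^sub>v v) \<bullet>c w + (B *\<^sub>v v) \<bullet>c w"
  unfolding cscalar_prod_mult_eq_sum[OF assms(1,3,4)] cscalar_prod_mult_eq_sum[OF assms(2,3,4)]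
    cscalar_prod_mult_eq_sum[OF minus_carrier_mat[OF assms(2)] assms(3,4)]
    cscalar_prod_mult_eq_sum[OF add_carrier_mat[OF assms(2)] assms(3,4)]
  using assms by (simp_all add: algebra_simps sum_subtractf sum.distrib)

lemma cscalar_form_bound:
  assumes "A \<in> carrier_mat n m" "v \<in> carrier_vec m" "w \<in> carrier_vec n" "norm (emb A) \<le> B"
  shows "cmod ((A *\<^sub>v v) \<bullet>c w) \<le> B * (vnorm v * vnorm w)"
proof -
  have "cmod ((A *\<^sub>v v) \<bullet>c w) \<le> vnorm (A *\<^sub>v v) * vnorm w"
    by (rule cscalar_prod_bound) (use assms in simp)
  also have "\<dots> \<le> norm (emb A) * vnorm v * vnorm w"
    by (intro mult_right_mono vnorm_mult_mat_vec_le) (use assms in simp_all)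
  also have "\<dots> \<le> B * vnorm v * vnorm w"
    by (intro mult_right_mono assms) simp_all
  finally show ?thesis by (simp add: mult.assoc)
qed

text \<open>
  Operator norm bounds on derivatives turn into bounds on differences by applying the scalar inequality to
  the functions \<open>t \<mapsto> (F t v) \<bullet> w\<close>, with constants that do not depend on the size of the matrices.
\<close>

lemma emb_difference_bound:
  assumes F: "mat_differentiable n m F" "\<And>t. F t \<in> carrier_mat n m"
    and B: "\<And>t. norm (emb (mat_deriv n m F t)) \<le> B"
  shows "norm (emb (F x) - emb (F y)) \<le> B * \<bar>x - y\<bar>"
proof -
  have B0: "0 \<le> B" using B[of x] norm_ge_zero order_trans by blast
  have "norm (emb (F x - F y)) \<le> B * \<bar>x - y\<bar>"
  proof (rule norm_emb_le_bilinear)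
    fix v w :: "complex Matrix.vec"
    assume "v \<in> carrier_vec (dim_col (F x - F y))" "w \<in> carrier_vec (dim_row (F x - F y))"
    then have vw: "v \<in> carrier_vec m" "w \<in> carrier_vec n" using F(2)[of y] by simp_all
    have "cmod ((F x *\<^sub>v v) \<bullet>c w - (F y *\<^sub>v v) \<bullet>c w) \<le> (B * (vnorm v * vnorm w)) * \<bar>x - y\<bar>"
      by (rule vector_mean_value_bound[OF has_vector_derivative_form[OF F vw]])
        (rule cscalar_form_bound[OF mat_deriv_carrier vw B])
    then show "cmod (((F x - F y) *\<^sub>v v) \<bullet>c w) \<le> B * \<bar>x - y\<bar> * (vnorm v * vnorm w)"
      by (simp add: cscalar_prod_minus_mult[OF F(2) F(2) vw] mult_ac)
  qed (use B0 in simp)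
  then show ?thesis by (simp add: emb_minus[OF F(2) F(2)])
qed

lemma emb_second_difference_bound:
  assumes F: "mat_twice_differentiable n m F" "\<And>t. F t \<in> carrier_mat n m"
    and B: "\<And>t. norm (emb (mat_deriv n m (mat_deriv n m F) t)) \<le> B" and \<eta>: "0 \<le> \<eta>"
  shows "norm ((emb (F (x + \<eta>)) - emb (F x)) + (emb (F (x - \<eta>)) - emb (F x))) \<le> 2 * B * \<eta>\<^sup>2"
proof -
  have B0: "0 \<le> B" using B[of x] norm_ge_zero order_trans by blast
  have d: "mat_differentiable n m F" "mat_differentiable n m (mat_deriv n m F)"
    using F(1) by (simp_all add: mat_twice_differentiable_def)
  let ?A = "(F (x + \<eta>) - F x) + (F (x - \<eta>) - F x)"
  have A: "F s - F t \<in> carrier_mat n m" for s t using F(2) by (intro minus_carrier_mat)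
  have "norm (emb ?A) \<le> 2 * B * \<eta>\<^sup>2"
  proof (rule norm_emb_le_bilinear)
    fix v w :: "complex Matrix.vec"
    assume "v \<in> carrier_vec (dim_col ?A)" "w \<in> carrier_vec (dim_row ?A)"
    then have vw: "v \<in> carrier_vec m" "w \<in> carrier_vec n" using F(2)[of x] by simp_all
    let ?f = "\<lambda>t. (F t *\<^sub>v v) \<bullet>c w"
    have "cmod ((?f (x + \<eta>) - ?f x) + (?f (x - \<eta>) - ?f x)) \<le> 2 * (B * (vnorm v * vnorm w)) * \<eta>\<^sup>2"
      by (rule second_difference_mean_value_bound[OF \<eta> has_vector_derivative_form[OF d(1) F(2) vw]
            has_vector_derivative_form[OF d(2) mat_deriv_carrier vw]
            cscalar_form_bound[OF mat_deriv_carrier vw B]])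
    then show "cmod ((?A *\<^sub>v v) \<bullet>c w) \<le> 2 * B * \<eta>\<^sup>2 * (vnorm v * vnorm w)"
      by (simp add: cscalar_prod_minus_mult[OF F(2) F(2) vw] cscalar_prod_minus_mult(2)[OF A A vw] mult_ac)
  qed (use B0 in simp)
  then show ?thesis by (simp only: emb_add[OF A A] emb_minus[OF F(2) F(2)])
qed

lemma vector_derivative_periodic:
  fixes f :: "real \<Rightarrow> 'a::real_normed_vector"
  assumes "\<And>t. f (t + r) = f t"
  shows "vector_derivative f (at (x + r)) = vector_derivative f (at x)"
proof -
  have "(f has_vector_derivative D) (at (x + r)) \<longleftrightarrow> (f has_vector_derivative D) (at x)" for D
  proof
    have shift: "(g has_vector_derivative D) (at y)"
      if "(f has_vector_derivative D) (at (y + c))" "\<And>t. g t = f (t + c)" for g :: "real \<Rightarrow> 'a" and y c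
    proof -
      have "((f \<circ> (\<lambda>t. t + c)) has_vector_derivative 1 *\<^sub>R D) (at y)"
        by (rule vector_diff_chain_at) (use that in \<open>auto intro!: derivative_eq_intros\<close>)
      moreover have "f \<circ> (\<lambda>t. t + c) = g" using that(2) by auto
      ultimately show ?thesis by simp
    qed
    show "(f has_vector_derivative D) (at x)" if "(f has_vector_derivative D) (at (x + r))"
      by (rule shift[OF that]) (simp add: assms)
    show "(f has_vector_derivative D) (at (x + r))" if "(f has_vector_derivative D) (at x)"
      by (rule shift[of _ "- r"]) (use that assms[of "t - r" for t] in auto)
  qed
  then show ?thesis by (simp add: vector_derivative_def)
qed

lemma mat_deriv_periodic:
  assumes "\<And>t. F (t + r) = F t"
  shows "mat_deriv n m F (t + r) = mat_deriv n m F t"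
  unfolding mat_deriv_def
  by (intro eq_matI) (auto intro!: vector_derivative_periodic simp: assms)

section \<open>Powers of the distance to frequency 0\<close>

text \<open>
  The transfer function \<open>|1 - e\<^sup>-\<^sup>i\<^sup>t|\<^sup>s\<close>, that is \<open>(2 |sin (t / 2)|)\<^sup>s\<close>, of fractional differencing.  With
  \<open>s = 2 d\<close> it is the reciprocal of the long-memory factor and vanishes at frequency 0 like \<open>|t|\<^sup>s\<close>.
\<close>

definition zero_dist_powr :: "real \<Rightarrow> real \<Rightarrow> real" where
  "zero_dist_powr s t = cmod (1 - cis (- t)) powr s"

lemma cmod_one_minus_cis: "cmod (1 - cis (- t)) = 2 * \<bar>sin (t / 2)\<bar>"
proof -
  have "(cmod (1 - cis (- t)))\<^sup>2 = (1 - cos t)\<^sup>2 + (sin t)\<^sup>2"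
    by (simp add: cmod_power2)
  also have "\<dots> = 2 - 2 * cos t"
    using sin_cos_squared_add[of t] by (simp add: power2_eq_square algebra_simps)
  also have "cos t = 1 - 2 * (sin (t / 2))\<^sup>2"
    using cos_double_sin[of "t / 2"] by simp
  finally have "(cmod (1 - cis (- t)))\<^sup>2 = (2 * \<bar>sin (t / 2)\<bar>)\<^sup>2"
    by (simp add: power_mult_distrib)
  then show ?thesis by (rule power2_eq_imp_eq) auto
qed

text \<open>
  Normalise the larger number to 1: then the claim is \<open>1 \<le> u\<^sup>s + (1 - u)\<^sup>s\<close>, which holds because
  \<open>u \<le> u\<^sup>s\<close> on the unit interval.
\<close>

lemma powr_diff_holder:
  fixes a b s :: real
  assumes "0 \<le> a" "0 \<le> b" "0 \<le> s" "s \<le> 1"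
  shows "\<bar>a powr s - b powr s\<bar> \<le> \<bar>a - b\<bar> powr s"
proof -
  have main: "a powr s - b powr s \<le> (a - b) powr s" if "0 \<le> b" "b < a" for a b :: real
  proof (cases "b = 0")
    case False
    with that have ab: "0 < b" "0 < a" by auto
    have unit: "u \<le> u powr s" if "0 < u" "u \<le> 1" for u :: real
      using powr_mono'[of s 1 u] that assms by simp
    have "1 = b / a + (a - b) / a" using ab by (simp add: field_simps)
    also have "\<dots> \<le> (b / a) powr s + ((a - b) / a) powr s"
      using ab that by (intro add_mono unit) auto
    also have "\<dots> = (b powr s + (a - b) powr s) / a powr s"
      using ab that by (simp add: powr_divide add_divide_distrib)
    finally have "a powr s \<le> b powr s + (a - b) powr s"
      using ab by (simp add: field_simps)
    then show ?thesis by simp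
  qed simp
  have mono: "b powr s \<le> a powr s" if "0 \<le> b" "b < a" for a b :: real
    using that assms by (intro powr_mono2) auto
  consider "a = b" | "a < b" | "b < a" by linarith
  then show ?thesis
  proof cases
    case 2
    then show ?thesis using main[of a b] mono[of a b] assms by simp
  next
    case 3
    then show ?thesis using main[of b a] mono[of b a] assms by simp
  qed simp
qed

lemma zero_dist_powr_holder:
  assumes "0 \<le> s" "s \<le> 1"
  shows "\<bar>zero_dist_powr s x - zero_dist_powr s y\<bar> \<le> \<bar>x - y\<bar> powr s"
proof -
  have "\<bar>cmod (1 - cis (- x)) - cmod (1 - cis (- y))\<bar> \<le> cmod ((1 - cis (- x)) - (1 - cis (- y)))"
    by (rule norm_triangle_ineq3)
  also have "(1 - cis (- x)) - (1 - cis (- y)) = cis (- y) * (1 - cis (- (x - y)))"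
    by (simp add: algebra_simps cis_mult)
  also have "cmod \<dots> = 2 * \<bar>sin ((x - y) / 2)\<bar>"
    by (simp only: norm_mult norm_cis cmod_one_minus_cis)
  also have "\<dots> \<le> \<bar>x - y\<bar>"
    using abs_sin_x_le_abs_x[of "(x - y) / 2"] by simp
  finally have le: "\<bar>cmod (1 - cis (- x)) - cmod (1 - cis (- y))\<bar> \<le> \<bar>x - y\<bar>" .
  have "\<bar>zero_dist_powr s x - zero_dist_powr s y\<bar> \<le> \<bar>cmod (1 - cis (- x)) - cmod (1 - cis (- y))\<bar> powr s"
    unfolding zero_dist_powr_def by (rule powr_diff_holder) (use assms in auto)
  also have "\<dots> \<le> \<bar>x - y\<bar> powr s"
    by (rule powr_mono2) (use assms le in auto)
  finally show ?thesis .
qed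

lemma zero_dist_powr_even: "zero_dist_powr s (- t) = zero_dist_powr s t"
  by (simp only: zero_dist_powr_def cmod_one_minus_cis) simp

text \<open>
  The range beyond \<open>\<pi> / 2\<close> matters: for \<open>\<theta> \<le> \<pi>\<close> and \<open>\<eta> \<le> \<theta> / 2\<close> the half-angle of
  \<open>\<theta> + \<eta>\<close> can reach \<open>3 \<pi> / 4\<close>.
\<close>

lemma sin_ge_quarter:
  assumes "0 \<le> x" "x \<le> 3 * pi / 4"
  shows "x / 4 \<le> sin x"
proof (cases "x \<le> pi / 3")
  case True
  have "sin 0 - 0 / 2 \<le> sin x - x / 2"
  proof (rule DERIV_nonneg_imp_nondecreasing[OF assms(1)])
    fix t assume "0 \<le> t" "t \<le> x"
    with True have "cos (pi / 3) \<le> cos t"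
      by (intro cos_monotone_0_pi_le) (use pi_gt_zero in linarith)+
    then have "0 \<le> cos t - 1 / 2" by (simp add: cos_60)
    moreover have "((\<lambda>x. sin x - x / 2) has_real_derivative cos t - 1 / 2) (at t)"
      by (auto intro!: derivative_eq_intros)
    ultimately show "\<exists>y. ((\<lambda>x. sin x - x / 2) has_real_derivative y) (at t) \<and> 0 \<le> y"
      by blast
  qed
  then show ?thesis using assms by simp
next
  case False
  have "cos (pi / 4) \<le> cos \<bar>x - pi / 2\<bar>"
    by (intro cos_monotone_0_pi_le) (use False assms pi_gt_zero in \<open>auto simp: abs_if field_simps\<close>)
  also have "\<dots> = sin x" by (simp add: cos_diff)
  finally have "sqrt 2 / 2 \<le> sin x" by (simp add: cos_45)
  moreover have "1.4 \<le> sqrt 2" by (rule real_le_rsqrt) (simp add: power2_eq_square)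
  moreover have "x / 4 \<le> 0.7" using assms pi_less_4 pi_approx by (simp add: field_simps)
  ultimately show ?thesis by linarith
qed

text \<open>
  On the interval of radius \<open>\<eta> \<le> \<theta> / 2\<close> about \<open>\<theta>\<close> the function is smooth, with derivatives of
  order \<open>\<theta>\<^sup>s\<^sup>-\<^sup>1\<close> and \<open>\<theta>\<^sup>s\<^sup>-\<^sup>2\<close> since \<open>2 sin (t / 2) \<ge> \<theta> / 8\<close> there.
\<close>

lemma zero_dist_powr_differences:
  assumes \<theta>: "0 < \<theta>" "\<theta> \<le> pi" and \<eta>: "0 \<le> \<eta>" "2 * \<eta> \<le> \<theta>" and s: "0 \<le> s" "s \<le> 1"
  shows "\<bar>zero_dist_powr s (\<theta> + \<eta>) - zero_dist_powr s \<theta>\<bar> \<le> 8 * \<eta> * \<theta> powr (s - 1)"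
    and "\<bar>zero_dist_powr s (\<theta> - \<eta>) - zero_dist_powr s \<theta>\<bar> \<le> 8 * \<eta> * \<theta> powr (s - 1)"
    and "\<bar>(zero_dist_powr s (\<theta> + \<eta>) - zero_dist_powr s \<theta>) + (zero_dist_powr s (\<theta> - \<eta>) - zero_dist_powr s \<theta>)\<bar>
      \<le> 160 * \<eta>\<^sup>2 * \<theta> powr (s - 2)"
proof -
  define f where "f t = (2 * sin (t / 2)) powr s" for t
  define f' where "f' t = s * (2 * sin (t / 2)) powr (s - 1) * cos (t / 2)" for t
  define f'' where "f'' t = s * (s - 1) * (2 * sin (t / 2)) powr (s - 2) * (cos (t / 2))\<^sup>2
      - s / 2 * (2 * sin (t / 2)) powr (s - 1) * sin (t / 2)" for t
  have near: "\<theta> / 8 \<le> 2 * sin (t / 2) \<and> 0 < sin (t / 2)" if "\<bar>t - \<theta>\<bar> \<le> \<eta>" for t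
  proof -
    have "\<theta> / 2 \<le> t" "t \<le> 3 / 2 * \<theta>" using that \<eta> by (auto simp: abs_if split: if_splits)
    then have "t / 2 / 4 \<le> sin (t / 2)" using \<theta> by (intro sin_ge_quarter) auto
    then show ?thesis using \<open>\<theta> / 2 \<le> t\<close> \<theta> by auto
  qed
  have eq: "zero_dist_powr s t = f t" if "\<bar>t - \<theta>\<bar> \<le> \<eta>" for t
    using near[OF that] by (simp only: zero_dist_powr_def cmod_one_minus_cis f_def) simp
  have d1: "(f has_vector_derivative f' t) (at t)" if "\<bar>t - \<theta>\<bar> \<le> \<eta>" for t
    unfolding f_def f'_def has_real_derivative_iff_has_vector_derivative[symmetric]
    using near[OF that] by (auto intro!: derivative_eq_intros)
  have d2: "(f' has_vector_derivative f'' t) (at t)" if "\<bar>t - \<theta>\<bar> \<le> \<eta>" for t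
    unfolding f'_def f''_def has_real_derivative_iff_has_vector_derivative[symmetric]
    using near[OF that] by (auto intro!: derivative_eq_intros simp: power2_eq_square algebra_simps)
  have pw: "(2 * sin (t / 2)) powr (s - k) \<le> 8 ^ k * \<theta> powr (s - k)"
    if "\<bar>t - \<theta>\<bar> \<le> \<eta>" "1 \<le> k" for t and k :: nat
  proof -
    have "(2 * sin (t / 2)) powr (s - k) \<le> (\<theta> / 8) powr (s - k)"
      by (rule powr_mono2') (use near[OF that(1)] \<theta> that(2) s in auto)
    also have "\<dots> = 8 powr (k - s) * \<theta> powr (s - k)"
      using \<theta> powr_minus_divide[of 8 "k - s"] by (simp add: powr_divide)
    also have "\<dots> \<le> 8 powr k * \<theta> powr (s - k)"
      using s by (intro mult_right_mono powr_mono) auto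
    finally show ?thesis by (simp add: powr_realpow)
  qed
  have b1: "norm (f' t) \<le> 8 * \<theta> powr (s - 1)" if "\<bar>t - \<theta>\<bar> \<le> \<eta>" for t
  proof -
    have "norm (f' t) = s * (2 * sin (t / 2)) powr (s - 1) * \<bar>cos (t / 2)\<bar>"
      using s by (simp add: f'_def abs_mult)
    also have "\<dots> \<le> 1 * (8 * \<theta> powr (s - 1)) * 1"
      using pw[OF that, of 1] s abs_cos_le_one[of "t / 2"] by (intro mult_mono) auto
    finally show ?thesis by simp
  qed
  have b2: "norm (f'' t) \<le> 80 * \<theta> powr (s - 2)" if "\<bar>t - \<theta>\<bar> \<le> \<eta>" for t
  proof -
    have "norm (f'' t) \<le> norm (s * (s - 1) * (2 * sin (t / 2)) powr (s - 2) * (cos (t / 2))\<^sup>2)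
        + norm (s / 2 * (2 * sin (t / 2)) powr (s - 1) * sin (t / 2))"
      unfolding f''_def by (rule norm_triangle_ineq4)
    also have "\<dots> = s * (1 - s) * (2 * sin (t / 2)) powr (s - 2) * (cos (t / 2))\<^sup>2
        + s / 2 * (2 * sin (t / 2)) powr (s - 1) * \<bar>sin (t / 2)\<bar>"
      using s by (simp add: abs_mult)
    also have "\<dots> \<le> 1 * 1 * (8 ^ 2 * \<theta> powr (s - 2)) * 1 + 1 / 2 * (8 * \<theta> powr (s - 1)) * 1"
      using pw[OF that, of 1] pw[OF that, of 2] s abs_cos_le_one[of "t / 2"] abs_sin_le_one[of "t / 2"]
        power_le_one[of "\<bar>cos (t / 2)\<bar>" 2]
      by (intro add_mono mult_mono) auto
    also have "\<theta> powr (s - 1) = \<theta> * \<theta> powr (s - 2)"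
      using \<theta> powr_mult_base[of \<theta> "s - 2"] by simp
    also have "\<dots> \<le> 4 * \<theta> powr (s - 2)"
      using \<theta> pi_less_4 by (intro mult_right_mono) auto
    finally show ?thesis by simp
  qed
  have seg: "\<bar>t - \<theta>\<bar> \<le> \<eta>" if "t \<in> closed_segment (\<theta> + \<eta>) \<theta> \<or> t \<in> closed_segment (\<theta> - \<eta>) \<theta>" for t
    using that \<eta> by (auto simp: closed_segment_eq_real_ivl split: if_splits)
  have "norm (f (\<theta> + \<eta>) - f \<theta>) \<le> 8 * \<theta> powr (s - 1) * \<bar>\<theta> + \<eta> - \<theta>\<bar>"
    by (rule vector_mean_value_bound[OF d1 b1]) (use seg in blast)+
  then show "\<bar>zero_dist_powr s (\<theta> + \<eta>) - zero_dist_powr s \<theta>\<bar> \<le> 8 * \<eta> * \<theta> powr (s - 1)"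
    using \<eta> by (simp add: eq mult_ac)
  have "norm (f (\<theta> - \<eta>) - f \<theta>) \<le> 8 * \<theta> powr (s - 1) * \<bar>\<theta> - \<eta> - \<theta>\<bar>"
    by (rule vector_mean_value_bound[OF d1 b1]) (use seg in blast)+
  then show "\<bar>zero_dist_powr s (\<theta> - \<eta>) - zero_dist_powr s \<theta>\<bar> \<le> 8 * \<eta> * \<theta> powr (s - 1)"
    using \<eta> by (simp add: eq mult_ac)
  have "norm ((f (\<theta> + \<eta>) - f \<theta>) + (f (\<theta> - \<eta>) - f \<theta>)) \<le> 2 * (80 * \<theta> powr (s - 2)) * \<eta>\<^sup>2"
    by (rule second_difference_mean_value_bound[OF \<eta>(1) d1 d2 b2])
  then show "\<bar>(zero_dist_powr s (\<theta> + \<eta>) - zero_dist_powr s \<theta>) + (zero_dist_powr s (\<theta> - \<eta>) - zero_dist_powr s \<theta>)\<bar>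
      \<le> 160 * \<eta>\<^sup>2 * \<theta> powr (s - 2)"
    using \<eta> by (simp add: eq mult_ac)
qed

lemma zero_dist_powr_differences_abs:
  assumes \<theta>: "\<bar>\<theta>\<bar> \<le> pi" "0 < \<bar>\<theta>\<bar>" and \<eta>: "0 \<le> \<eta>" "2 * \<eta> \<le> \<bar>\<theta>\<bar>" and s: "0 \<le> s" "s \<le> 1"
  shows "\<bar>zero_dist_powr s (\<theta> + \<eta>) - zero_dist_powr s \<theta>\<bar> \<le> 8 * \<eta> * \<bar>\<theta>\<bar> powr (s - 1)"
    and "\<bar>zero_dist_powr s (\<theta> - \<eta>) - zero_dist_powr s \<theta>\<bar> \<le> 8 * \<eta> * \<bar>\<theta>\<bar> powr (s - 1)"
    and "\<bar>(zero_dist_powr s (\<theta> + \<eta>) - zero_dist_powr s \<theta>) + (zero_dist_powr s (\<theta> - \<eta>) - zero_dist_powr s \<theta>)\<bar>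
      \<le> 160 * \<eta>\<^sup>2 * \<bar>\<theta>\<bar> powr (s - 2)"
proof -
  note b = zero_dist_powr_differences[OF \<theta>(2,1) \<eta> s]
  have "zero_dist_powr s (\<theta> + \<eta>) = zero_dist_powr s (\<bar>\<theta>\<bar> - \<eta>)"
    "zero_dist_powr s (\<theta> - \<eta>) = zero_dist_powr s (\<bar>\<theta>\<bar> + \<eta>)" "zero_dist_powr s \<theta> = zero_dist_powr s \<bar>\<theta>\<bar>"
    if "\<theta> < 0"
  proof -
    have "\<bar>\<theta>\<bar> - \<eta> = - (\<theta> + \<eta>)" "\<bar>\<theta>\<bar> + \<eta> = - (\<theta> - \<eta>)" "\<bar>\<theta>\<bar> = - \<theta>"
      using that by simp_all
    then show "zero_dist_powr s (\<theta> + \<eta>) = zero_dist_powr s (\<bar>\<theta>\<bar> - \<eta>)"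
      "zero_dist_powr s (\<theta> - \<eta>) = zero_dist_powr s (\<bar>\<theta>\<bar> + \<eta>)" "zero_dist_powr s \<theta> = zero_dist_powr s \<bar>\<theta>\<bar>"
      by (simp_all only: zero_dist_powr_even)
  qed
  note e = this
  show "\<bar>zero_dist_powr s (\<theta> + \<eta>) - zero_dist_powr s \<theta>\<bar> \<le> 8 * \<eta> * \<bar>\<theta>\<bar> powr (s - 1)"
    "\<bar>zero_dist_powr s (\<theta> - \<eta>) - zero_dist_powr s \<theta>\<bar> \<le> 8 * \<eta> * \<bar>\<theta>\<bar> powr (s - 1)"
    "\<bar>(zero_dist_powr s (\<theta> + \<eta>) - zero_dist_powr s \<theta>) + (zero_dist_powr s (\<theta> - \<eta>) - zero_dist_powr s \<theta>)\<bar>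
      \<le> 160 * \<eta>\<^sup>2 * \<bar>\<theta>\<bar> powr (s - 2)"
  proof (atomize (full), cases "\<theta> < 0")
    case True
    have "x + y = y + x" for x y :: real by simp
    with b show "\<bar>zero_dist_powr s (\<theta> + \<eta>) - zero_dist_powr s \<theta>\<bar> \<le> 8 * \<eta> * \<bar>\<theta>\<bar> powr (s - 1) \<and>
      \<bar>zero_dist_powr s (\<theta> - \<eta>) - zero_dist_powr s \<theta>\<bar> \<le> 8 * \<eta> * \<bar>\<theta>\<bar> powr (s - 1) \<and>
      \<bar>(zero_dist_powr s (\<theta> + \<eta>) - zero_dist_powr s \<theta>) + (zero_dist_powr s (\<theta> - \<eta>) - zero_dist_powr s \<theta>)\<bar>
      \<le> 160 * \<eta>\<^sup>2 * \<bar>\<theta>\<bar> powr (s - 2)"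
      using e[OF True] by metis
  qed (use b in simp)
qed

section \<open>Fourier coefficients and second differences\<close>

lemma set_integral_translate:
  fixes F :: "real \<Rightarrow> complex"
  shows "set_integrable lborel {x<..y} (\<lambda>t. F (t + r)) \<longleftrightarrow> set_integrable lborel {x + r<..y + r} F"
    and "(LINT t:{x<..y}|lborel. F (t + r)) = (LINT t:{x + r<..y + r}|lborel. F t)"
proof -
  have ind: "indicator {x + r<..y + r} (r + 1 * t) *\<^sub>R F (r + 1 * t) = indicator {x<..y} t *\<^sub>R F (t + r)" for t
    by (simp add: indicator_def add.commute)
  show "set_integrable lborel {x<..y} (\<lambda>t. F (t + r)) \<longleftrightarrow> set_integrable lborel {x + r<..y + r} F"
    unfolding set_integrable_def
    using lborel_integrable_real_affine_iff[of 1 "\<lambda>t. indicator {x + r<..y + r} t *\<^sub>R F t" r]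
    unfolding ind by simp
  show "(LINT t:{x<..y}|lborel. F (t + r)) = (LINT t:{x + r<..y + r}|lborel. F t)"
    unfolding set_lebesgue_integral_def
    using lborel_integral_real_affine[of 1 "\<lambda>t. indicator {x + r<..y + r} t *\<^sub>R F t" r]
    unfolding ind by simp
qed

text \<open>
  The interval is cut at the point where the translate leaves the period, and the second piece is moved back
  by one period.
\<close>

lemma set_integral_periodic_shift:
  fixes F :: "real \<Rightarrow> complex"
  assumes per: "\<And>t. F (t + p) = F t" and r: "0 \<le> r" "r \<le> p"
    and int: "set_integrable lborel {a<..a + p} F"
  shows "set_integrable lborel {a<..a + p} (\<lambda>t. F (t + r))"
    and "(LINT t:{a<..a + p}|lborel. F (t + r)) = (LINT t:{a<..a + p}|lborel. F t)"
proof -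
  have per': "F (t + (r - p)) = F (t + r)" for t
    using per[of "t + (r - p)"] by (simp add: algebra_simps)
  have A: "set_integrable lborel {a<..a + p - r} (\<lambda>t. F (t + r))"
    unfolding set_integral_translate by (rule set_integrable_subset[OF int]) (use r in auto)
  have "set_integrable lborel {a + p - r<..a + p} (\<lambda>t. F (t + (r - p)))"
    unfolding set_integral_translate by (rule set_integrable_subset[OF int]) (use r in auto)
  then have B: "set_integrable lborel {a + p - r<..a + p} (\<lambda>t. F (t + r))"
    by (simp only: per')
  have AB: "{a<..a + p} = {a<..a + p - r} \<union> {a + p - r<..a + p}" using r by auto
  show "set_integrable lborel {a<..a + p} (\<lambda>t. F (t + r))"
    unfolding AB by (rule set_integrable_Un[OF A B]) auto
  have "(LINT t:{a<..a + p}|lborel. F (t + r))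
      = (LINT t:{a<..a + p - r}|lborel. F (t + r)) + (LINT t:{a + p - r<..a + p}|lborel. F (t + (r - p)))"
    unfolding AB per' by (rule set_integral_Un[OF _ A B]) auto
  also have "\<dots> = (LINT t:{a + r<..a + p}|lborel. F t) + (LINT t:{a<..a + r}|lborel. F t)"
    unfolding set_integral_translate by simp
  also have "\<dots> = (LINT t:{a + r<..a + p} \<union> {a<..a + r}|lborel. F t)"
    by (rule set_integral_Un[symmetric]) (use r in \<open>auto intro: set_integrable_subset[OF int]\<close>)
  also have "{a + r<..a + p} \<union> {a<..a + r} = {a<..a + p}" using r by auto
  finally show "(LINT t:{a<..a + p}|lborel. F (t + r)) = (LINT t:{a<..a + p}|lborel. F t)" .
qed

text \<open>
  Since \<open>h \<eta> = \<plusminus>\<pi>\<close>, translating \<open>F\<close> by \<open>\<eta>\<close> or by \<open>-\<eta>\<close> multiplies its coefficient by \<open>-1\<close>.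
\<close>

lemma fourier_coefficient_second_difference:
  fixes F :: "real \<Rightarrow> complex" and h :: int
  assumes per: "\<And>t. F (t + 2 * pi) = F t" and h: "h \<noteq> 0"
    and int: "set_integrable lborel freq (\<lambda>t. F t * cis (- (of_int h * t)))"
  defines "\<eta> \<equiv> pi / real_of_int \<bar>h\<bar>"
  shows "set_integrable lborel freq (\<lambda>t. ((F (t + \<eta>) - F t) + (F (t - \<eta>) - F t)) * cis (- (of_int h * t)))"
    and "(LINT t:freq|lborel. ((F (t + \<eta>) - F t) + (F (t - \<eta>) - F t)) * cis (- (of_int h * t)))
      = - 4 * (LINT t:freq|lborel. F t * cis (- (of_int h * t)))"
proof -
  define G where "G t = F t * cis (- (of_int h * t))" for t
  have freq: "freq = {- pi<..- pi + 2 * pi}" by (auto simp: freq_def)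
  have cis_period: "cis (of_int m * (2 * pi)) = 1" for m :: int
    using cis_multiple_2pi[of "of_int m"] by (simp add: mult_ac)
  have "cis (- (of_int h * (t + 2 * pi))) = cis (- (of_int h * t))" for t
    using cis_period[of "- h"] cis_mult[of "- (of_int h * t)" "of_int (- h) * (2 * pi)"]
    by (simp add: algebra_simps)
  then have perG: "G (t + 2 * pi) = G t" for t by (simp add: G_def per)
  have h1: "1 \<le> real_of_int \<bar>h\<bar>" using h by simp
  then have \<eta>: "0 < \<eta>" "\<eta> \<le> pi" unfolding \<eta>_def by (auto simp: divide_le_eq)
  have "of_int h * \<eta> = pi \<or> of_int h * \<eta> = - pi"
    using h by (auto simp: \<eta>_def abs_if)
  then have half: "cis (of_int h * \<eta>) = - 1" "cis (- (of_int h * \<eta>)) = - 1"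
    by (auto simp: cis_cnj[symmetric] simp del: cis_cnj)
  have plus: "F (t + \<eta>) * cis (- (of_int h * t)) = - G (t + \<eta>)" for t
  proof -
    have "cis (- (of_int h * (t + \<eta>))) = cis (- (of_int h * t)) * cis (- (of_int h * \<eta>))"
      by (simp add: cis_mult algebra_simps)
    then show ?thesis unfolding G_def half by simp
  qed
  have minus: "F (t - \<eta>) * cis (- (of_int h * t)) = - G (t + (2 * pi - \<eta>))" for t
  proof -
    have "cis (- (of_int h * (t - \<eta>))) = cis (- (of_int h * t)) * cis (of_int h * \<eta>)"
      by (simp add: cis_mult algebra_simps)
    then have "F (t - \<eta>) * cis (- (of_int h * t)) = - G (t - \<eta>)" unfolding G_def half by simp
    also have "G (t - \<eta>) = G (t + (2 * pi - \<eta>))" using perG[of "t - \<eta>"] by (simp add: algebra_simps)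
    finally show ?thesis .
  qed
  have eq: "((F (t + \<eta>) - F t) + (F (t - \<eta>) - F t)) * cis (- (of_int h * t))
      = - G (t + \<eta>) - G (t + (2 * pi - \<eta>)) - 2 * G t" for t
  proof -
    have "((F (t + \<eta>) - F t) + (F (t - \<eta>) - F t)) * cis (- (of_int h * t))
        = F (t + \<eta>) * cis (- (of_int h * t)) + F (t - \<eta>) * cis (- (of_int h * t))
          - 2 * (F t * cis (- (of_int h * t)))"
      by (simp add: algebra_simps)
    then show ?thesis
      unfolding plus minus by (simp add: G_def)
  qed
  have intG: "set_integrable lborel {- pi<..- pi + 2 * pi} G"
    using int unfolding freq G_def .
  note s1 = set_integral_periodic_shift[of G "2 * pi" \<eta> "- pi", OF perG _ _ intG]
    and s2 = set_integral_periodic_shift[of G "2 * pi" "2 * pi - \<eta>" "- pi", OF perG _ _ intG]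
  have i1: "set_integrable lborel freq (\<lambda>t. G (t + \<eta>))" "(LINT t:freq|lborel. G (t + \<eta>)) = (LINT t:freq|lborel. G t)"
    unfolding freq by (rule s1; use \<eta> in simp)+
  have i2: "set_integrable lborel freq (\<lambda>t. G (t + (2 * pi - \<eta>)))"
    "(LINT t:freq|lborel. G (t + (2 * pi - \<eta>))) = (LINT t:freq|lborel. G t)"
    unfolding freq by (rule s2; use \<eta> in simp)+
  have i3: "set_integrable lborel freq (\<lambda>t. 2 * G t)"
    using intG unfolding freq by simp
  have i4: "set_integrable lborel freq (\<lambda>t. - G (t + \<eta>))"
    using i1(1) by (simp add: set_integrable_def)
  have i5: "set_integrable lborel freq (\<lambda>t. - G (t + \<eta>) - G (t + (2 * pi - \<eta>)))"
    using i4 i2(1) by (rule set_integral_diff)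
  show "set_integrable lborel freq (\<lambda>t. ((F (t + \<eta>) - F t) + (F (t - \<eta>) - F t)) * cis (- (of_int h * t)))"
    unfolding eq using i5 i3 by (rule set_integral_diff)
  show "(LINT t:freq|lborel. ((F (t + \<eta>) - F t) + (F (t - \<eta>) - F t)) * cis (- (of_int h * t)))
      = - 4 * (LINT t:freq|lborel. F t * cis (- (of_int h * t)))"
    unfolding eq set_integral_diff(2)[OF i5 i3] set_integral_diff(2)[OF i4 i2(1)]
    by (simp add: i1(2) i2(2) set_integral_uminus[OF i1(1)] G_def[symmetric])
qed

lemma has_bochner_integral_powr_tail:
  fixes s b :: real
  assumes b: "0 < b" and s: "s < 1"
  shows "has_bochner_integral lborel (\<lambda>t. indicator {b..} t * t powr (s - 2)) (b powr (s - 1) / (1 - s))"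
proof (rule has_bochner_integral_nn_integral)
  show "(\<lambda>t. indicator {b..} t * t powr (s - 2)) \<in> borel_measurable lborel" by measurable
  show "AE t in lborel. 0 \<le> indicator {b..} t * t powr (s - 2)" by (simp add: indicator_def)
  show "0 \<le> b powr (s - 1) / (1 - s)" using s by simp
  have "(\<integral>\<^sup>+ t. ennreal (t powr (s - 2)) * indicator {b..} t \<partial>lborel)
      = ennreal (0 - (- (b powr (s - 1) / (1 - s))))"
  proof (rule nn_integral_FTC_atLeast)
    fix t assume "b \<le> t"
    then have t: "0 < t" using b by linarith
    show "((\<lambda>t. - (t powr (s - 1) / (1 - s))) has_real_derivative t powr (s - 2)) (at t)"
    proof -
      have "((\<lambda>t. - (t powr (s - 1) / (1 - s))) has_real_derivative - ((s - 1) * t powr (s - 1 - 1) / (1 - s))) (at t)"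
        by (intro DERIV_minus DERIV_cdivide has_real_derivative_powr t)
      moreover have "- ((s - 1) * t powr (s - 1 - 1) / (1 - s)) = t powr (s - 2)"
        using s by (simp add: field_simps)
      ultimately show ?thesis by simp
    qed
    show "0 \<le> t powr (s - 2)" by simp
  next
    have "((\<lambda>t :: real. t powr (s - 1)) \<longlongrightarrow> 0) at_top"
      by (rule tendsto_neg_powr) (use s in \<open>auto simp: filterlim_ident\<close>)
    then have "((\<lambda>t. - (t powr (s - 1) / (1 - s))) \<longlongrightarrow> - (0 / (1 - s))) at_top"
      by (intro tendsto_intros) (use s in auto)
    then show "((\<lambda>t. - (t powr (s - 1) / (1 - s))) \<longlongrightarrow> 0) at_top" by simp
  qed measurable
  moreover have "ennreal (indicator {b..} t * t powr (s - 2)) = ennreal (t powr (s - 2)) * indicator {b..} t" for t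
    by (simp add: indicator_def)
  ultimately show "(\<integral>\<^sup>+ t. ennreal (indicator {b..} t * t powr (s - 2)) \<partial>lborel) = ennreal (b powr (s - 1) / (1 - s))"
    by simp
qed

text \<open>
  The zone \<open>|t| < 2 \<eta>\<close> has length \<open>4 \<eta>\<close> and contributes order \<open>\<eta>\<^sup>1\<^sup>+\<^sup>s\<close>; outside of it
  \<open>\<eta>\<^sup>2 |t|\<^sup>s\<^sup>-\<^sup>2\<close> integrates to the same order, because \<open>s < 1\<close> makes the tail integrable.  The finite
  exceptional set \<open>Z\<close> collects the points where one of \<open>t\<close>, \<open>t + \<eta>\<close>, \<open>t - \<eta>\<close> meets a singularity.
\<close>

lemma fourier_coefficient_decay:
  fixes F :: "real \<Rightarrow> complex" and h :: int and s A :: real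
  assumes per: "\<And>t. F (t + 2 * pi) = F t" and h: "h \<noteq> 0"
    and int: "set_integrable lborel freq (\<lambda>t. F t * cis (- (of_int h * t)))"
    and s: "0 \<le> s" "s < 1" and A: "0 \<le> A" and Z: "finite Z"
  defines "\<eta> \<equiv> pi / real_of_int \<bar>h\<bar>"
  assumes near: "\<And>t. t \<in> freq - Z \<Longrightarrow> \<bar>t\<bar> < 2 * \<eta> \<Longrightarrow>
      cmod ((F (t + \<eta>) - F t) + (F (t - \<eta>) - F t)) \<le> A * \<eta> powr s"
    and far: "\<And>t. t \<in> freq - Z \<Longrightarrow> 2 * \<eta> \<le> \<bar>t\<bar> \<Longrightarrow>
      cmod ((F (t + \<eta>) - F t) + (F (t - \<eta>) - F t)) \<le> A * (\<eta>\<^sup>2 * \<bar>t\<bar> powr (s - 2))"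
  shows "cmod (LINT t:freq|lborel. F t * cis (- (of_int h * t)))
    \<le> 16 * A * (1 + 1 / (1 - s)) * real_of_int \<bar>h\<bar> powr (- 1 - s)"
proof -
  have h1: "1 \<le> real_of_int \<bar>h\<bar>" using h by simp
  then have \<eta>: "0 < \<eta>" by (simp add: \<eta>_def)
  let ?c = "LINT t:freq|lborel. F t * cis (- (of_int h * t))"
  define f where "f t = indicator freq t *\<^sub>R (((F (t + \<eta>) - F t) + (F (t - \<eta>) - F t)) * cis (- (of_int h * t)))" for t
  define k where "k t = indicator {2 * \<eta>..} t * t powr (s - 2)" for t :: real
  define g where "g t = A * (indicator {- 2 * \<eta>..2 * \<eta>} t * \<eta> powr s + \<eta>\<^sup>2 * (k t + k (- t)))" for t
  note second = fourier_coefficient_second_difference[OF per h int, folded \<eta>_def]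
  have intf: "integrable lborel f" and If: "integral\<^sup>L lborel f = - 4 * ?c"
    using second unfolding f_def set_integrable_def set_lebesgue_integral_def by simp_all
  have tail: "has_bochner_integral lborel k ((2 * \<eta>) powr (s - 1) / (1 - s))"
    unfolding k_def by (rule has_bochner_integral_powr_tail) (use \<eta> s in auto)
  have tail': "has_bochner_integral lborel (\<lambda>t. k (- t)) ((2 * \<eta>) powr (s - 1) / (1 - s))"
    using lborel_has_bochner_integral_real_affine_iff[of "- 1" k "(2 * \<eta>) powr (s - 1) / (1 - s)" 0] tail
    by simp
  have mid: "has_bochner_integral lborel (indicator {- 2 * \<eta>..2 * \<eta>} :: real \<Rightarrow> real) (4 * \<eta>)"
  proof -
    have "measure lborel {- 2 * \<eta>..2 * \<eta>} = 4 * \<eta>" using \<eta> by simp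
    then show ?thesis
      using has_bochner_integral_real_indicator[of "{- 2 * \<eta>..2 * \<eta>}" lborel] \<eta> by simp
  qed
  have g: "has_bochner_integral lborel g (A * (4 * \<eta> * \<eta> powr s
      + \<eta>\<^sup>2 * ((2 * \<eta>) powr (s - 1) / (1 - s) + (2 * \<eta>) powr (s - 1) / (1 - s))))"
    unfolding g_def
    by (intro has_bochner_integral_mult_right has_bochner_integral_add has_bochner_integral_mult_left mid tail tail')
  have "4 * cmod ?c = cmod (integral\<^sup>L lborel f)" by (simp add: If norm_mult)
  also have "\<dots> \<le> (\<integral>t. cmod (f t) \<partial>lborel)" by (rule integral_norm_bound)
  also have "\<dots> \<le> integral\<^sup>L lborel g"
  proof (rule integral_mono_AE)
    show "integrable lborel (\<lambda>t. cmod (f t))" using intf by simp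
    show "integrable lborel g" using g by (rule integrable.intros)
    have "AE t in lborel. t \<notin> Z"
      using Z by (intro AE_not_in) (simp add: null_sets_def emeasure_lborel_countable countable_finite borel_closed finite_imp_closed)
    then show "AE t in lborel. cmod (f t) \<le> g t"
    proof eventually_elim
      case (elim t)
      have k0: "0 \<le> k u" for u by (simp add: k_def)
      have g0: "0 \<le> g t" using A k0[of t] k0[of "- t"] by (simp add: g_def)
      show ?case
      proof (cases "t \<in> freq")
        case True
        have f: "cmod (f t) = cmod ((F (t + \<eta>) - F t) + (F (t - \<eta>) - F t))"
          using True by (simp add: f_def norm_mult)
        show ?thesis
        proof (cases "\<bar>t\<bar> < 2 * \<eta>")
          case small: True
          have "cmod (f t) \<le> A * (1 * \<eta> powr s + 0)"
            unfolding f using near[of t] True elim small by simp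
          also have "\<dots> \<le> g t"
            unfolding g_def using small k0[of t] k0[of "- t"] A
            by (intro mult_left_mono add_mono) (auto simp: indicator_def abs_if split: if_splits)
          finally show ?thesis .
        next
          case large: False
          have "cmod (f t) \<le> A * (0 + \<eta>\<^sup>2 * \<bar>t\<bar> powr (s - 2))"
            unfolding f using far[of t] True elim large by simp
          also have "\<bar>t\<bar> powr (s - 2) \<le> k t + k (- t)"
            using large k0[of t] k0[of "- t"] by (cases "0 \<le> t") (auto simp: k_def)
          then have "A * (0 + \<eta>\<^sup>2 * \<bar>t\<bar> powr (s - 2)) \<le> g t"
            unfolding g_def using A by (intro mult_left_mono add_mono) auto
          finally show ?thesis .
        qed
      qed (use g0 in \<open>simp add: f_def\<close>)
    qed
  qed
  also have "\<dots> = A * (4 * \<eta> * \<eta> powr s + 2 * (\<eta>\<^sup>2 * (2 * \<eta>) powr (s - 1) / (1 - s)))"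
    using g by (simp add: has_bochner_integral_integral_eq algebra_simps)
  also have "\<dots> \<le> A * (4 * \<eta> powr (1 + s) + 2 * (\<eta> powr (1 + s) / (1 - s)))"
  proof -
    have 1: "\<eta> * \<eta> powr s = \<eta> powr (1 + s)" using \<eta> by (simp add: powr_add)
    have "\<eta>\<^sup>2 * (2 * \<eta>) powr (s - 1) = 2 powr (s - 1) * (\<eta> powr 2 * \<eta> powr (s - 1))"
      using \<eta> by (simp add: powr_mult powr_numeral)
    also have "\<dots> = 2 powr (s - 1) * \<eta> powr (1 + s)" by (simp flip: powr_add add: add.commute)
    also have "\<dots> \<le> 1 * \<eta> powr (1 + s)"
      using s powr_mono[of "s - 1" 0 "2 :: real"] by (intro mult_right_mono) auto
    finally have 2: "\<eta>\<^sup>2 * (2 * \<eta>) powr (s - 1) \<le> \<eta> powr (1 + s)" by simp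
    show ?thesis
      using 1 2 A s by (intro mult_left_mono add_mono divide_right_mono) auto
  qed
  also have "\<dots> \<le> 4 * (A * (1 + 1 / (1 - s)) * \<eta> powr (1 + s))"
    using A s by (simp add: algebra_simps) (intro divide_right_mono mult_left_mono; simp)
  finally have "cmod ?c \<le> A * (1 + 1 / (1 - s)) * \<eta> powr (1 + s)" by simp
  also have "\<eta> powr (1 + s) = pi powr (1 + s) * real_of_int \<bar>h\<bar> powr (- 1 - s)"
    using h1 powr_minus_divide[of "real_of_int \<bar>h\<bar>" "1 + s"] by (simp add: \<eta>_def powr_divide)
  also have "A * (1 + 1 / (1 - s)) * (pi powr (1 + s) * real_of_int \<bar>h\<bar> powr (- 1 - s))
      \<le> A * (1 + 1 / (1 - s)) * (16 * real_of_int \<bar>h\<bar> powr (- 1 - s))"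
  proof (intro mult_left_mono mult_right_mono)
    have "pi powr (1 + s) \<le> pi powr 2"
      using pi_gt3 s by (intro powr_mono) auto
    also have "\<dots> = pi\<^sup>2" by (simp add: powr_numeral)
    also have "\<dots> \<le> 4\<^sup>2" using pi_less_4 by (intro power_mono) auto
    finally show "pi powr (1 + s) \<le> 16" by simp
  qed (use A s in auto)
  finally show ?thesis by (simp only: mult_ac)
qed

section \<open>The projection onto the leading eigenvectors\<close>

text \<open>
  The representative in \<open>freq\<close> of a frequency modulo \<open>2 \<pi>\<close>.  The eigenvectors are given on \<open>freq\<close> only,
  whereas second differences near the end points of \<open>freq\<close> need the periodic extension.
\<close>

definition wrap :: "real \<Rightarrow> real" where
  "wrap t = t - 2 * pi * of_int \<lceil>(t - pi) / (2 * pi)\<rceil>"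

lemma wrap_freq: "wrap t \<in> freq"
proof -
  let ?c = "\<lceil>(t - pi) / (2 * pi)\<rceil>"
  have "(t - pi) / (2 * pi) \<le> of_int ?c" "of_int ?c - 1 < (t - pi) / (2 * pi)" by linarith+
  moreover have "0 < 2 * pi" by simp
  ultimately have "t - pi \<le> of_int ?c * (2 * pi)" "(of_int ?c - 1) * (2 * pi) < t - pi"
    by (simp_all only: pos_divide_le_eq pos_less_divide_eq)
  then have "- pi < t - 2 * pi * of_int ?c" "t - 2 * pi * of_int ?c \<le> pi"
    by (simp_all only: left_diff_distrib mult_1_left mult.commute[of "2 * pi"])
  then show ?thesis by (simp add: wrap_def freq_def)
qed

lemma wrap_shift: "\<exists>k :: int. wrap t = t + of_int k * (2 * pi)"
  by (rule exI[of _ "- \<lceil>(t - pi) / (2 * pi)\<rceil>"]) (simp add: wrap_def)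

lemma wrap_eq: "t \<in> freq \<Longrightarrow> wrap t = t"
proof -
  assume "t \<in> freq"
  then have "- 1 < (t - pi) / (2 * pi)" "(t - pi) / (2 * pi) \<le> 0"
    using pi_gt_zero by (auto simp: freq_def field_simps)
  then have "\<lceil>(t - pi) / (2 * pi)\<rceil> = 0" by linarith
  then show ?thesis by (simp add: wrap_def)
qed

lemma wrap_periodic: "wrap (t + 2 * pi) = wrap t"
proof -
  have "(t + 2 * pi - pi) / (2 * pi) = (t - pi) / (2 * pi) + 1" by (simp add: field_simps)
  then have "\<lceil>(t + 2 * pi - pi) / (2 * pi)\<rceil> = \<lceil>(t - pi) / (2 * pi)\<rceil> + 1"
    by (simp only: ceiling_add_one)
  then show ?thesis by (simp add: wrap_def distrib_left)
qed

lemma periodic_int_shift: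
  fixes F :: "real \<Rightarrow> 'a" and k :: int
  assumes per: "\<And>t. F (t + r) = F t"
  shows "F (t + of_int k * r) = F t"
proof (induction k rule: int_induct[of _ 0])
  case (step1 i)
  then show ?case using per[of "t + of_int i * r"] by (simp add: algebra_simps)
next
  case (step2 i)
  then show ?case using per[of "t + of_int (i - 1) * r"] by (simp add: algebra_simps)
qed simp

lemma periodic_wrap: "(\<And>t. F (t + 2 * pi) = F t) \<Longrightarrow> F (wrap t) = F t"
  using wrap_shift[of t] periodic_int_shift[of F "2 * pi"] by metis

lemma wrap_nonzero:
  assumes "\<bar>t\<bar> \<le> 2 * pi" "t \<noteq> 0" "t \<noteq> 2 * pi" "t \<noteq> - 2 * pi"
  shows "wrap t \<noteq> 0"
proof
  assume "wrap t = 0"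
  moreover obtain k :: int where "wrap t = t + of_int k * (2 * pi)" using wrap_shift[of t] by blast
  ultimately have k: "t = - (of_int k * (2 * pi))" by linarith
  then have "\<bar>real_of_int k\<bar> \<le> 1" using assms(1) by (simp add: abs_mult)
  then have "\<bar>k\<bar> \<le> 1" by linarith
  then have "k = 0 \<or> k = 1 \<or> k = - 1" by linarith
  then show False using k assms by auto
qed

lemma cmod_one_minus_cis_periodic: "cmod (1 - cis (- (t + 2 * pi))) = cmod (1 - cis (- t))"
proof -
  have "\<bar>sin ((t + 2 * pi) / 2)\<bar> = \<bar>sin (t / 2)\<bar>" by (simp add: add_divide_distrib)
  then show ?thesis by (simp only: cmod_one_minus_cis)
qed

lemma cmod_one_minus_cis_pos:
  assumes "wrap t \<noteq> 0"
  shows "0 < cmod (1 - cis (- t))"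
proof -
  have r: "\<bar>wrap t\<bar> \<le> pi" using wrap_freq[of t] by (auto simp: freq_def)
  have "sin (wrap t / 2) \<noteq> 0"
  proof
    assume "sin (wrap t / 2) = 0"
    then have "sin \<bar>wrap t / 2\<bar> = 0" by (auto simp: abs_if)
    moreover have "0 < sin \<bar>wrap t / 2\<bar>"
      using r assms by (intro sin_gt_zero) auto
    ultimately show False by simp
  qed
  then have "0 < cmod (1 - cis (- wrap t))" unfolding cmod_one_minus_cis by simp
  moreover have "cmod (1 - cis (- wrap t)) = cmod (1 - cis (- t))"
    by (rule periodic_wrap[of "\<lambda>t. cmod (1 - cis (- t))"]) (rule cmod_one_minus_cis_periodic)
  ultimately show ?thesis by (simp only:)
qed

text \<open>
  The memory parameters differ between factors; on \<open>(0, \<pi>]\<close> all powers may be replaced by the one with the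
  smallest exponent at the cost of the factor \<open>4 > \<pi>\<close>.
\<close>

lemma powr_exponent_le:
  assumes "0 < t" "t \<le> pi" "c \<le> a" "a \<le> c + 1"
  shows "t powr a \<le> 4 * t powr c"
proof -
  have "t powr (a - c) \<le> pi powr (a - c)" using assms by (intro powr_mono2) auto
  also have "\<dots> \<le> pi powr 1" using assms pi_gt3 by (intro powr_mono) auto
  also have "\<dots> \<le> 4" using pi_less_4 pi_gt_zero by simp
  finally have "t powr (a - c) * t powr c \<le> 4 * t powr c" by (intro mult_right_mono) auto
  then show ?thesis by (simp flip: powr_add)
qed

text \<open>
  An explicit constant, so that uniformity in \<open>n\<close>, \<open>i\<close> and \<open>h\<close> is visible: the first summand serves
  near frequency 0 and the second away from it.
\<close>

definition projection_const :: "real \<Rightarrow> real \<Rightarrow> real \<Rightarrow> real \<Rightarrow> real" where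
  "projection_const K L B1 B2 =
     128 * (2 * K + 1) * L\<^sup>2 * (B1 + 1)
     + (4 * (2 * K + 1) * (4 * L\<^sup>2 * (640 * (B2 + 1)) + 56 * L ^ 5 * (4096 * (B1 + 1)\<^sup>2))
        + 128 * (2 * K + 1)\<^sup>2 * (4 * L\<^sup>2)\<^sup>2 * (4096 * (B1 + 1)\<^sup>2))"

text \<open>
  The situation for one fixed \<open>n\<close>, freed from the probabilistic model.  The matrix \<open>X\<close> is the
  idiosyncratic spectral density and \<open>s\<close> is twice the smallest memory parameter.  The constants \<open>K\<close>,
  \<open>sl\<close>, \<open>B1\<close>, \<open>B2\<close> are those that do not depend on \<open>n\<close>.
\<close>

locale long_memory_spectrum =
  fixes q n :: nat and G X S :: "real \<Rightarrow> complex mat" and lam :: "nat \<Rightarrow> real \<Rightarrow> real"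
    and p :: "nat \<Rightarrow> nat \<Rightarrow> real \<Rightarrow> complex Matrix.vec" and d :: "nat \<Rightarrow> real"
    and K sl B1 B2 s :: real
  assumes qn: "q \<le> n" and n: "0 < n"
    and G: "\<And>t. G t \<in> carrier_mat n q" and X: "\<And>t. X t \<in> carrier_mat n n"
    and G_periodic: "\<And>t. G (t + 2 * pi) = G t" and X_periodic: "\<And>t. X (t + 2 * pi) = X t"
    and G_smooth: "mat_twice_differentiable n q G" and X_smooth: "mat_twice_differentiable n n X"
    and G_bounds: "\<And>t. t \<in> freq \<Longrightarrow> norm (emb (mat_deriv n q G t)) \<le> B1 * sqrt n"
      "\<And>t. t \<in> freq \<Longrightarrow> norm (emb (mat_deriv n q (mat_deriv n q G) t)) \<le> B2 * sqrt n"
    and X_bounds: "\<And>t. t \<in> freq \<Longrightarrow> norm (emb (mat_deriv n n X t)) \<le> B1"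
      "\<And>t. t \<in> freq \<Longrightarrow> norm (emb (mat_deriv n n (mat_deriv n n X) t)) \<le> B2"
    and sl: "0 < sl" and large: "8 * K + 4 \<le> real n * sl"
    and coercive: "\<And>t w. t \<in> freq \<Longrightarrow> w \<in> carrier_vec q \<Longrightarrow>
      real n * sl * (vnorm w)\<^sup>2 \<le> (vnorm (G t *\<^sub>v w))\<^sup>2"
    and X_norm: "\<And>t. t \<in> freq - {0} \<Longrightarrow> norm (emb (X t)) \<le> K"
    and S_eq: "\<And>t. t \<in> freq - {0} \<Longrightarrow> S t =
      G t * mat_diag q (\<lambda>l. complex_of_real (cmod (1 - cis (- t)) powr (- 2 * d l))) * mat_adjoint (G t) + X t"
    and eigen: "\<And>t. t \<in> freq - {0} \<Longrightarrow> ordered_row_eigenbasis n (S t) (\<lambda>j. lam j t) (\<lambda>j. p n j t)"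
    and s: "0 \<le> s" "s < 1" and d: "\<And>l. l < q \<Longrightarrow> s \<le> 2 * d l" "\<And>l. l < q \<Longrightarrow> 2 * d l < 1"
begin

definition L :: real where "L = (2 * K + 2) * (1 + 1 / sqrt sl)"

definition g where "g t = (1 / sqrt n) *\<^sub>R emb (G t)"
definition g' where "g' t = (1 / sqrt n) *\<^sub>R emb (mat_adjoint (G t))"
definition E where "E t = (1 / real n) *\<^sub>R emb (mat_diag q (\<lambda>l. complex_of_real (zero_dist_powr (2 * d l) t)))"
definition x where "x t = emb (X t) + (K + 1) *\<^sub>R emb (1\<^sub>m n)"
definition Proj where "Proj t = Matrix.mat n n (\<lambda>(i, k). \<Sum>j<q. cnj (p n j (wrap t) $ i) * p n j (wrap t) $ k)"

lemma Proj_carrier [simp]: "Proj t \<in> carrier_mat n n"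
  and dim_Proj [simp]: "dim_row (Proj t) = n" "dim_col (Proj t) = n"
  by (simp_all add: Proj_def)

lemma K_nonneg: "0 \<le> K"
proof -
  have "pi \<in> freq - {0}" by (simp add: freq_def)
  then show ?thesis using X_norm norm_ge_zero order_trans by blast
qed

lemma B_nonneg: "0 \<le> B1" "0 \<le> B2"
proof -
  have "0 \<in> freq" by (simp add: freq_def)
  then show "0 \<le> B1" "0 \<le> B2" using X_bounds norm_ge_zero order_trans by blast+
qed

lemma L_ge_1: "1 \<le> L"
proof -
  have "1 * 1 \<le> (2 * K + 2) * (1 + 1 / sqrt sl)"
    using K_nonneg sl by (intro mult_mono) auto
  then show ?thesis by (simp add: L_def)
qed

text \<open>
  The condition on \<open>t\<close> excludes the multiples of \<open>2 \<pi>\<close>, where the spectral density is infinite.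
\<close>

lemma resolvent_at:
  assumes t: "wrap t \<noteq> 0"
  shows "\<exists>R T W V H. spectral_split (2 * K + 1) (emb (1\<^sub>m n)) R (emb (Proj t)) T \<and>
    bordered_resolvent L (emb (1\<^sub>m n)) (emb (1\<^sub>m q)) R (g t) (g' t) (E t) (x t) W V H"
proof -
  have r: "wrap t \<in> freq - {0}" using t wrap_freq by simp
  define dv where "dv l = cmod (1 - cis (- t)) powr (- 2 * d l)" for l
  have f: "0 < cmod (1 - cis (- t))" by (rule cmod_one_minus_cis_pos[OF t])
  have f2: "cmod (1 - cis (- t)) \<le> 2" by (simp only: cmod_one_minus_cis) simp
  have dv_wrap: "cmod (1 - cis (- wrap t)) = cmod (1 - cis (- t))"
    by (rule periodic_wrap[of "\<lambda>t. cmod (1 - cis (- t))"]) (rule cmod_one_minus_cis_periodic)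
  have G_wrap: "G (wrap t) = G t" and X_wrap: "X (wrap t) = X t"
    using periodic_wrap G_periodic X_periodic by metis+
  have nsl: "0 < real n * sl" using n sl by simp
  interpret factor_spectrum n "S (wrap t)" "\<lambda>j. lam j (wrap t)" "\<lambda>j. p n j (wrap t)" q "G t" "X t" dv K "real n * sl"
  proof
    show "ordered_row_eigenbasis n (S (wrap t)) (\<lambda>j. lam j (wrap t)) (\<lambda>j. p n j (wrap t))"
      by (rule eigen[OF r])
    show "G t \<in> carrier_mat n q" "X t \<in> carrier_mat n n" by (rule G X)+
    show eq: "S (wrap t) = G t * mat_diag q (\<lambda>l. complex_of_real (dv l)) * mat_adjoint (G t) + X t"
      unfolding S_eq[OF r] G_wrap X_wrap dv_wrap dv_def ..
    show "S (wrap t) \<in> carrier_mat n n" unfolding eq using X by simp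
    show "1 / 2 \<le> dv l" if "l < q" for l
    proof -
      have "1 / 2 = 2 powr (- 1 :: real)" by (simp add: powr_minus)
      also have "\<dots> \<le> 2 powr (- 2 * d l)"
        using d[OF that] by (intro powr_mono) auto
      also have "\<dots> \<le> dv l"
        unfolding dv_def by (rule powr_mono2') (use f f2 d[OF that] s in auto)
      finally show ?thesis .
    qed
    show "norm (emb (X t)) \<le> K" using X_norm[OF r] by (simp only: X_wrap)
    show "real n * sl * (vnorm w)\<^sup>2 \<le> (vnorm (G t *\<^sub>v w))\<^sup>2" if "w \<in> carrier_vec q" for w
      using coercive[OF wrap_freq that, of t] by (simp only: G_wrap)
  qed (rule nsl)
  have "sqrt n / sqrt (real n * sl) = 1 / sqrt sl"
    using n sl by (simp add: real_sqrt_mult)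
  then have "(2 * K + 2) * (1 + sqrt n / sqrt (real n * sl)) \<le> L" by (simp add: L_def)
  moreover have "1 / dv l = zero_dist_powr (2 * d l) t" for l
    using f by (simp add: dv_def zero_dist_powr_def powr_minus_divide)
  ultimately show ?thesis
    using resolvent_data[OF qn, of "sqrt n" L] n large
    unfolding g_def g'_def E_def x_def Proj_def by simp
qed

lemma G_deriv_bounds: "norm (emb (mat_deriv n q G t)) \<le> B1 * sqrt n"
    "norm (emb (mat_deriv n q (mat_deriv n q G) t)) \<le> B2 * sqrt n"
  and X_deriv_bounds: "norm (emb (mat_deriv n n X t)) \<le> B1"
    "norm (emb (mat_deriv n n (mat_deriv n n X) t)) \<le> B2"
proof -
  note per = mat_deriv_periodic[of G "2 * pi" n q, OF G_periodic] mat_deriv_periodic[of X "2 * pi" n n, OF X_periodic]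
  note per2 = mat_deriv_periodic[of "mat_deriv n q G" "2 * pi" n q, OF per(1)]
    mat_deriv_periodic[of "mat_deriv n n X" "2 * pi" n n, OF per(2)]
  show "norm (emb (mat_deriv n q G t)) \<le> B1 * sqrt n"
    using G_bounds(1)[OF wrap_freq, of t] periodic_wrap[of "mat_deriv n q G" t, OF per(1)] by simp
  show "norm (emb (mat_deriv n q (mat_deriv n q G) t)) \<le> B2 * sqrt n"
    using G_bounds(2)[OF wrap_freq, of t] periodic_wrap[of "mat_deriv n q (mat_deriv n q G)" t, OF per2(1)] by simp
  show "norm (emb (mat_deriv n n X t)) \<le> B1"
    using X_bounds(1)[OF wrap_freq, of t] periodic_wrap[of "mat_deriv n n X" t, OF per(2)] by simp
  show "norm (emb (mat_deriv n n (mat_deriv n n X) t)) \<le> B2"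
    using X_bounds(2)[OF wrap_freq, of t] periodic_wrap[of "mat_deriv n n (mat_deriv n n X)" t, OF per2(2)] by simp
qed

lemma adjoint_minus: "emb (mat_adjoint A) - emb (mat_adjoint B) = emb (mat_adjoint (A - B))"
  if "A \<in> carrier_mat n q" "B \<in> carrier_mat n q" for A B
proof -
  have "mat_adjoint (A - B) = mat_adjoint A - mat_adjoint B"
    by (rule eq_matI) (use that in auto)
  then show ?thesis using that by (simp add: emb_minus[of _ q n])
qed

lemma norm_scaled_le: "norm z \<le> c * sqrt n \<Longrightarrow> norm ((1 / sqrt n) *\<^sub>R z) \<le> c" for z :: "fvec endo"
  using n by (simp add: field_simps)

lemma smooth_differences:
  "norm (g u - g t) \<le> B1 * \<bar>u - t\<bar>" "norm (g' u - g' t) \<le> B1 * \<bar>u - t\<bar>" "norm (x u - x t) \<le> B1 * \<bar>u - t\<bar>"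
proof -
  have dG: "norm (emb (G u) - emb (G t)) \<le> B1 * sqrt n * \<bar>u - t\<bar>"
    by (rule emb_difference_bound[OF _ G G_deriv_bounds(1)])
      (use G_smooth in \<open>simp add: mat_twice_differentiable_def\<close>)
  have eq: "g u - g t = (1 / sqrt n) *\<^sub>R (emb (G u) - emb (G t))"
    by (simp add: g_def scaleR_diff_right)
  show "norm (g u - g t) \<le> B1 * \<bar>u - t\<bar>"
    unfolding eq using dG by (intro norm_scaled_le) (simp only: mult_ac)
  have eq': "g' u - g' t = (1 / sqrt n) *\<^sub>R (emb (mat_adjoint (G u)) - emb (mat_adjoint (G t)))"
    by (simp add: g'_def scaleR_diff_right)
  have "norm (emb (mat_adjoint (G u)) - emb (mat_adjoint (G t))) = norm (emb (G u) - emb (G t))"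
    by (simp add: adjoint_minus[OF G G] norm_emb_adjoint emb_minus[OF G G])
  then show "norm (g' u - g' t) \<le> B1 * \<bar>u - t\<bar>"
    unfolding eq' using dG by (intro norm_scaled_le) (simp only: mult_ac)
  show "norm (x u - x t) \<le> B1 * \<bar>u - t\<bar>"
    using emb_difference_bound[OF _ X X_deriv_bounds(1), of u t] X_smooth
    by (simp add: x_def mat_twice_differentiable_def)
qed

lemma smooth_second_differences:
  assumes \<eta>: "0 \<le> \<eta>"
  shows "norm ((g (t + \<eta>) - g t) + (g (t - \<eta>) - g t)) \<le> 2 * B2 * \<eta>\<^sup>2"
    "norm ((g' (t + \<eta>) - g' t) + (g' (t - \<eta>) - g' t)) \<le> 2 * B2 * \<eta>\<^sup>2"
    "norm ((x (t + \<eta>) - x t) + (x (t - \<eta>) - x t)) \<le> 2 * B2 * \<eta>\<^sup>2"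
proof -
  let ?D = "(G (t + \<eta>) - G t) + (G (t - \<eta>) - G t)"
  let ?d = "(emb (G (t + \<eta>)) - emb (G t)) + (emb (G (t - \<eta>)) - emb (G t))"
  have A: "G u - G v \<in> carrier_mat n q" for u v using G by (intro minus_carrier_mat)
  have dG: "norm ?d \<le> 2 * (B2 * sqrt n) * \<eta>\<^sup>2"
    by (rule emb_second_difference_bound[OF G_smooth G G_deriv_bounds(2) \<eta>])
  have eq: "(g (t + \<eta>) - g t) + (g (t - \<eta>) - g t) = (1 / sqrt n) *\<^sub>R ?d"
    by (simp add: g_def scaleR_add_right scaleR_diff_right)
  show "norm ((g (t + \<eta>) - g t) + (g (t - \<eta>) - g t)) \<le> 2 * B2 * \<eta>\<^sup>2"
    unfolding eq using dG by (intro norm_scaled_le) (simp only: mult_ac)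
  have "(g' (t + \<eta>) - g' t) + (g' (t - \<eta>) - g' t)
      = (1 / sqrt n) *\<^sub>R (emb (mat_adjoint (G (t + \<eta>) - G t)) + emb (mat_adjoint (G (t - \<eta>) - G t)))"
    by (simp add: g'_def scaleR_add_right scaleR_diff_right flip: adjoint_minus[OF G G])
  also have "emb (mat_adjoint (G (t + \<eta>) - G t)) + emb (mat_adjoint (G (t - \<eta>) - G t)) = emb (mat_adjoint ?D)"
  proof -
    have "mat_adjoint ?D = mat_adjoint (G (t + \<eta>) - G t) + mat_adjoint (G (t - \<eta>) - G t)"
      by (rule eq_matI) (use A[of "t + \<eta>" t] A[of "t - \<eta>" t] in auto)
    then show ?thesis using A[of "t + \<eta>" t] A[of "t - \<eta>" t] by (simp only: emb_add[OF mat_adjoint_carrier mat_adjoint_carrier])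
  qed
  finally have eq': "(g' (t + \<eta>) - g' t) + (g' (t - \<eta>) - g' t) = (1 / sqrt n) *\<^sub>R emb (mat_adjoint ?D)" .
  have "norm (emb (mat_adjoint ?D)) = norm ?d"
    by (simp only: norm_emb_adjoint emb_add[OF A A] emb_minus[OF G G])
  then show "norm ((g' (t + \<eta>) - g' t) + (g' (t - \<eta>) - g' t)) \<le> 2 * B2 * \<eta>\<^sup>2"
    unfolding eq' using dG by (intro norm_scaled_le) (simp only: mult_ac)
  show "norm ((x (t + \<eta>) - x t) + (x (t - \<eta>) - x t)) \<le> 2 * B2 * \<eta>\<^sup>2"
    using emb_second_difference_bound[OF X_smooth X X_deriv_bounds(2) \<eta>, of t] by (simp add: x_def)
qed

lemma norm_scaled_diag_le:
  assumes "0 \<le> c" "\<And>l. l < q \<Longrightarrow> \<bar>\<phi> l\<bar> \<le> c"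
  shows "norm ((1 / real n) *\<^sub>R emb (mat_diag q (\<lambda>l. complex_of_real (\<phi> l)))) \<le> c"
proof -
  have "norm (emb (mat_diag q (\<lambda>l. complex_of_real (\<phi> l)))) \<le> c"
    by (rule norm_emb_mat_diag_le) (use assms in auto)
  moreover have "1 / real n \<le> 1" using n by simp
  ultimately have "1 / real n * norm (emb (mat_diag q (\<lambda>l. complex_of_real (\<phi> l)))) \<le> 1 * c"
    by (intro mult_mono) auto
  then show ?thesis by simp
qed

lemma E_difference: "E u - E t = (1 / real n) *\<^sub>R emb (mat_diag q
    (\<lambda>l. complex_of_real (zero_dist_powr (2 * d l) u - zero_dist_powr (2 * d l) t)))"
proof -
  have "mat_diag q (\<lambda>l. complex_of_real (zero_dist_powr (2 * d l) u - zero_dist_powr (2 * d l) t))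
    = mat_diag q (\<lambda>l. complex_of_real (zero_dist_powr (2 * d l) u))
      - mat_diag q (\<lambda>l. complex_of_real (zero_dist_powr (2 * d l) t))"
    by (rule eq_matI) (auto simp: mat_diag_def)
  then show ?thesis
    by (simp only: E_def emb_minus[OF mat_diag_dim mat_diag_dim] scaleR_diff_right)
qed

lemma E_second_difference: "(E u - E t) + (E v - E t) = (1 / real n) *\<^sub>R emb (mat_diag q
    (\<lambda>l. complex_of_real ((zero_dist_powr (2 * d l) u - zero_dist_powr (2 * d l) t)
      + (zero_dist_powr (2 * d l) v - zero_dist_powr (2 * d l) t))))"
proof -
  have "mat_diag q (\<lambda>l. complex_of_real ((zero_dist_powr (2 * d l) u - zero_dist_powr (2 * d l) t)
      + (zero_dist_powr (2 * d l) v - zero_dist_powr (2 * d l) t)))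
    = mat_diag q (\<lambda>l. complex_of_real (zero_dist_powr (2 * d l) u - zero_dist_powr (2 * d l) t))
      + mat_diag q (\<lambda>l. complex_of_real (zero_dist_powr (2 * d l) v - zero_dist_powr (2 * d l) t))"
    by (rule eq_matI) (auto simp: mat_diag_def)
  then show ?thesis
    by (simp only: E_difference emb_add[OF mat_diag_dim mat_diag_dim] scaleR_add_right)
qed

text \<open>
  Hoelder continuity with exponent \<open>s\<close>: the entries of \<open>E\<close> are Hoelder continuous with exponents at
  least \<open>s\<close>, and all other ingredients are Lipschitz.
\<close>

lemma Proj_difference:
  assumes t: "wrap t \<noteq> 0" "wrap u \<noteq> 0" and ut: "\<bar>u - t\<bar> \<le> pi" "u \<noteq> t"
  shows "norm (emb (Proj u) - emb (Proj t)) \<le> 64 * (2 * K + 1) * L\<^sup>2 * (B1 + 1) * \<bar>u - t\<bar> powr s"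
proof -
  define \<delta> where "\<delta> = 4 * (B1 + 1) * \<bar>u - t\<bar> powr s"
  obtain R T W V H R' T' W' V' H' where
    r: "spectral_split (2 * K + 1) (emb (1\<^sub>m n)) R (emb (Proj t)) T"
      "bordered_resolvent L (emb (1\<^sub>m n)) (emb (1\<^sub>m q)) R (g t) (g' t) (E t) (x t) W V H"
      "spectral_split (2 * K + 1) (emb (1\<^sub>m n)) R' (emb (Proj u)) T'"
      "bordered_resolvent L (emb (1\<^sub>m n)) (emb (1\<^sub>m q)) R' (g u) (g' u) (E u) (x u) W' V' H'"
    using resolvent_at[OF t(1)] resolvent_at[OF t(2)] by blast
  have pos: "0 < \<bar>u - t\<bar>" using ut by simp
  have "\<bar>u - t\<bar> powr 1 \<le> 4 * \<bar>u - t\<bar> powr s"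
    by (rule powr_exponent_le) (use pos ut s in auto)
  then have lin: "\<bar>u - t\<bar> \<le> 4 * \<bar>u - t\<bar> powr s" using pos by simp
  have "B1 * \<bar>u - t\<bar> \<le> (B1 + 1) * (4 * \<bar>u - t\<bar> powr s)"
    using lin B_nonneg by (intro mult_mono) auto
  then have smooth: "B1 * \<bar>u - t\<bar> \<le> \<delta>" by (simp only: \<delta>_def mult_ac)
  have "norm (E u - E t) \<le> 4 * \<bar>u - t\<bar> powr s"
    unfolding E_difference
  proof (rule norm_scaled_diag_le)
    fix l assume l: "l < q"
    have "\<bar>zero_dist_powr (2 * d l) u - zero_dist_powr (2 * d l) t\<bar> \<le> \<bar>u - t\<bar> powr (2 * d l)"
      by (rule zero_dist_powr_holder) (use d[OF l] s in auto)
    also have "\<dots> \<le> 4 * \<bar>u - t\<bar> powr s"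
      by (rule powr_exponent_le) (use pos ut d[OF l] s in auto)
    finally show "\<bar>zero_dist_powr (2 * d l) u - zero_dist_powr (2 * d l) t\<bar> \<le> 4 * \<bar>u - t\<bar> powr s" .
  qed simp
  also have "4 * \<bar>u - t\<bar> powr s = 4 * 1 * \<bar>u - t\<bar> powr s" by simp
  also have "\<dots> \<le> \<delta>"
    unfolding \<delta>_def using B_nonneg by (intro mult_right_mono mult_left_mono) auto
  finally have "norm (R' - R) \<le> 4 * L\<^sup>2 * \<delta>"
    using smooth smooth_differences[of u t]
    by (intro bordered_resolvent_difference_bound(1)[OF r(4,2) _ _ _ _ L_ge_1]) linarith+
  then have "4 * (2 * K + 1) * norm (R' - R) \<le> 4 * (2 * K + 1) * (4 * L\<^sup>2 * \<delta>)"
    using K_nonneg by (intro mult_left_mono) auto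
  then show ?thesis
    using projection_difference_bound[OF r(3,1)] by (simp add: \<delta>_def algebra_simps)
qed

lemma Proj_second_difference_near:
  assumes t: "wrap t \<noteq> 0" "wrap (t + \<eta>) \<noteq> 0" "wrap (t - \<eta>) \<noteq> 0" and \<eta>: "0 < \<eta>" "\<eta> \<le> pi"
  shows "norm ((emb (Proj (t + \<eta>)) - emb (Proj t)) + (emb (Proj (t - \<eta>)) - emb (Proj t)))
    \<le> projection_const K L B1 B2 * \<eta> powr s"
proof -
  have "norm ((emb (Proj (t + \<eta>)) - emb (Proj t)) + (emb (Proj (t - \<eta>)) - emb (Proj t)))
      \<le> 64 * (2 * K + 1) * L\<^sup>2 * (B1 + 1) * \<eta> powr s + 64 * (2 * K + 1) * L\<^sup>2 * (B1 + 1) * \<eta> powr s"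
    using Proj_difference[OF t(1,2)] Proj_difference[OF t(1,3)] \<eta> by (intro norm_triangle_mono) auto
  also have "\<dots> = 128 * (2 * K + 1) * L\<^sup>2 * (B1 + 1) * \<eta> powr s" by simp
  also have "\<dots> \<le> projection_const K L B1 B2 * \<eta> powr s"
    using K_nonneg B_nonneg L_ge_1 by (intro mult_right_mono) (auto simp: projection_const_def)
  finally show ?thesis .
qed

lemma Proj_second_difference_far:
  assumes t: "\<bar>t\<bar> \<le> pi" and \<eta>: "0 < \<eta>" "2 * \<eta> \<le> \<bar>t\<bar>"
  shows "norm ((emb (Proj (t + \<eta>)) - emb (Proj t)) + (emb (Proj (t - \<eta>)) - emb (Proj t)))
    \<le> projection_const K L B1 B2 * (\<eta>\<^sup>2 * \<bar>t\<bar> powr (s - 2))"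
proof -
  have pos: "0 < \<bar>t\<bar>" using \<eta> by linarith
  have "\<bar>t + \<eta>\<bar> < 2 * pi" "\<bar>t - \<eta>\<bar> < 2 * pi" "\<bar>t\<bar> < 2 * pi" "t + \<eta> \<noteq> 0" "t - \<eta> \<noteq> 0"
    using t \<eta> pi_gt_zero by (auto simp: abs_if split: if_splits)
  then have wrap: "wrap t \<noteq> 0" "wrap (t + \<eta>) \<noteq> 0" "wrap (t - \<eta>) \<noteq> 0"
    using pos by (intro wrap_nonzero; force)+
  define \<delta> \<epsilon> where "\<delta> = 32 * (B1 + 1) * (\<eta> * \<bar>t\<bar> powr (s - 1))"
    and "\<epsilon> = 640 * (B2 + 1) * (\<eta>\<^sup>2 * \<bar>t\<bar> powr (s - 2))"
  obtain R T W V H R1 T1 W1 V1 H1 R2 T2 W2 V2 H2 where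
    r: "spectral_split (2 * K + 1) (emb (1\<^sub>m n)) R (emb (Proj t)) T"
      "bordered_resolvent L (emb (1\<^sub>m n)) (emb (1\<^sub>m q)) R (g t) (g' t) (E t) (x t) W V H"
      "spectral_split (2 * K + 1) (emb (1\<^sub>m n)) R1 (emb (Proj (t + \<eta>))) T1"
      "bordered_resolvent L (emb (1\<^sub>m n)) (emb (1\<^sub>m q)) R1 (g (t + \<eta>)) (g' (t + \<eta>)) (E (t + \<eta>)) (x (t + \<eta>)) W1 V1 H1"
      "spectral_split (2 * K + 1) (emb (1\<^sub>m n)) R2 (emb (Proj (t - \<eta>))) T2"
      "bordered_resolvent L (emb (1\<^sub>m n)) (emb (1\<^sub>m q)) R2 (g (t - \<eta>)) (g' (t - \<eta>)) (E (t - \<eta>)) (x (t - \<eta>)) W2 V2 H2"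
    using resolvent_at[OF wrap(1)] resolvent_at[OF wrap(2)] resolvent_at[OF wrap(3)] by blast
  have one: "1 \<le> 4 * \<bar>t\<bar> powr (s - 1)"
    using powr_exponent_le[of "\<bar>t\<bar>" "s - 1" 0] pos t s by simp
  have two: "1 \<le> 16 * \<bar>t\<bar> powr (s - 2)"
    using one powr_exponent_le[of "\<bar>t\<bar>" "s - 2" "s - 1"] pos t by simp
  have "B1 * \<eta> * 1 \<le> (B1 + 1) * \<eta> * (4 * \<bar>t\<bar> powr (s - 1))"
    using one B_nonneg \<eta> by (intro mult_mono) auto
  also have "\<dots> \<le> 8 * ((B1 + 1) * \<eta> * (4 * \<bar>t\<bar> powr (s - 1)))"
    using B_nonneg \<eta> by simp
  also have "\<dots> = \<delta>" by (simp add: \<delta>_def)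
  finally have \<delta>_smooth: "B1 * \<bar>(t + \<eta>) - t\<bar> \<le> \<delta>" "B1 * \<bar>(t - \<eta>) - t\<bar> \<le> \<delta>" using \<eta> by simp_all
  have "2 * B2 * \<eta>\<^sup>2 * 1 \<le> 2 * (B2 + 1) * \<eta>\<^sup>2 * (16 * \<bar>t\<bar> powr (s - 2))"
    using two B_nonneg by (intro mult_mono) auto
  also have "\<dots> \<le> 20 * (2 * (B2 + 1) * \<eta>\<^sup>2 * (16 * \<bar>t\<bar> powr (s - 2)))"
    using B_nonneg by simp
  also have "\<dots> = \<epsilon>" by (simp add: \<epsilon>_def)
  finally have \<epsilon>_smooth: "2 * B2 * \<eta>\<^sup>2 \<le> \<epsilon>" by simp
  have \<delta>0: "0 \<le> \<delta>" "0 \<le> \<epsilon>" using B_nonneg \<eta> by (simp_all add: \<delta>_def \<epsilon>_def)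
  have first: "8 * \<eta> * \<bar>t\<bar> powr (2 * d l - 1) \<le> \<delta>" if l: "l < q" for l
  proof -
    have "8 * \<eta> * \<bar>t\<bar> powr (2 * d l - 1) \<le> 8 * \<eta> * (4 * \<bar>t\<bar> powr (s - 1))"
      using pos t \<eta> d[OF l] s by (intro mult_left_mono powr_exponent_le) auto
    also have "\<dots> = 32 * 1 * (\<eta> * \<bar>t\<bar> powr (s - 1))" by simp
    also have "\<dots> \<le> \<delta>"
      unfolding \<delta>_def using B_nonneg \<eta> by (intro mult_right_mono mult_left_mono) auto
    finally show ?thesis .
  qed
  have second: "160 * \<eta>\<^sup>2 * \<bar>t\<bar> powr (2 * d l - 2) \<le> \<epsilon>" if l: "l < q" for l
  proof -
    have "160 * \<eta>\<^sup>2 * \<bar>t\<bar> powr (2 * d l - 2) \<le> 160 * \<eta>\<^sup>2 * (4 * \<bar>t\<bar> powr (s - 2))"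
      using pos t d[OF l] s by (intro mult_left_mono powr_exponent_le) auto
    also have "\<dots> = 640 * 1 * (\<eta>\<^sup>2 * \<bar>t\<bar> powr (s - 2))" by simp
    also have "\<dots> \<le> \<epsilon>"
      unfolding \<epsilon>_def using B_nonneg by (intro mult_right_mono mult_left_mono) auto
    finally show ?thesis .
  qed
  note zd = zero_dist_powr_differences_abs[OF t pos less_imp_le[OF \<eta>(1)] \<eta>(2)]
  have E1: "norm (E (t + \<eta>) - E t) \<le> \<delta>" "norm (E (t - \<eta>) - E t) \<le> \<delta>"
    unfolding E_difference
    by (rule norm_scaled_diag_le[OF \<delta>0(1)], rule order_trans[OF zd(1) first] order_trans[OF zd(2) first];
        use d s in force)+
  have E2: "norm ((E (t + \<eta>) - E t) + (E (t - \<eta>) - E t)) \<le> \<epsilon>"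
    unfolding E_second_difference
    by (rule norm_scaled_diag_le[OF \<delta>0(2)], rule order_trans[OF zd(3) second]; use d s in force)
  note S1 = order_trans[OF smooth_differences(1) \<delta>_smooth(1)] order_trans[OF smooth_differences(2) \<delta>_smooth(1)]
      E1(1) order_trans[OF smooth_differences(3) \<delta>_smooth(1)]
    and S2 = order_trans[OF smooth_differences(1) \<delta>_smooth(2)] order_trans[OF smooth_differences(2) \<delta>_smooth(2)]
      E1(2) order_trans[OF smooth_differences(3) \<delta>_smooth(2)]
  note ss = smooth_second_differences[OF less_imp_le[OF \<eta>(1)]]
  have nR: "norm (R1 - R) \<le> 4 * L\<^sup>2 * \<delta>" "norm (R2 - R) \<le> 4 * L\<^sup>2 * \<delta>"
    by (rule bordered_resolvent_difference_bound(1)[OF r(4,2) S1 L_ge_1]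
        bordered_resolvent_difference_bound(1)[OF r(6,2) S2 L_ge_1])+
  have nRR: "norm ((R1 - R) + (R2 - R)) \<le> 4 * L\<^sup>2 * \<epsilon> + 56 * L ^ 5 * \<delta>\<^sup>2"
    by (rule bordered_resolvent_second_difference_bound[OF r(2,4,6) S1 S2 order_trans[OF ss(1) \<epsilon>_smooth]
          order_trans[OF ss(2) \<epsilon>_smooth] E2 order_trans[OF ss(3) \<epsilon>_smooth] L_ge_1])
  have "norm ((emb (Proj (t + \<eta>)) - emb (Proj t)) + (emb (Proj (t - \<eta>)) - emb (Proj t)))
      \<le> 4 * (2 * K + 1) * (4 * L\<^sup>2 * \<epsilon> + 56 * L ^ 5 * \<delta>\<^sup>2) + 128 * (2 * K + 1)\<^sup>2 * (4 * L\<^sup>2 * \<delta>)\<^sup>2"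
    by (rule projection_second_difference_bound[OF r(1,3,5) nR nRR])
  also have "\<dots> = 4 * (2 * K + 1) * (4 * L\<^sup>2 * \<epsilon> + 56 * L ^ 5 * \<delta>\<^sup>2) + 128 * (2 * K + 1)\<^sup>2 * (4 * L\<^sup>2)\<^sup>2 * \<delta>\<^sup>2"
    by (simp add: power_mult_distrib)
  also have "\<delta>\<^sup>2 \<le> 4096 * (B1 + 1)\<^sup>2 * (\<eta>\<^sup>2 * \<bar>t\<bar> powr (s - 2))"
  proof -
    have "\<delta>\<^sup>2 = 1024 * (B1 + 1)\<^sup>2 * \<eta>\<^sup>2 * \<bar>t\<bar> powr (2 * s - 2)"
    proof -
      have "(\<bar>t\<bar> powr (s - 1))\<^sup>2 = \<bar>t\<bar> powr (2 * s - 2)"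
        using pos by (simp add: power2_eq_square flip: powr_add)
      then show ?thesis by (simp only: \<delta>_def power_mult_distrib) simp
    qed
    also have "\<dots> \<le> 1024 * (B1 + 1)\<^sup>2 * \<eta>\<^sup>2 * (4 * \<bar>t\<bar> powr (s - 2))"
      using pos t s by (intro mult_left_mono powr_exponent_le) auto
    finally show ?thesis by simp
  qed
  then have "4 * (2 * K + 1) * (4 * L\<^sup>2 * \<epsilon> + 56 * L ^ 5 * \<delta>\<^sup>2) + 128 * (2 * K + 1)\<^sup>2 * (4 * L\<^sup>2)\<^sup>2 * \<delta>\<^sup>2
      \<le> 4 * (2 * K + 1) * (4 * L\<^sup>2 * \<epsilon> + 56 * L ^ 5 * (4096 * (B1 + 1)\<^sup>2 * (\<eta>\<^sup>2 * \<bar>t\<bar> powr (s - 2))))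
        + 128 * (2 * K + 1)\<^sup>2 * (4 * L\<^sup>2)\<^sup>2 * (4096 * (B1 + 1)\<^sup>2 * (\<eta>\<^sup>2 * \<bar>t\<bar> powr (s - 2)))"
    using K_nonneg L_ge_1 by (intro add_mono mult_left_mono order_refl) auto
  also have "\<dots> = (4 * (2 * K + 1) * (4 * L\<^sup>2 * (640 * (B2 + 1)) + 56 * L ^ 5 * (4096 * (B1 + 1)\<^sup>2))
        + 128 * (2 * K + 1)\<^sup>2 * (4 * L\<^sup>2)\<^sup>2 * (4096 * (B1 + 1)\<^sup>2)) * (\<eta>\<^sup>2 * \<bar>t\<bar> powr (s - 2))"
    unfolding \<epsilon>_def by (simp only: distrib_left distrib_right mult.assoc)
  also have "\<dots> \<le> projection_const K L B1 B2 * (\<eta>\<^sup>2 * \<bar>t\<bar> powr (s - 2))"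
    using K_nonneg B_nonneg L_ge_1 by (intro mult_right_mono) (auto simp: projection_const_def)
  finally show ?thesis .
qed

text \<open>
  Duality reduces the norm of the vector \<open>c\<close> of coefficients to a scalar function: its squared norm is
  the Fourier coefficient of \<open>F t = (Proj t *\<^sub>v w) $ i\<close> with \<open>w\<close> the conjugate of \<open>c\<close>, up to the factor
  \<open>2 \<pi>\<close>.  The second differences of \<open>F\<close> are bounded by those of the projection times \<open>vnorm c\<close>, so
  one factor \<open>vnorm c\<close> cancels.
\<close>

lemma K_coeff_bound:
  assumes i: "i < n" and h: "h \<noteq> 0"
  shows "vnorm (K_coeff q p n i h)
    \<le> 16 * projection_const K L B1 B2 * (1 + 1 / (1 - s)) * real_of_int \<bar>h\<bar> powr (- 1 - s)"
proof -
  define c where "c = K_coeff q p n i h"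
  have c: "c \<in> carrier_vec n" by (simp add: c_def K_coeff_def)
  define \<eta> where "\<eta> = pi / real_of_int \<bar>h\<bar>"
  have h1: "1 \<le> real_of_int \<bar>h\<bar>" using h by simp
  then have \<eta>: "0 < \<eta>" "\<eta> \<le> pi" unfolding \<eta>_def by (auto simp: divide_le_eq)
  define w where "w = conjugate c"
  have w: "w \<in> carrier_vec n" and w_index: "k < n \<Longrightarrow> w $ k = cnj (c $ k)" for k
    using c by (simp_all add: w_def conjugate_complex_def)
  have nw: "vnorm w = vnorm c"
    using c by (auto simp: vnorm_def w_def conjugate_complex_def intro!: L2_set_cong)
  define F where "F t = (Proj t *\<^sub>v w) $ i" for t
  have F_periodic: "F (t + 2 * pi) = F t" for t
    by (simp add: F_def Proj_def wrap_periodic)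
  have F_eq: "F t = (\<Sum>k<n. K_row q p n i t $ k * cnj (c $ k))" if "t \<in> freq" for t
    using i w by (auto simp: F_def Proj_def scalar_prod_def K_row_def wrap_eq[OF that] w_index atLeast0LessThan)
  let ?e = "\<lambda>t. cis (- (of_int h * t))"
  have piece: "set_integrable lborel freq (\<lambda>t. K_row q p n i t $ k * cnj (c $ k) * ?e t)"
    "(LINT t:freq|lborel. K_row q p n i t $ k * cnj (c $ k) * ?e t) = 2 * pi * (c $ k * cnj (c $ k))"
    if k: "k < n" for k
    \<comment> \<open>If the integrand of an entry is not integrable, its
        integral and hence \<open>c $ k\<close> is 0 by convention, and the term of \<open>F\<close> vanishes identically.\<close>
  proof (atomize (full), cases "c $ k = 0")
    case False
    have ck: "c $ k = complex_of_real (1 / (2 * pi)) * (LINT t:freq|lborel. K_row q p n i t $ k * ?e t)"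
      using k by (simp add: c_def K_coeff_def)
    have "set_integrable lborel freq (\<lambda>t. K_row q p n i t $ k * ?e t)"
    proof (rule ccontr)
      assume "\<not> ?thesis"
      then have "(LINT t:freq|lborel. K_row q p n i t $ k * ?e t) = 0"
        unfolding set_integrable_def set_lebesgue_integral_def by (rule not_integrable_integral_eq)
      with ck False show False by simp
    qed
    moreover have "(\<lambda>t. K_row q p n i t $ k * cnj (c $ k) * ?e t) = (\<lambda>t. cnj (c $ k) * (K_row q p n i t $ k * ?e t))"
      by (simp add: fun_eq_iff)
    moreover have "(LINT t:freq|lborel. K_row q p n i t $ k * ?e t) = 2 * pi * c $ k"
      unfolding ck by simp
    then have "cnj (c $ k) * (LINT t:freq|lborel. K_row q p n i t $ k * ?e t) = 2 * pi * (c $ k * cnj (c $ k))"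
      by (simp only: mult_ac)
    ultimately show "set_integrable lborel freq (\<lambda>t. K_row q p n i t $ k * cnj (c $ k) * ?e t) \<and>
      (LINT t:freq|lborel. K_row q p n i t $ k * cnj (c $ k) * ?e t) = 2 * pi * (c $ k * cnj (c $ k))"
      by simp
  qed (simp add: set_integrable_def set_lebesgue_integral_def)
  have freq_eq: "indicator freq t *\<^sub>R (F t * ?e t)
      = (\<Sum>k<n. indicator freq t *\<^sub>R (K_row q p n i t $ k * cnj (c $ k) * ?e t))" for t
    using F_eq[of t] by (cases "t \<in> freq") (simp_all add: sum_distrib_right)
  have int: "set_integrable lborel freq (\<lambda>t. F t * ?e t)"
    unfolding set_integrable_def freq_eq
    by (rule Bochner_Integration.integrable_sum) (use piece(1) in \<open>simp add: set_integrable_def\<close>)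
  have "(LINT t:freq|lborel. F t * ?e t) = (\<Sum>k<n. 2 * pi * (c $ k * cnj (c $ k)))"
    unfolding set_lebesgue_integral_def freq_eq
    by (subst Bochner_Integration.integral_sum)
      (use piece in \<open>simp_all add: set_integrable_def set_lebesgue_integral_def\<close>)
  also have "\<dots> = 2 * pi * (c \<bullet>c c)"
    using c by (simp add: cscalar_prod_eq_sum sum_distrib_left)
  also have "\<dots> = complex_of_real (2 * pi * (vnorm c)\<^sup>2)"
    by (simp add: cscalar_prod_self)
  finally have coeff: "(LINT t:freq|lborel. F t * ?e t) = complex_of_real (2 * pi * (vnorm c)\<^sup>2)" .
  define A where "A = projection_const K L B1 B2 * vnorm c"
  have const: "0 \<le> projection_const K L B1 B2"
    using K_nonneg B_nonneg L_ge_1 by (simp add: projection_const_def)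
  have bilinear: "cmod ((F u - F t) + (F v - F t))
      \<le> norm ((emb (Proj u) - emb (Proj t)) + (emb (Proj v) - emb (Proj t))) * vnorm c" for u v t
  proof -
    let ?D = "(Proj u - Proj t) + (Proj v - Proj t)"
    have D: "?D \<in> carrier_mat n n" by (intro add_carrier_mat minus_carrier_mat Proj_carrier)
    have row: "(A *\<^sub>v w) $ i = (\<Sum>k<n. A $$ (i, k) * w $ k)" if "A \<in> carrier_mat n n" for A
      using that i w by (auto simp: scalar_prod_def atLeast0LessThan)
    have "(F u - F t) + (F v - F t) = (?D *\<^sub>v w) $ i"
      unfolding F_def row[OF Proj_carrier] row[OF D] sum_subtractf[symmetric] sum.distrib[symmetric]
      by (rule sum.cong) (use i in \<open>simp_all add: algebra_simps\<close>)
    also have "cmod \<dots> \<le> vnorm (?D *\<^sub>v w)"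
      by (rule norm_index_le_vnorm) (use i in simp)
    also have "\<dots> \<le> norm (emb ?D) * vnorm w"
      by (rule vnorm_mult_mat_vec_le) (use w in simp)
    also have "emb ?D = (emb (Proj u) - emb (Proj t)) + (emb (Proj v) - emb (Proj t))"
      by (simp only: emb_add[OF minus_carrier_mat[OF Proj_carrier] minus_carrier_mat[OF Proj_carrier]]
          emb_minus[OF Proj_carrier Proj_carrier])
    finally show ?thesis by (simp add: nw)
  qed
  have "cmod (LINT t:freq|lborel. F t * ?e t)
      \<le> 16 * A * (1 + 1 / (1 - s)) * real_of_int \<bar>h\<bar> powr (- 1 - s)"
  proof (rule fourier_coefficient_decay[OF F_periodic h int s, folded \<eta>_def])
    show "0 \<le> A" by (simp add: A_def const)
    show "finite {0, \<eta>, - \<eta>, 2 * pi - \<eta>, \<eta> - 2 * pi}" by simp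
  next
    fix t assume t: "t \<in> freq - {0, \<eta>, - \<eta>, 2 * pi - \<eta>, \<eta> - 2 * pi}"
    then have "wrap t \<noteq> 0" "wrap (t + \<eta>) \<noteq> 0" "wrap (t - \<eta>) \<noteq> 0"
      using \<eta> by - (rule wrap_nonzero; auto simp: freq_def abs_if)+
    from Proj_second_difference_near[OF this \<eta>]
    have "cmod ((F (t + \<eta>) - F t) + (F (t - \<eta>) - F t)) \<le> projection_const K L B1 B2 * \<eta> powr s * vnorm c"
      by (intro order_trans[OF bilinear] mult_right_mono) auto
    then show "cmod ((F (t + \<eta>) - F t) + (F (t - \<eta>) - F t)) \<le> A * \<eta> powr s"
      by (simp only: A_def mult_ac)
  next
    fix t assume t: "t \<in> freq - {0, \<eta>, - \<eta>, 2 * pi - \<eta>, \<eta> - 2 * pi}" "2 * \<eta> \<le> \<bar>t\<bar>"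
    then have "\<bar>t\<bar> \<le> pi" by (auto simp: freq_def)
    from Proj_second_difference_far[OF this \<eta>(1) t(2)]
    have "cmod ((F (t + \<eta>) - F t) + (F (t - \<eta>) - F t))
        \<le> projection_const K L B1 B2 * (\<eta>\<^sup>2 * \<bar>t\<bar> powr (s - 2)) * vnorm c"
      by (intro order_trans[OF bilinear] mult_right_mono) auto
    then show "cmod ((F (t + \<eta>) - F t) + (F (t - \<eta>) - F t)) \<le> A * (\<eta>\<^sup>2 * \<bar>t\<bar> powr (s - 2))"
      by (simp only: A_def mult_ac)
  qed
  then have le: "2 * pi * (vnorm c)\<^sup>2 \<le> 16 * A * (1 + 1 / (1 - s)) * real_of_int \<bar>h\<bar> powr (- 1 - s)"
    unfolding coeff norm_of_real by simp
  let ?M = "16 * projection_const K L B1 B2 * (1 + 1 / (1 - s)) * real_of_int \<bar>h\<bar> powr (- 1 - s)"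
  have "vnorm c * vnorm c \<le> 2 * pi * (vnorm c)\<^sup>2"
    using pi_gt3 mult_right_mono[of 1 "2 * pi" "(vnorm c)\<^sup>2"] by (simp add: power2_eq_square)
  also note le
  also have "16 * A * (1 + 1 / (1 - s)) * real_of_int \<bar>h\<bar> powr (- 1 - s) = ?M * vnorm c"
    by (simp only: A_def mult_ac)
  finally have le': "vnorm c * vnorm c \<le> ?M * vnorm c" .
  have "vnorm c \<le> ?M"
  proof (cases "vnorm c = 0")
    case True
    then show ?thesis using const s by simp
  next
    case False
    then have "0 < vnorm c" using vnorm_nonneg[of c] by linarith
    with le' show ?thesis by (rule mult_right_le_imp_le)
  qed
  then show ?thesis by (simp only: c_def)
qed

end

section \<open>The long-memory dynamic factor model\<close>

lemma d_ord_last: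
  assumes q: "0 < q"
  shows "\<exists>l<q. d_ord q d q = d l" and "l < q \<Longrightarrow> d_ord q d q \<le> d l"
proof -
  let ?s = "sort (map d [0..<q])"
  have len: "length ?s = q" by simp
  have first: "d_ord q d q = ?s ! 0"
    using q by (simp add: d_ord_def rev_nth)
  have "?s ! 0 \<in> set ?s" using q len by (intro nth_mem) simp
  then show "\<exists>l<q. d_ord q d q = d l" unfolding first by auto
  assume "l < q"
  then have "d l \<in> set ?s" by simp
  then obtain k where "k < q" "?s ! k = d l" using len by (metis in_set_conv_nth)
  moreover have "?s ! 0 \<le> ?s ! k" by (rule sorted_nth_mono) (use \<open>k < q\<close> len in auto)
  ultimately show "d_ord q d q \<le> d l" by (simp add: first)
qed

text \<open>
  The gap \<open>\<alpha>\<close> between \<open>q\<close> and \<open>q + 1\<close> is one of the terms of the minimum that defines \<open>rho\<close> at \<open>q\<close>; it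
  equals \<open>2 d_ord q d q\<close> because \<open>d_ord\<close> vanishes at \<open>q + 1\<close>.
\<close>

lemma rho_le_last_gap:
  assumes q: "0 < q" and nonneg: "0 \<le> d_ord q d q"
  shows "rho q d q \<le> 2 * d_ord q d q"
proof -
  obtain m where m: "q = Suc m" using q by (cases q) auto
  have "rho q d (Suc m) \<le> gap q d (Suc m) (Suc (Suc m))"
    unfolding rho.simps by (rule Min_le) auto
  moreover have "gap q d (Suc m) (Suc (Suc m)) = 2 * d_ord q d q"
    using nonneg by (simp add: gap_def m d_ord_def)
  ultimately show ?thesis by (simp add: m)
qed

lemma loewner_lower_bound_coercive:
  assumes G: "G \<in> carrier_mat n q" and n: "0 < n" and w: "w \<in> carrier_vec q"
    and le: "loewner_le (complex_of_real c \<cdot>\<^sub>m 1\<^sub>m q)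
      (complex_of_real (1 / real n) \<cdot>\<^sub>m (mat_adjoint G * G))"
  shows "real n * c * (vnorm w)\<^sup>2 \<le> (vnorm (G *\<^sub>v w))\<^sup>2"
proof -
  let ?M = "mat_adjoint G * G"
  let ?S = "complex_of_real (1 / real n) \<cdot>\<^sub>m ?M" and ?I = "complex_of_real c \<cdot>\<^sub>m 1\<^sub>m q"
  have Ga: "mat_adjoint G \<in> carrier_mat q n" using G by simp
  have M: "?M \<in> carrier_mat q q" by (rule mult_carrier_mat[OF Ga G])
  have S: "?S \<in> carrier_mat q q" and I: "?I \<in> carrier_mat q q" using M by simp_all
  have Mw: "?M *\<^sub>v w \<in> carrier_vec q" by (rule mult_mat_vec_carrier[OF M w])
  note form = gram_form[OF G w]
  have scal: "(a \<cdot>\<^sub>v v) \<bullet>c w = a * (v \<bullet>c w)" if "v \<in> carrier_vec q" for a :: complex and v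
    using that w by (simp add: cscalar_prod_eq_sum sum_distrib_left mult.assoc)
  have "?S *\<^sub>v w = complex_of_real (1 / real n) \<cdot>\<^sub>v (?M *\<^sub>v w)" "?I *\<^sub>v w = complex_of_real c \<cdot>\<^sub>v w"
    using G w by (simp_all add: smult_mat_mult_vec)
  then have "((?S - ?I) *\<^sub>v w) \<bullet>c w = complex_of_real (1 / real n * (vnorm (G *\<^sub>v w))\<^sup>2 - c * (vnorm w)\<^sup>2)"
    unfolding cscalar_prod_minus_mult(1)[OF S I w w] by (simp add: scal[OF Mw] scal[OF w] form cscalar_prod_self)
  moreover have "0 \<le> Re (((?S - ?I) *\<^sub>v w) \<bullet>c w)"
    using le w I unfolding loewner_le_def psd_def by simp
  ultimately have "c * (vnorm w)\<^sup>2 \<le> 1 / real n * (vnorm (G *\<^sub>v w))\<^sup>2" by simp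
  then show ?thesis using n by (simp add: field_simps)
qed

lemma (in row_eigenbasis) hermitian: "mat_adjoint A = A"
proof -
  let ?L = "mat_diag n (\<lambda>j. complex_of_real (lam j))"
  have L: "mat_adjoint ?L = ?L" "dim_row ?L = n" "dim_col ?L = n"
    by (auto intro!: eq_matI simp: mat_diag_def)
  have "A = (mat_adjoint U * U) * A" using A by (simp add: adjoint_U)
  also have "\<dots> = mat_adjoint U * (?L * U)"
    unfolding U_mult_A[symmetric] by (rule assoc_mult_mat) (use A in auto)
  finally have A_eq: "A = mat_adjoint U * (?L * U)" .
  have "mat_adjoint A = mat_adjoint U * ?L * U"
    unfolding A_eq by (subst mat_adjoint_mult, simp add: L)+ (simp add: L)
  also have "\<dots> = A"
    unfolding A_eq by (rule assoc_mult_mat[OF _ mat_diag_dim]) auto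
  finally show ?thesis .
qed

lemma mat_adjoint_factor_part:
  assumes G: "G \<in> carrier_mat n q"
  shows "mat_adjoint (G * mat_diag q (\<lambda>l. complex_of_real (c l)) * mat_adjoint G)
    = G * mat_diag q (\<lambda>l. complex_of_real (c l)) * mat_adjoint G"
proof -
  let ?D = "mat_diag q (\<lambda>l. complex_of_real (c l))"
  have D: "mat_adjoint ?D = ?D"
    by (rule eq_matI) (auto simp: mat_diag_def)
  have "mat_adjoint (G * ?D * mat_adjoint G) = G * mat_adjoint (G * ?D)"
    using G by (subst mat_adjoint_mult) (simp_all add: mat_diag_def)
  also have "mat_adjoint (G * ?D) = ?D * mat_adjoint G"
    using G by (subst mat_adjoint_mult) (simp_all only: D, simp_all add: mat_diag_def)
  also have "G * (?D * mat_adjoint G) = G * ?D * mat_adjoint G"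
    by (rule assoc_mult_mat[symmetric, OF G mat_diag_dim mat_adjoint_carrier[OF G]])
  finally show ?thesis .
qed

text \<open>
  What remains is to extract constants that do not depend on \<open>n\<close>.  The eigenvalue bounds of the
  idiosyncratic spectral density become an operator norm bound because it is Hermitian, being the difference
  of the Hermitian matrices \<open>Sig\<close> and \<open>Sig_chi\<close>.
\<close>

theorem lemmaD4:
  fixes M :: "'w measure" and q :: nat
    and b g :: "nat \<Rightarrow> nat \<Rightarrow> int \<Rightarrow> real"
    and dd :: "nat \<Rightarrow> nat \<Rightarrow> real" and d :: "nat \<Rightarrow> real"
    and u \<chi> \<xi> x :: "'w process"
    and B :: "nat \<Rightarrow> int \<Rightarrow> real mat" and eps :: "nat \<Rightarrow> 'w process"
    and Sig_chi Sig_xi Sig :: "nat \<Rightarrow> real \<Rightarrow> complex mat"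
    and lam :: "nat \<Rightarrow> nat \<Rightarrow> real \<Rightarrow> real" and p :: "nat \<Rightarrow> nat \<Rightarrow> real \<Rightarrow> complex Matrix.vec"
  assumes "dfm_model M q b u \<chi> \<xi> x B eps Sig_chi Sig_xi Sig"
    and "long_memory q b dd g"
    and "pervasiveness q g"
    and "memory_structure q dd g d Sig_chi"
    and "idiosyncratic M eps Sig_xi"
    and "gap_dominance q d"
    and "\<And>n \<theta>. \<theta> \<in> freq - {0} \<Longrightarrow>
           ordered_row_eigenbasis n (Sig n \<theta>) (\<lambda>j. lam n j \<theta>) (\<lambda>j. p n j \<theta>)"
  shows "\<exists>C N. \<forall>n\<ge>N. \<forall>i<n. \<forall>h::int. h \<noteq> 0 \<longrightarrow>
           vnorm (K_coeff q p n i h) \<le> C * real_of_int \<bar>h\<bar> powr (- 1 - rho q d q)"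
proof (cases "q = 0")
  case True
  then have "vnorm (K_coeff q p n i h) = 0" for n i h
    by (simp add: K_coeff_def K_row_def vnorm_def L2_set_def set_lebesgue_integral_def)
  then show ?thesis by (intro exI[of _ 0]) simp
next
  case False
  then have q: "0 < q" by simp
  note model = assms(1) and lm = assms(2) and perv = assms(3) and mem = assms(4) and idio = assms(5)
    and eigen = assms(7)
  have dl: "0 \<le> d l" "2 * d l < 1" if "l < q" for l
    using lm mem that by (force simp: long_memory_def memory_structure_def)+
  define s where "s = 2 * d_ord q d q"
  have s: "0 \<le> s" "s < 1"
    using d_ord_last(1)[OF q, of d] dl by (auto simp: s_def)
  have sd: "s \<le> 2 * d l" if "l < q" for l
    using d_ord_last(2)[OF q that, of d] by (simp add: s_def)
  have rho: "rho q d q \<le> s"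
    unfolding s_def by (rule rho_le_last_gap[OF q]) (use s in \<open>simp add: s_def\<close>)
  obtain sl su C1 C2 LG N0 where sl: "0 < sl" and perv_n: "\<And>n. N0 \<le> n \<Longrightarrow>
      (\<forall>\<theta>\<in>freq. loewner_le (complex_of_real sl \<cdot>\<^sub>m 1\<^sub>m q) (S_mat q g n \<theta>) \<and>
                    loewner_le (S_mat q g n \<theta>) (complex_of_real su \<cdot>\<^sub>m 1\<^sub>m q)) \<and>
          (\<forall>\<theta>\<in>freq. op_norm (mat_deriv n q (G_mat q g n) \<theta>) \<le> C1 * sqrt (real n)) \<and>
          (\<forall>\<theta>\<in>freq. op_norm (mat_deriv n q (mat_deriv n q (G_mat q g n)) \<theta>) \<le> C2 * sqrt (real n)) \<and>
          (\<forall>\<theta>\<^sub>1\<in>freq. \<forall>\<theta>\<^sub>2\<in>freq.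
             op_norm (G_mat q g n \<theta>\<^sub>2 - G_mat q g n \<theta>\<^sub>1) \<le> sqrt (real n) * LG * \<bar>\<theta>\<^sub>2 - \<theta>\<^sub>1\<bar>)"
    using perv unfolding pervasiveness_def eventually_sequentially by metis
  obtain l1 l2 D1 D2 where
    ev: "\<And>n \<theta> k. \<theta> \<in> freq \<Longrightarrow> eigenvalue (Sig_xi n \<theta>) k \<Longrightarrow> k \<in> complex_of_real ` {l1..l2}"
    and xi_deriv: "\<And>n \<theta>. \<theta> \<in> freq \<Longrightarrow> op_norm (mat_deriv n n (Sig_xi n) \<theta>) \<le> D1"
      "\<And>n \<theta>. \<theta> \<in> freq \<Longrightarrow> op_norm (mat_deriv n n (mat_deriv n n (Sig_xi n)) \<theta>) \<le> D2"
    using idio unfolding idiosyncratic_def by metis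
  have xi_periodic: "Sig_xi n (\<theta> + 2 * pi) = Sig_xi n \<theta>" and xi_smooth: "mat_twice_differentiable n n (Sig_xi n)" for n \<theta>
    using idio unfolding idiosyncratic_def by metis+
  define K where "K = \<bar>l1\<bar> + \<bar>l2\<bar>"
  define B1 B2 where "B1 = max C1 D1" and "B2 = max C2 D2"
  \<comment> \<open>\<open>N\<close> ensures \<open>q \<le> n\<close>, the bounds of pervasiveness, and that the leading eigenvalues,
      which exceed a multiple of \<open>n sl\<close>, are separated from the bulk.\<close>
  define N where "N = max (max N0 (Suc q)) (nat \<lceil>(8 * K + 4) / sl\<rceil>)"
  define L0 where "L0 = (2 * K + 2) * (1 + 1 / sqrt sl)"
  define C where "C = 16 * projection_const K L0 B1 B2 * (1 + 1 / (1 - s))"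
  have G_carrier: "G_mat q g n \<theta> \<in> carrier_mat n q" for n \<theta>
    by (simp add: G_mat_def)
  have G_periodic: "G_mat q g n (\<theta> + 2 * pi) = G_mat q g n \<theta>" for n \<theta>
  proof -
    have "cis (- (of_int k * (\<theta> + 2 * pi))) = cis (- (of_int k * \<theta>))" for k :: int
      using cis_multiple_2pi[of "of_int (- k)"] cis_mult[of "- (of_int k * \<theta>)" "2 * pi * of_int (- k)"]
      by (simp add: algebra_simps)
    then show ?thesis by (simp add: G_mat_def)
  qed
  have xi_carrier_freq: "Sig_xi n \<theta> \<in> carrier_mat n n" if "\<theta> \<in> freq" for n \<theta>
  proof -
    have "spectral_density M n \<xi> (Sig_xi n)"
      using model by (simp only: dfm_model_def)
    then show ?thesis using that by (simp only: spectral_density_def)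
  qed
  have xi_carrier: "Sig_xi n \<theta> \<in> carrier_mat n n" for n \<theta>
    using xi_carrier_freq[OF wrap_freq, of n \<theta>] periodic_wrap[of "Sig_xi n" \<theta>, OF xi_periodic] by simp
  have main: "vnorm (K_coeff q p n i h) \<le> C * real_of_int \<bar>h\<bar> powr (- 1 - s)"
    if n: "N \<le> n" and i: "i < n" and h: "h \<noteq> 0" for n i and h :: int
  proof -
    have nN: "N0 \<le> n" "q \<le> n" "0 < n" "(8 * K + 4) / sl \<le> real n"
      using n by (auto simp: N_def nat_le_iff ceiling_le_iff)
    interpret long_memory_spectrum q n "G_mat q g n" "Sig_xi n" "Sig n" "\<lambda>j. lam n j" p d K sl B1 B2 s
    proof
      show "G_mat q g n t \<in> carrier_mat n q" "Sig_xi n t \<in> carrier_mat n n"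
        "G_mat q g n (t + 2 * pi) = G_mat q g n t" "Sig_xi n (t + 2 * pi) = Sig_xi n t"
        "mat_twice_differentiable n n (Sig_xi n)" for t
        by (fact G_carrier xi_carrier G_periodic xi_periodic xi_smooth)+
      show "mat_twice_differentiable n q (G_mat q g n)"
        using perv by (simp add: pervasiveness_def)
      show "norm (emb (mat_deriv n q (G_mat q g n) t)) \<le> B1 * sqrt n" if "t \<in> freq" for t
        using perv_n[OF nN(1)] that mult_right_mono[of C1 B1 "sqrt n"]
        by (fastforce simp: op_norm_eq_norm_emb B1_def)
      show "norm (emb (mat_deriv n q (mat_deriv n q (G_mat q g n)) t)) \<le> B2 * sqrt n" if "t \<in> freq" for t
        using perv_n[OF nN(1)] that mult_right_mono[of C2 B2 "sqrt n"]
        by (fastforce simp: op_norm_eq_norm_emb B2_def)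
      show "norm (emb (mat_deriv n n (Sig_xi n) t)) \<le> B1"
        "norm (emb (mat_deriv n n (mat_deriv n n (Sig_xi n)) t)) \<le> B2" if "t \<in> freq" for t
        using xi_deriv[OF that, of n] by (auto simp: op_norm_eq_norm_emb B1_def B2_def)
      show "real n * sl * (vnorm w)\<^sup>2 \<le> (vnorm (G_mat q g n t *\<^sub>v w))\<^sup>2"
        if "t \<in> freq" "w \<in> carrier_vec q" for t w
        using perv_n[OF nN(1)] that(1)
        by (intro loewner_lower_bound_coercive[OF G_carrier nN(3) that(2)]) (simp add: S_mat_def)
      have chi: "Sig_chi n t = G_mat q g n t
          * mat_diag q (\<lambda>l. complex_of_real (cmod (1 - cis (- t)) powr (- 2 * d l)))
          * mat_adjoint (G_mat q g n t)" if "t \<in> freq - {0}" for t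
        using mem that by (simp add: memory_structure_def)
      have "Sig n t = Sig_chi n t + Sig_xi n t" if "t \<in> freq - {0}" for t
        using model that by (simp only: dfm_model_def)
      then show S: "Sig n t = G_mat q g n t
          * mat_diag q (\<lambda>l. complex_of_real (cmod (1 - cis (- t)) powr (- 2 * d l)))
          * mat_adjoint (G_mat q g n t) + Sig_xi n t" if "t \<in> freq - {0}" for t
        using that by (simp add: chi)
      show e: "ordered_row_eigenbasis n (Sig n t) (\<lambda>j. lam n j t) (\<lambda>j. p n j t)" if "t \<in> freq - {0}" for t
        by (rule eigen[OF that])
      show "norm (emb (Sig_xi n t)) \<le> K" if t: "t \<in> freq - {0}" for t
        proof (rule hermitian_norm_le_eigenvalue_bound[OF xi_carrier])
          let ?C = "G_mat q g n t
            * mat_diag q (\<lambda>l. complex_of_real (cmod (1 - cis (- t)) powr (- 2 * d l)))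
            * mat_adjoint (G_mat q g n t)"
          have C: "?C \<in> carrier_mat n n"
            by (rule mult_carrier_mat[OF mult_carrier_mat[OF G_carrier mat_diag_dim] mat_adjoint_carrier[OF G_carrier]])
          have "Sig n t \<in> carrier_mat n n"
            unfolding S[OF t] by (rule add_carrier_mat[OF xi_carrier])
          then interpret row_eigenbasis n "Sig n t" "\<lambda>j. lam n j t" "\<lambda>j. p n j t"
            using e[OF t] by unfold_locales
          show "mat_adjoint (Sig_xi n t) = Sig_xi n t"
          proof (rule eq_matI)
            fix i j assume "i < dim_row (Sig_xi n t)" "j < dim_col (Sig_xi n t)"
            then have ij: "i < n" "j < n" using xi_carrier[of n t] by auto
            have transfer: "cnj z = w" if "cnj a = a'" "cnj c = c'" "a = c + z" "a' = c' + w" for a a' c c' z w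
              using that by auto
            have S_herm: "cnj (Sig n t $$ (j, i)) = Sig n t $$ (i, j)"
              using arg_cong[OF hermitian, of "\<lambda>M. M $$ (i, j)"] A ij by simp
            have C_herm: "cnj (?C $$ (j, i)) = ?C $$ (i, j)"
              using arg_cong[OF mat_adjoint_factor_part[OF G_carrier], of "\<lambda>M. M $$ (i, j)"] C ij
              by (metis carrier_matD index_mat_adjoint)
            have sum: "Sig n t $$ (i', j') = ?C $$ (i', j') + Sig_xi n t $$ (i', j')"
              if "i' < n" "j' < n" for i' j'
              unfolding S[OF t] using that xi_carrier[of n t] by (intro index_add_mat(1)) auto
            have "cnj (Sig_xi n t $$ (j, i)) = Sig_xi n t $$ (i, j)"
              by (rule transfer[OF S_herm C_herm sum[OF ij(2,1)] sum[OF ij]])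
            then show "mat_adjoint (Sig_xi n t) $$ (i, j) = Sig_xi n t $$ (i, j)"
              using ij xi_carrier[of n t] by simp
          qed (use xi_carrier[of n t] in auto)
          show "cmod k \<le> K" if "eigenvalue (Sig_xi n t) k" for k
          proof -
            from ev[OF _ that] t obtain r where "k = complex_of_real r" "l1 \<le> r" "r \<le> l2" by auto
            then show ?thesis by (auto simp: K_def)
          qed
        qed (simp add: K_def)
    qed (use q nN sl s sd dl in \<open>auto simp: field_simps\<close>)
    show ?thesis
      using K_coeff_bound[OF i h] unfolding C_def L0_def L_def .
  qed
  show ?thesis
  proof (intro exI[of _ C] exI[of _ N] allI impI)
    fix n i and h :: int assume a: "N \<le> n" "i < n" "h \<noteq> 0"
    have h: "1 \<le> real_of_int \<bar>h\<bar>" using a by simp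
    have "0 < real_of_int \<bar>h\<bar> powr (- 1 - s)" using h by simp
    moreover have "0 \<le> C * real_of_int \<bar>h\<bar> powr (- 1 - s)"
      using main[OF a] vnorm_nonneg order_trans by blast
    ultimately have C: "0 \<le> C" by (simp add: zero_le_mult_iff)
    have "vnorm (K_coeff q p n i h) \<le> C * real_of_int \<bar>h\<bar> powr (- 1 - s)" by (rule main[OF a])
    also have "\<dots> \<le> C * real_of_int \<bar>h\<bar> powr (- 1 - rho q d q)"
      by (intro mult_left_mono powr_mono C) (use rho h in auto)
    finally show "vnorm (K_coeff q p n i h) \<le> C * real_of_int \<bar>h\<bar> powr (- 1 - rho q d q)" .
  qed
qed

end
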